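(* We have $S_{p,a,b}(\mathbb A_\mathbb{Q})^\mathcal{B}=\emptyset$ and in particular $S_{p,a,b}(\mathbb{Q})=\emptyset$.
   Context: Let $p$ be an odd prime and $a,b$ integers with $(a+b-1)^2-4ab=p$, $4a\equiv4b\equiv1\bmod p$, $a\equiv b\equiv1\bmod 2$ and $a\equiv1\bmod 8$. $S_{p,a,b}$ is the quartic del Pezzo surface $y^2-px^2=uv$, $z^2-px^2=(u+v)(au+bv)$ (everywhere locally soluble), and $\mathcal B=\left(p,\frac{z-y}{u}\right)\in\operatorname{Br}S_{p,a,b}$. $S(\mathbb A_{\mathbb Q})^{\mathcal B}$ is the set of adelic points $(P_v)_v$ with $\sum_v\operatorname{inv}_v\mathcal B(P_v)=0$, $\operatorname{inv}_v$ being the local invariant map. *)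

theory Defs
  imports
    Complex_Main
    "HOL-Library.FuncSet"
    "HOL-Library.Poly_Mapping"
    "HOL-Algebra.QuotRing"
    "HOL-Algebra.Module"
    "HOL-Number_Theory.Cong"
begin

datatype place = Infinite | Finite nat

definition places :: "place set" where
  "places = insert Infinite (Finite ` {l. prime l})"

definition padic_val :: "nat \<Rightarrow> rat \<Rightarrow> int" where
  "padic_val l x = int (multiplicity (int l) (fst (quotient_of x)))
     - int (multiplicity (int l) (snd (quotient_of x)))"

fun place_abs :: "place \<Rightarrow> rat \<Rightarrow> real" where
  "place_abs Infinite x = \<bar>real_of_rat x\<bar>"
| "place_abs (Finite l) x = (if x = 0 then 0 else real l powi (- padic_val l x))"

definition cauchy_seqs :: "place \<Rightarrow> (nat \<Rightarrow> rat) set" where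
  "cauchy_seqs v = {s. \<forall>e>0. \<exists>N. \<forall>m\<ge>N. \<forall>n\<ge>N. place_abs v (s m - s n) < e}"

definition null_seqs :: "place \<Rightarrow> (nat \<Rightarrow> rat) set" where
  "null_seqs v = {s. (\<lambda>n. place_abs v (s n)) \<longlonglongrightarrow> 0}"

definition cauchy_ring :: "place \<Rightarrow> (nat \<Rightarrow> rat) ring" where
  "cauchy_ring v = \<lparr>carrier = cauchy_seqs v, monoid.mult = (\<lambda>s t n. s n * t n), one = (\<lambda>_. 1),
     zero = (\<lambda>_. 0), add = (\<lambda>s t n. s n + t n)\<rparr>"

text \<open>The completion \<open>\<rat>\<^sub>v\<close> (the real numbers when \<open>v\<close> is infinite), as Cauchy sequences
  modulo null sequences, and the embedding of the rationals as constant sequences.\<close>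

definition completion :: "place \<Rightarrow> (nat \<Rightarrow> rat) set ring" where
  "completion v = cauchy_ring v Quot null_seqs v"

definition completion_of_rat :: "place \<Rightarrow> rat \<Rightarrow> (nat \<Rightarrow> rat) set" where
  "completion_of_rat v q = null_seqs v +>\<^bsub>cauchy_ring v\<^esub> (\<lambda>_. q)"

definition rat_field :: "rat ring" where
  "rat_field = \<lparr>carrier = UNIV, monoid.mult = (*), one = 1, zero = 0, add = (+)\<rparr>"

datatype coord = Cx | Cy | Cz | Cu | Cv

text \<open>The polynomial ring over the rationals in the five variables \<open>x, y, z, u, v\<close>.\<close>

type_synonym rpoly = "(coord \<Rightarrow>\<^sub>0 nat) \<Rightarrow>\<^sub>0 rat"

definition pvar :: "coord \<Rightarrow> rpoly" where
  "pvar i = Poly_Mapping.single (Poly_Mapping.single i 1) 1"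

definition homogeneous :: "nat \<Rightarrow> rpoly \<Rightarrow> bool" where
  "homogeneous d F \<longleftrightarrow>
     (\<forall>m\<in>Poly_Mapping.keys F. (\<Sum>i\<in>UNIV. Poly_Mapping.lookup m i) = d)"

definition quadric1 :: "int \<Rightarrow> rpoly" where
  "quadric1 p = pvar Cy ^ 2 - of_int p * pvar Cx ^ 2 - pvar Cu * pvar Cv"

definition quadric2 :: "int \<Rightarrow> int \<Rightarrow> int \<Rightarrow> rpoly" where
  "quadric2 p a b = pvar Cz ^ 2 - of_int p * pvar Cx ^ 2
     - (pvar Cu + pvar Cv) * (of_int a * pvar Cu + of_int b * pvar Cv)"

context
  fixes K :: "('k, 'm) ring_scheme" (structure) and emb :: "rat \<Rightarrow> 'k"
begin

definition eval_rpoly :: "rpoly \<Rightarrow> (coord \<Rightarrow> 'k) \<Rightarrow> 'k" where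
  "eval_rpoly F c = (\<Oplus>m\<in>Poly_Mapping.keys F.
     emb (Poly_Mapping.lookup F m) \<otimes> (\<Otimes>i\<in>UNIV. c i [^] Poly_Mapping.lookup m i))"

end

context
  fixes K :: "('k, 'm) ring_scheme" (structure)
begin

definition proj_point :: "(coord \<Rightarrow> 'k) \<Rightarrow> (coord \<Rightarrow> 'k) set" where
  "proj_point c = {(\<lambda>i. t \<otimes> c i) | t. t \<in> carrier K - {\<zero>}}"

end

text \<open>\<open>S(K)\<close> for a field \<open>K\<close> containing the rationals via \<open>emb\<close>: a point of projective 4-space
  is the set of all its vectors of homogeneous coordinates.\<close>

definition surface_points ::
  "('k, 'm) ring_scheme \<Rightarrow> (rat \<Rightarrow> 'k) \<Rightarrow> int \<Rightarrow> int \<Rightarrow> int \<Rightarrow> (coord \<Rightarrow> 'k) set set" where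
  "surface_points K emb p a b = {proj_point K c | c.
     range c \<subseteq> carrier K \<and> c \<noteq> (\<lambda>_. \<zero>\<^bsub>K\<^esub>) \<and>
     eval_rpoly K emb (quadric1 p) c = \<zero>\<^bsub>K\<^esub> \<and> eval_rpoly K emb (quadric2 p a b) c = \<zero>\<^bsub>K\<^esub>}"

abbreviation rational_points :: "int \<Rightarrow> int \<Rightarrow> int \<Rightarrow> (coord \<Rightarrow> rat) set set" where
  "rational_points \<equiv> surface_points rat_field (\<lambda>q. q)"

abbreviation local_points ::
  "place \<Rightarrow> int \<Rightarrow> int \<Rightarrow> int \<Rightarrow> (coord \<Rightarrow> (nat \<Rightarrow> rat) set) set set" where
  "local_points v \<equiv> surface_points (completion v) (completion_of_rat v)"

text \<open>The surface is projective, so its adelic points are the full product of the local points.\<close>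

definition adelic_points ::
  "int \<Rightarrow> int \<Rightarrow> int \<Rightarrow> (place \<Rightarrow> (coord \<Rightarrow> (nat \<Rightarrow> rat) set) set) set" where
  "adelic_points p a b = (\<Pi>\<^sub>E v\<in>places. local_points v p a b)"

definition surface_ideal :: "int \<Rightarrow> int \<Rightarrow> int \<Rightarrow> rpoly set" where
  "surface_ideal p a b = {A * quadric1 p + B * quadric2 p a b | A B. True}"

definition fraction_pairs :: "int \<Rightarrow> int \<Rightarrow> int \<Rightarrow> (rpoly \<times> rpoly) set" where
  "fraction_pairs p a b = {(G, H). (\<exists>d. homogeneous d G \<and> homogeneous d H) \<and> H \<notin> surface_ideal p a b}"

definition ratfun :: "int \<Rightarrow> int \<Rightarrow> int \<Rightarrow> rpoly \<Rightarrow> rpoly \<Rightarrow> (rpoly \<times> rpoly) set" where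
  "ratfun p a b G H = {(G', H') \<in> fraction_pairs p a b. G * H' - G' * H \<in> surface_ideal p a b}"

definition function_field :: "int \<Rightarrow> int \<Rightarrow> int \<Rightarrow> (rpoly \<times> rpoly) set ring" where
  "function_field p a b =
     \<lparr>carrier = {ratfun p a b G H | G H. (G, H) \<in> fraction_pairs p a b},
      monoid.mult = (\<lambda>\<phi> \<psi>. \<Union>(G, H)\<in>\<phi>. \<Union>(G', H')\<in>\<psi>. ratfun p a b (G * G') (H * H')),
      one = ratfun p a b 1 1,
      zero = ratfun p a b 0 1,
      add = (\<lambda>\<phi> \<psi>. \<Union>(G, H)\<in>\<phi>. \<Union>(G', H')\<in>\<psi>. ratfun p a b (G * H' + G' * H) (H * H'))\<rparr>"

text \<open>\<open>\<phi>\<close> is regular at the local point \<open>P\<close> and takes the value \<open>k\<close> there.\<close>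

definition has_value_at ::
  "place \<Rightarrow> (coord \<Rightarrow> (nat \<Rightarrow> rat) set) set \<Rightarrow> (rpoly \<times> rpoly) set \<Rightarrow> (nat \<Rightarrow> rat) set \<Rightarrow> bool" where
  "has_value_at v P \<phi> k \<longleftrightarrow> k \<in> carrier (completion v) \<and>
     (\<exists>(G, H)\<in>\<phi>. \<exists>c\<in>P.
        eval_rpoly (completion v) (completion_of_rat v) H c \<noteq> \<zero>\<^bsub>completion v\<^esub> \<and>
        k \<otimes>\<^bsub>completion v\<^esub> eval_rpoly (completion v) (completion_of_rat v) H c
          = eval_rpoly (completion v) (completion_of_rat v) G c)"

context
  fixes K :: "('k, 'm) ring_scheme" (structure)
begin

text \<open>The algebra \<open>(\<alpha>, \<beta>)\<close> over \<open>K\<close>: coordinates with respect to \<open>1, i, j, ij\<close>, where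
  \<open>i\<^sup>2 = \<alpha>\<close>, \<open>j\<^sup>2 = \<beta>\<close>, \<open>ji = -ij\<close>.\<close>

definition quaternion_algebra :: "'k \<Rightarrow> 'k \<Rightarrow> ('k, 'k \<times> 'k \<times> 'k \<times> 'k) module" where
  "quaternion_algebra \<alpha> \<beta> =
     \<lparr>carrier = carrier K \<times> carrier K \<times> carrier K \<times> carrier K,
      monoid.mult = (\<lambda>(x0, x1, x2, x3) (y0, y1, y2, y3).
        (x0 \<otimes> y0 \<oplus> \<alpha> \<otimes> (x1 \<otimes> y1) \<oplus> \<beta> \<otimes> (x2 \<otimes> y2) \<ominus> (\<alpha> \<otimes> \<beta>) \<otimes> (x3 \<otimes> y3),
         x0 \<otimes> y1 \<oplus> x1 \<otimes> y0 \<oplus> \<beta> \<otimes> (x3 \<otimes> y2 \<ominus> x2 \<otimes> y3),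
         x0 \<otimes> y2 \<oplus> x2 \<otimes> y0 \<oplus> \<alpha> \<otimes> (x1 \<otimes> y3 \<ominus> x3 \<otimes> y1),
         x0 \<otimes> y3 \<oplus> x3 \<otimes> y0 \<oplus> (x1 \<otimes> y2 \<ominus> x2 \<otimes> y1))),
      one = (\<one>, \<zero>, \<zero>, \<zero>),
      zero = (\<zero>, \<zero>, \<zero>, \<zero>),
      add = (\<lambda>(x0, x1, x2, x3) (y0, y1, y2, y3). (x0 \<oplus> y0, x1 \<oplus> y1, x2 \<oplus> y2, x3 \<oplus> y3)),
      smult = (\<lambda>c (x0, x1, x2, x3). (c \<otimes> x0, c \<otimes> x1, c \<otimes> x2, c \<otimes> x3))\<rparr>"

text \<open>Two by two matrices, listed as \<open>(m11, m12, m21, m22)\<close>.\<close>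

definition matrix_algebra2 :: "('k, 'k \<times> 'k \<times> 'k \<times> 'k) module" where
  "matrix_algebra2 =
     \<lparr>carrier = carrier K \<times> carrier K \<times> carrier K \<times> carrier K,
      monoid.mult = (\<lambda>(x11, x12, x21, x22) (y11, y12, y21, y22).
        (x11 \<otimes> y11 \<oplus> x12 \<otimes> y21, x11 \<otimes> y12 \<oplus> x12 \<otimes> y22,
         x21 \<otimes> y11 \<oplus> x22 \<otimes> y21, x21 \<otimes> y12 \<oplus> x22 \<otimes> y22)),
      one = (\<one>, \<zero>, \<zero>, \<one>),
      zero = (\<zero>, \<zero>, \<zero>, \<zero>),
      add = (\<lambda>(x11, x12, x21, x22) (y11, y12, y21, y22).
        (x11 \<oplus> y11, x12 \<oplus> y12, x21 \<oplus> y21, x22 \<oplus> y22)),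
      smult = (\<lambda>c (x11, x12, x21, x22). (c \<otimes> x11, c \<otimes> x12, c \<otimes> x21, c \<otimes> x22))\<rparr>"

definition algebra_isomorphic :: "('k, 'c) module \<Rightarrow> ('k, 'd) module \<Rightarrow> bool" where
  "algebra_isomorphic A B \<longleftrightarrow>
     (\<exists>h\<in>ring_iso A B. \<forall>c\<in>carrier K. \<forall>x\<in>carrier A. h (c \<odot>\<^bsub>A\<^esub> x) = c \<odot>\<^bsub>B\<^esub> h x)"

end

text \<open>The local invariant of the class of a quaternion algebra over \<open>\<rat>\<^sub>v\<close>, as the representative in
  \<open>[0, 1)\<close> of an element of \<open>\<rat>/\<int>\<close>. The invariant map is injective and the class is killed by 2, so
  a non-split algebra has invariant \<open>1/2\<close>, the only element of order 2 of \<open>\<rat>/\<int>\<close>.\<close>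

definition local_inv ::
  "place \<Rightarrow> ((nat \<Rightarrow> rat) set, (nat \<Rightarrow> rat) set \<times> (nat \<Rightarrow> rat) set \<times> (nat \<Rightarrow> rat) set \<times> (nat \<Rightarrow> rat) set) module
     \<Rightarrow> rat" where
  "local_inv v A =
     (if algebra_isomorphic (completion v) A (matrix_algebra2 (completion v)) then 0 else 1 / 2)"

definition brauer_class ::
  "int \<Rightarrow> int \<Rightarrow> int \<Rightarrow> ((rpoly \<times> rpoly) set,
     (rpoly \<times> rpoly) set \<times> (rpoly \<times> rpoly) set \<times> (rpoly \<times> rpoly) set \<times> (rpoly \<times> rpoly) set) module" where
  "brauer_class p a b = quaternion_algebra (function_field p a b)
     (ratfun p a b (of_int p) 1) (ratfun p a b (pvar Cz - pvar Cy) (pvar Cu))"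

text \<open>\<open>i\<close> is the invariant of the value at \<open>P\<close> of the class \<open>\<B>\<close> of \<open>brauer_class\<close>. On the local ring
  at \<open>P\<close> the class \<open>\<B>\<close> is that of an Azumaya quaternion algebra \<open>(\<phi>, \<psi>)\<close> with \<open>\<phi>\<close> and \<open>\<psi>\<close> units
  at \<open>P\<close>, equal to \<open>\<B>\<close> over the function field (Brauer equivalent quaternion algebras are
  isomorphic), and \<open>\<B>(P)\<close> is the class of its fibre \<open>(\<phi>(P), \<psi>(P))\<close>. In particular
  \<open>\<phi> = p\<close>, \<open>\<psi> = (z - y)/u\<close> serves wherever \<open>(z - y)/u\<close> is regular and nonzero. Since the Brauer
  group of the local ring of a smooth point injects into that of the function field, \<open>i\<close> does not
  depend on the choice of \<open>(\<phi>, \<psi>)\<close>.\<close>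

definition has_invariant_at ::
  "int \<Rightarrow> int \<Rightarrow> int \<Rightarrow> place \<Rightarrow> (coord \<Rightarrow> (nat \<Rightarrow> rat) set) set \<Rightarrow> rat \<Rightarrow> bool" where
  "has_invariant_at p a b v P i \<longleftrightarrow>
     (\<exists>\<phi>\<in>carrier (function_field p a b). \<exists>\<psi>\<in>carrier (function_field p a b). \<exists>\<alpha> \<beta>.
        algebra_isomorphic (function_field p a b)
          (quaternion_algebra (function_field p a b) \<phi> \<psi>) (brauer_class p a b) \<and>
        has_value_at v P \<phi> \<alpha> \<and> \<alpha> \<noteq> \<zero>\<^bsub>completion v\<^esub> \<and>
        has_value_at v P \<psi> \<beta> \<and> \<beta> \<noteq> \<zero>\<^bsub>completion v\<^esub> \<and>
        i = local_inv v (quaternion_algebra (completion v) \<alpha> \<beta>))"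

text \<open>Because the invariants are unique, quantifying over all families \<open>\<iota>\<close> just names them; a point at
  which some invariant did not exist would belong to the set. So would a point with infinitely many
  nonzero invariants, by the convention for infinite sums. Emptiness of the set thus includes the
  existence of the invariants and the finiteness of their support. Membership in \<open>\<int>\<close> is vanishing
  in \<open>\<rat>/\<int>\<close>.\<close>

definition brauer_manin_set ::
  "int \<Rightarrow> int \<Rightarrow> int \<Rightarrow> (place \<Rightarrow> (coord \<Rightarrow> (nat \<Rightarrow> rat) set) set) set" where
  "brauer_manin_set p a b = {P \<in> adelic_points p a b.
     \<forall>\<iota>. (\<forall>v\<in>places. has_invariant_at p a b v (P v) (\<iota> v)) \<longrightarrow>
         (\<Sum>v | v \<in> places \<and> \<iota> v \<noteq> 0. \<iota> v) \<in> \<int>}"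

end

theory Submission
  imports Defs "HOL-Number_Theory.Quadratic_Reciprocity"
    "HOL-Computational_Algebra.Polynomial"
begin

text \<open>The local invariant of \<open>\<B>\<close> is \<open>1/2\<close> at every local point over \<open>p\<close> and \<open>0\<close> at every other local
  point, so the invariants of an adelic point never sum to zero.

  The norm forms \<open>uv = y\<^sup>2 - px\<^sup>2\<close> and \<open>4a(z - y)(z + y) = (2au + (a + b - 1)v)\<^sup>2 - pv\<^sup>2\<close> show that
  replacing \<open>u\<close> by \<open>v\<close>, or \<open>z - y\<close> by \<open>4a(z + y)\<close>, does not change the class of \<open>(p, (z - y)/u)\<close>;
  one more tangent hyperplane section of each of the two quadric cones covers the whole surface. The hypotheses
  force \<open>p \<equiv> 5 (mod 8)\<close>. Where \<open>p\<close> is a local square the algebra splits. At the other places \<open>l \<noteq> p\<close> the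
  equations modulo \<open>l\<^sup>3\<close> make \<open>z - y\<close> and one of \<open>u\<close>, \<open>v\<close> units for primitive coordinates, and units are
  norms from the unramified extension. At \<open>p\<close> the equations reduce to \<open>y\<^sup>2 = uv\<close> and \<open>(2z)\<^sup>2 = (u + v)\<^sup>2\<close>,
  whence \<open>2eu(z - y) = (u - ey)\<^sup>2\<close> with \<open>e = \<plusminus>1\<close>; as \<open>2\<close> is a non-residue, so is \<open>(z - y)/u\<close>, and the
  algebra is ramified. For rational points the same facts contradict quadratic reciprocity directly.\<close>

section \<open>Quaternion algebras over a field\<close>

text \<open>\<open>brauer_manin_set\<close> quantifies over all families of invariants, so one
  family with sum 1/2 excludes an adelic point. The obstacle is that such a family must exist at
  every local point, also where (z - y)/u has a zero or a pole, and that each member must come from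
  an isomorphism of algebras over the function field. Hence the homogeneous coordinate ring has to
  be an integral domain, and enough linear forms have to be available that some quotient of them is
  a unit at any given point. Splitting is always certified by an explicit norm; non-splitting is
  reduced to the absence of an isotropic pure quaternion, which congruences can decide. The
  congruence p = 5 modulo 8 is the discriminant equation for odd a and b. It acts three times: 2 is
  a non-residue modulo p; -1 is a residue, so the sign e at p is harmless; and 2 is inert in the
  field generated by the square root of p. The equations are used modulo \<open>l ^ 3\<close>
  because l = 2 demands precision 8.\<close>

lemma (in abelian_group) diff_eq_iff:
  assumes "a \<in> carrier G" "b \<in> carrier G" "c \<in> carrier G"
  shows "a \<ominus> b = c \<longleftrightarrow> a = c \<oplus> b" "c = a \<ominus> b \<longleftrightarrow> c \<oplus> b = a"
proof -
  have "c \<oplus> b \<ominus> b = c" using assms by (simp add: a_minus_def a_assoc r_neg)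
  moreover have "a \<ominus> b \<oplus> b = a" using assms by (simp add: a_minus_def a_assoc l_neg)
  ultimately show "a \<ominus> b = c \<longleftrightarrow> a = c \<oplus> b" "c = a \<ominus> b \<longleftrightarrow> c \<oplus> b = a" by auto
qed

text \<open>Collecting the negative terms of each side of an equation into one subtrahend and then moving it
  to the other side turns a ring identity into one between sums of monomials.\<close>

lemma (in cring) diff_collect:
  "\<lbrakk>a \<in> carrier R; b \<in> carrier R; c \<in> carrier R\<rbrakk> \<Longrightarrow> a \<oplus> (b \<ominus> c) = (a \<oplus> b) \<ominus> c"
  "\<lbrakk>a \<in> carrier R; b \<in> carrier R; c \<in> carrier R\<rbrakk> \<Longrightarrow> (a \<ominus> b) \<oplus> c = (a \<oplus> c) \<ominus> b"
  "\<lbrakk>a \<in> carrier R; b \<in> carrier R; c \<in> carrier R\<rbrakk> \<Longrightarrow> a \<ominus> (b \<ominus> c) = (a \<oplus> c) \<ominus> b"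
  "\<lbrakk>a \<in> carrier R; b \<in> carrier R; c \<in> carrier R\<rbrakk> \<Longrightarrow> (a \<ominus> b) \<ominus> c = a \<ominus> (b \<oplus> c)"
  "\<lbrakk>a \<in> carrier R; b \<in> carrier R; c \<in> carrier R\<rbrakk> \<Longrightarrow> a \<otimes> (b \<ominus> c) = a \<otimes> b \<ominus> a \<otimes> c"
  "\<lbrakk>a \<in> carrier R; b \<in> carrier R; c \<in> carrier R\<rbrakk> \<Longrightarrow> (b \<ominus> c) \<otimes> a = b \<otimes> a \<ominus> c \<otimes> a"
  by (simp_all add: a_minus_def minus_add r_distr l_distr r_minus l_minus a_ac)

lemmas (in cring) ring_identity_simps =
  diff_collect diff_eq_iff l_distr r_distr m_assoc m_comm m_lcomm a_assoc a_comm a_lcomm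

lemma algebra_isomorphic_trans:
  assumes "algebra_isomorphic K A B" "algebra_isomorphic K B C"
  shows "algebra_isomorphic K A C"
proof -
  obtain h where h: "h \<in> ring_iso A B" "\<forall>c\<in>carrier K. \<forall>x\<in>carrier A. h (c \<odot>\<^bsub>A\<^esub> x) = c \<odot>\<^bsub>B\<^esub> h x"
    using assms(1) unfolding algebra_isomorphic_def by blast
  obtain k where k: "k \<in> ring_iso B C" "\<forall>c\<in>carrier K. \<forall>x\<in>carrier B. k (c \<odot>\<^bsub>B\<^esub> x) = c \<odot>\<^bsub>C\<^esub> k x"
    using assms(2) unfolding algebra_isomorphic_def by blast
  have "k \<circ> h \<in> ring_iso A C" using ring_iso_set_trans h(1) k(1) by blast
  moreover have "h x \<in> carrier B" if "x \<in> carrier A" for x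
    using h(1) that by (rule ring_iso_memE(1))
  ultimately show ?thesis
    unfolding algebra_isomorphic_def using h(2) k(2) by (intro bexI[of _ "k \<circ> h"]) auto
qed

context field
begin

text \<open>The generator j of the first algebra goes to (f + gi)j, whose square is (f + gi)(f -
  gi)\<beta> = \<gamma>. On the part x2 j + x3 ij this multiplies x2 + x3 i by f + gi, so
  multiplication by (f - gi)/N inverts it.\<close>

lemma quaternion_algebra_norm_twist:
  assumes c: "\<alpha> \<in> carrier R" "\<beta> \<in> carrier R" "f \<in> carrier R" "g \<in> carrier R"
    and N: "f \<otimes> f \<ominus> \<alpha> \<otimes> (g \<otimes> g) \<noteq> \<zero>"
    and \<gamma>: "\<gamma> = \<beta> \<otimes> (f \<otimes> f \<ominus> \<alpha> \<otimes> (g \<otimes> g))"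
  shows "algebra_isomorphic R (quaternion_algebra R \<alpha> \<gamma>) (quaternion_algebra R \<alpha> \<beta>)"
proof -
  define N where "N = f \<otimes> f \<ominus> \<alpha> \<otimes> (g \<otimes> g)"
  define n where "n = inv N"
  have Nc: "N \<in> carrier R" "N \<noteq> \<zero>" using c N by (auto simp: N_def)
  have nc: "n \<in> carrier R" and nN: "n \<otimes> N = \<one>"
    using Nc by (auto simp: n_def field_Units)
  define h where "h = (\<lambda>(x0::'a, x1::'a, x2, x3). (x0, x1, x2 \<otimes> f \<oplus> \<alpha> \<otimes> (x3 \<otimes> g), x2 \<otimes> g \<oplus> x3 \<otimes> f))"
  define k where "k = (\<lambda>(x0::'a, x1::'a, x2, x3).
    (x0, x1, n \<otimes> (x2 \<otimes> f \<ominus> \<alpha> \<otimes> (x3 \<otimes> g)), n \<otimes> (x3 \<otimes> f \<ominus> x2 \<otimes> g)))"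
  let ?A = "quaternion_algebra R \<alpha> \<gamma>" and ?B = "quaternion_algebra R \<alpha> \<beta>"
  have hom: "h \<in> ring_hom ?A ?B"
  proof (rule ring_hom_memI)
    fix X Y assume "X \<in> carrier ?A" "Y \<in> carrier ?A"
    then obtain x0 x1 x2 x3 y0 y1 y2 y3 where XY: "X = (x0, x1, x2, x3)" "Y = (y0, y1, y2, y3)"
      and x: "x0 \<in> carrier R" "x1 \<in> carrier R" "x2 \<in> carrier R" "x3 \<in> carrier R"
      and y: "y0 \<in> carrier R" "y1 \<in> carrier R" "y2 \<in> carrier R" "y3 \<in> carrier R"
      by (auto simp: quaternion_algebra_def)
    have 1: "x0 \<otimes> y0 \<oplus> \<alpha> \<otimes> (x1 \<otimes> y1) \<oplus> \<gamma> \<otimes> (x2 \<otimes> y2) \<ominus> (\<alpha> \<otimes> \<gamma>) \<otimes> (x3 \<otimes> y3)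
       = x0 \<otimes> y0 \<oplus> \<alpha> \<otimes> (x1 \<otimes> y1)
         \<oplus> \<beta> \<otimes> ((x2 \<otimes> f \<oplus> \<alpha> \<otimes> (x3 \<otimes> g)) \<otimes> (y2 \<otimes> f \<oplus> \<alpha> \<otimes> (y3 \<otimes> g)))
         \<ominus> (\<alpha> \<otimes> \<beta>) \<otimes> ((x2 \<otimes> g \<oplus> x3 \<otimes> f) \<otimes> (y2 \<otimes> g \<oplus> y3 \<otimes> f))"
      unfolding \<gamma> using c x y by (simp add: ring_identity_simps)
    have 2: "x0 \<otimes> y1 \<oplus> x1 \<otimes> y0 \<oplus> \<gamma> \<otimes> (x3 \<otimes> y2 \<ominus> x2 \<otimes> y3)
       = x0 \<otimes> y1 \<oplus> x1 \<otimes> y0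
         \<oplus> \<beta> \<otimes> ((x2 \<otimes> g \<oplus> x3 \<otimes> f) \<otimes> (y2 \<otimes> f \<oplus> \<alpha> \<otimes> (y3 \<otimes> g))
                \<ominus> (x2 \<otimes> f \<oplus> \<alpha> \<otimes> (x3 \<otimes> g)) \<otimes> (y2 \<otimes> g \<oplus> y3 \<otimes> f))"
      unfolding \<gamma> using c x y by (simp add: ring_identity_simps)
    have 3: "(x0 \<otimes> y2 \<oplus> x2 \<otimes> y0 \<oplus> \<alpha> \<otimes> (x1 \<otimes> y3 \<ominus> x3 \<otimes> y1)) \<otimes> f
         \<oplus> \<alpha> \<otimes> ((x0 \<otimes> y3 \<oplus> x3 \<otimes> y0 \<oplus> (x1 \<otimes> y2 \<ominus> x2 \<otimes> y1)) \<otimes> g)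
       = x0 \<otimes> (y2 \<otimes> f \<oplus> \<alpha> \<otimes> (y3 \<otimes> g)) \<oplus> (x2 \<otimes> f \<oplus> \<alpha> \<otimes> (x3 \<otimes> g)) \<otimes> y0
         \<oplus> \<alpha> \<otimes> (x1 \<otimes> (y2 \<otimes> g \<oplus> y3 \<otimes> f) \<ominus> (x2 \<otimes> g \<oplus> x3 \<otimes> f) \<otimes> y1)"
      using c x y by (simp add: ring_identity_simps)
    have 4: "(x0 \<otimes> y2 \<oplus> x2 \<otimes> y0 \<oplus> \<alpha> \<otimes> (x1 \<otimes> y3 \<ominus> x3 \<otimes> y1)) \<otimes> g
         \<oplus> (x0 \<otimes> y3 \<oplus> x3 \<otimes> y0 \<oplus> (x1 \<otimes> y2 \<ominus> x2 \<otimes> y1)) \<otimes> f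
       = x0 \<otimes> (y2 \<otimes> g \<oplus> y3 \<otimes> f) \<oplus> (x2 \<otimes> g \<oplus> x3 \<otimes> f) \<otimes> y0
         \<oplus> (x1 \<otimes> (y2 \<otimes> f \<oplus> \<alpha> \<otimes> (y3 \<otimes> g)) \<ominus> (x2 \<otimes> f \<oplus> \<alpha> \<otimes> (x3 \<otimes> g)) \<otimes> y1)"
      using c x y by (simp add: ring_identity_simps)
    show "h (X \<otimes>\<^bsub>?A\<^esub> Y) = h X \<otimes>\<^bsub>?B\<^esub> h Y"
      using 1 2 3 4 by (simp add: XY h_def quaternion_algebra_def)
    have 5: "(x2 \<oplus> y2) \<otimes> f \<oplus> \<alpha> \<otimes> ((x3 \<oplus> y3) \<otimes> g)
        = x2 \<otimes> f \<oplus> \<alpha> \<otimes> (x3 \<otimes> g) \<oplus> (y2 \<otimes> f \<oplus> \<alpha> \<otimes> (y3 \<otimes> g))"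
      using c x y by (simp add: ring_identity_simps)
    have 6: "(x2 \<oplus> y2) \<otimes> g \<oplus> (x3 \<oplus> y3) \<otimes> f = x2 \<otimes> g \<oplus> x3 \<otimes> f \<oplus> (y2 \<otimes> g \<oplus> y3 \<otimes> f)"
      using c x y by (simp add: ring_identity_simps)
    show "h (X \<oplus>\<^bsub>?A\<^esub> Y) = h X \<oplus>\<^bsub>?B\<^esub> h Y"
      using 5 6 by (simp add: XY h_def quaternion_algebra_def)
  qed (use c in \<open>auto simp: h_def quaternion_algebra_def\<close>)
  have kh: "k (h X) = X" "h (k X) = X" if X: "X \<in> carrier ?A" for X
  proof -
    from X obtain x0 x1 x2 x3 where XY: "X = (x0, x1, x2, x3)"
      and x: "x0 \<in> carrier R" "x1 \<in> carrier R" "x2 \<in> carrier R" "x3 \<in> carrier R"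
      by (auto simp: quaternion_algebra_def)
    have u: "n \<otimes> N \<otimes> x2 = x2" "n \<otimes> N \<otimes> x3 = x3" using nN x by simp_all
    have 1: "n \<otimes> ((x2 \<otimes> f \<oplus> \<alpha> \<otimes> (x3 \<otimes> g)) \<otimes> f \<ominus> \<alpha> \<otimes> ((x2 \<otimes> g \<oplus> x3 \<otimes> f) \<otimes> g)) = n \<otimes> N \<otimes> x2"
      unfolding N_def using c x nc by (simp add: ring_identity_simps)
    have 2: "n \<otimes> ((x2 \<otimes> g \<oplus> x3 \<otimes> f) \<otimes> f \<ominus> (x2 \<otimes> f \<oplus> \<alpha> \<otimes> (x3 \<otimes> g)) \<otimes> g) = n \<otimes> N \<otimes> x3"
      unfolding N_def using c x nc by (simp add: ring_identity_simps)
    have 3: "(n \<otimes> (x2 \<otimes> f \<ominus> \<alpha> \<otimes> (x3 \<otimes> g))) \<otimes> f \<oplus> \<alpha> \<otimes> ((n \<otimes> (x3 \<otimes> f \<ominus> x2 \<otimes> g)) \<otimes> g) = n \<otimes> N \<otimes> x2"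
      unfolding N_def using c x nc by (simp add: ring_identity_simps)
    have 4: "(n \<otimes> (x2 \<otimes> f \<ominus> \<alpha> \<otimes> (x3 \<otimes> g))) \<otimes> g \<oplus> (n \<otimes> (x3 \<otimes> f \<ominus> x2 \<otimes> g)) \<otimes> f = n \<otimes> N \<otimes> x3"
      unfolding N_def using c x nc by (simp add: ring_identity_simps)
    show "k (h X) = X" "h (k X) = X"
      unfolding XY h_def k_def prod.case 1 2 3 4 u by simp_all
  qed
  have "bij_betw h (carrier ?A) (carrier ?B)"
  proof (rule bij_betw_byWitness[of _ k])
    show "\<forall>a\<in>carrier ?A. k (h a) = a" using kh by blast
    have "carrier ?B = carrier ?A" by (simp add: quaternion_algebra_def)
    then show "\<forall>a\<in>carrier ?B. h (k a) = a" using kh by blast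
    show "h ` carrier ?A \<subseteq> carrier ?B" using hom by (auto dest: ring_hom_memE(1))
    show "k ` carrier ?B \<subseteq> carrier ?A" using c nc by (auto simp: k_def quaternion_algebra_def)
  qed
  moreover have "h (t \<odot>\<^bsub>?A\<^esub> X) = t \<odot>\<^bsub>?B\<^esub> h X" if t: "t \<in> carrier R" and X: "X \<in> carrier ?A" for t X
  proof -
    from X obtain x0 x1 x2 x3 where XY: "X = (x0, x1, x2, x3)"
      and x: "x0 \<in> carrier R" "x1 \<in> carrier R" "x2 \<in> carrier R" "x3 \<in> carrier R"
      by (auto simp: quaternion_algebra_def)
    have 1: "t \<otimes> x2 \<otimes> f \<oplus> \<alpha> \<otimes> (t \<otimes> x3 \<otimes> g) = t \<otimes> (x2 \<otimes> f \<oplus> \<alpha> \<otimes> (x3 \<otimes> g))"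
      using c x t by (simp add: ring_identity_simps)
    have 2: "t \<otimes> x2 \<otimes> g \<oplus> t \<otimes> x3 \<otimes> f = t \<otimes> (x2 \<otimes> g \<oplus> x3 \<otimes> f)"
      using c x t by (simp add: ring_identity_simps)
    show ?thesis using 1 2 by (simp add: XY h_def quaternion_algebra_def)
  qed
  ultimately show ?thesis
    unfolding algebra_isomorphic_def ring_iso_def using hom by blast
qed

text \<open>The matrices (0, \<alpha>; 1, 0) for i and diag(1, -1) for j anticommute and have
  squares \<alpha> and 1. Recovering the coordinates from the entries takes 1/2 and 1/\<alpha>, the
  constants t and r.\<close>

lemma quaternion_algebra_one_split:
  assumes a: "\<alpha> \<in> carrier R" "\<alpha> \<noteq> \<zero>" and two: "\<one> \<oplus> \<one> \<noteq> \<zero>"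
  shows "algebra_isomorphic R (quaternion_algebra R \<alpha> \<one>) (matrix_algebra2 R)"
proof -
  define t where "t = inv (\<one> \<oplus> \<one>)"
  define r where "r = inv \<alpha>"
  have tc: "t \<in> carrier R" and tt: "t \<otimes> (\<one> \<oplus> \<one>) = \<one>"
    using two by (auto simp: t_def field_Units)
  have rc: "r \<in> carrier R" and ra: "r \<otimes> \<alpha> = \<one>"
    using a by (auto simp: r_def field_Units)
  note c = tc rc a(1)
  define h where "h = (\<lambda>(x0, x1, x2, x3). (x0 \<oplus> x2, \<alpha> \<otimes> (x1 \<ominus> x3), x1 \<oplus> x3, x0 \<ominus> x2))"
  define k where "k = (\<lambda>(m0, m1, m2, m3). (t \<otimes> (m0 \<oplus> m3), t \<otimes> (m2 \<oplus> r \<otimes> m1),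
     t \<otimes> (m0 \<ominus> m3), t \<otimes> (m2 \<ominus> r \<otimes> m1)))"
  let ?A = "quaternion_algebra R \<alpha> \<one>" and ?B = "matrix_algebra2 R"
  have hom: "h \<in> ring_hom ?A ?B"
  proof (rule ring_hom_memI)
    fix X Y assume "X \<in> carrier ?A" "Y \<in> carrier ?A"
    then obtain x0 x1 x2 x3 y0 y1 y2 y3 where XY: "X = (x0, x1, x2, x3)" "Y = (y0, y1, y2, y3)"
      and x: "x0 \<in> carrier R" "x1 \<in> carrier R" "x2 \<in> carrier R" "x3 \<in> carrier R"
      and y: "y0 \<in> carrier R" "y1 \<in> carrier R" "y2 \<in> carrier R" "y3 \<in> carrier R"
      by (auto simp: quaternion_algebra_def)
    have 1: "(x0 \<otimes> y0 \<oplus> \<alpha> \<otimes> (x1 \<otimes> y1) \<oplus> \<one> \<otimes> (x2 \<otimes> y2) \<ominus> (\<alpha> \<otimes> \<one>) \<otimes> (x3 \<otimes> y3))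
         \<oplus> (x0 \<otimes> y2 \<oplus> x2 \<otimes> y0 \<oplus> \<alpha> \<otimes> (x1 \<otimes> y3 \<ominus> x3 \<otimes> y1))
       = (x0 \<oplus> x2) \<otimes> (y0 \<oplus> y2) \<oplus> (\<alpha> \<otimes> (x1 \<ominus> x3)) \<otimes> (y1 \<oplus> y3)"
      using c x y by (simp add: ring_identity_simps)
    have 2: "\<alpha> \<otimes> ((x0 \<otimes> y1 \<oplus> x1 \<otimes> y0 \<oplus> \<one> \<otimes> (x3 \<otimes> y2 \<ominus> x2 \<otimes> y3))
         \<ominus> (x0 \<otimes> y3 \<oplus> x3 \<otimes> y0 \<oplus> (x1 \<otimes> y2 \<ominus> x2 \<otimes> y1)))
       = (x0 \<oplus> x2) \<otimes> (\<alpha> \<otimes> (y1 \<ominus> y3)) \<oplus> (\<alpha> \<otimes> (x1 \<ominus> x3)) \<otimes> (y0 \<ominus> y2)"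
      using c x y by (simp add: ring_identity_simps)
    have 3: "(x0 \<otimes> y1 \<oplus> x1 \<otimes> y0 \<oplus> \<one> \<otimes> (x3 \<otimes> y2 \<ominus> x2 \<otimes> y3))
         \<oplus> (x0 \<otimes> y3 \<oplus> x3 \<otimes> y0 \<oplus> (x1 \<otimes> y2 \<ominus> x2 \<otimes> y1))
       = (x1 \<oplus> x3) \<otimes> (y0 \<oplus> y2) \<oplus> (x0 \<ominus> x2) \<otimes> (y1 \<oplus> y3)"
      using c x y by (simp add: ring_identity_simps)
    have 4: "(x0 \<otimes> y0 \<oplus> \<alpha> \<otimes> (x1 \<otimes> y1) \<oplus> \<one> \<otimes> (x2 \<otimes> y2) \<ominus> (\<alpha> \<otimes> \<one>) \<otimes> (x3 \<otimes> y3))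
         \<ominus> (x0 \<otimes> y2 \<oplus> x2 \<otimes> y0 \<oplus> \<alpha> \<otimes> (x1 \<otimes> y3 \<ominus> x3 \<otimes> y1))
       = (x1 \<oplus> x3) \<otimes> (\<alpha> \<otimes> (y1 \<ominus> y3)) \<oplus> (x0 \<ominus> x2) \<otimes> (y0 \<ominus> y2)"
      using c x y by (simp add: ring_identity_simps)
    show "h (X \<otimes>\<^bsub>?A\<^esub> Y) = h X \<otimes>\<^bsub>?B\<^esub> h Y"
      unfolding XY h_def quaternion_algebra_def matrix_algebra2_def monoid.simps prod.case 1 2 3 4 ..
    have 5: "x0 \<oplus> y0 \<oplus> (x2 \<oplus> y2) = x0 \<oplus> x2 \<oplus> (y0 \<oplus> y2)"
      using c x y by (simp add: ring_identity_simps)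
    have 6: "\<alpha> \<otimes> (x1 \<oplus> y1 \<ominus> (x3 \<oplus> y3)) = \<alpha> \<otimes> (x1 \<ominus> x3) \<oplus> \<alpha> \<otimes> (y1 \<ominus> y3)"
      using c x y by (simp add: ring_identity_simps)
    have 7: "x1 \<oplus> y1 \<oplus> (x3 \<oplus> y3) = x1 \<oplus> x3 \<oplus> (y1 \<oplus> y3)"
      using c x y by (simp add: ring_identity_simps)
    have 8: "x0 \<oplus> y0 \<ominus> (x2 \<oplus> y2) = x0 \<ominus> x2 \<oplus> (y0 \<ominus> y2)"
      using c x y by (simp add: ring_identity_simps)
    show "h (X \<oplus>\<^bsub>?A\<^esub> Y) = h X \<oplus>\<^bsub>?B\<^esub> h Y"
      using 5 6 7 8 by (simp add: XY h_def quaternion_algebra_def matrix_algebra2_def)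
  next
    show "h \<one>\<^bsub>?A\<^esub> = \<one>\<^bsub>?B\<^esub>"
      using c by (auto simp: h_def quaternion_algebra_def matrix_algebra2_def a_minus_def)
  qed (use c in \<open>auto simp: h_def quaternion_algebra_def matrix_algebra2_def\<close>)
  have kh: "k (h X) = X" "h (k X) = X" if X: "X \<in> carrier ?A" for X
  proof -
    from X obtain x0 x1 x2 x3 where XY: "X = (x0, x1, x2, x3)"
      and x: "x0 \<in> carrier R" "x1 \<in> carrier R" "x2 \<in> carrier R" "x3 \<in> carrier R"
      by (auto simp: quaternion_algebra_def)
    have 0: "t \<otimes> (x0 \<oplus> x2 \<oplus> (x0 \<ominus> x2)) = (t \<otimes> (\<one> \<oplus> \<one>)) \<otimes> x0"
      "t \<otimes> (x1 \<oplus> x3 \<oplus> r \<otimes> (\<alpha> \<otimes> (x1 \<ominus> x3))) = t \<otimes> (x1 \<oplus> x3 \<oplus> (r \<otimes> \<alpha>) \<otimes> (x1 \<ominus> x3))"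
      "t \<otimes> (x1 \<oplus> x3 \<oplus> \<one> \<otimes> (x1 \<ominus> x3)) = (t \<otimes> (\<one> \<oplus> \<one>)) \<otimes> x1"
      "t \<otimes> (x0 \<oplus> x2 \<ominus> (x0 \<ominus> x2)) = (t \<otimes> (\<one> \<oplus> \<one>)) \<otimes> x2"
      "t \<otimes> (x1 \<oplus> x3 \<ominus> r \<otimes> (\<alpha> \<otimes> (x1 \<ominus> x3))) = t \<otimes> (x1 \<oplus> x3 \<ominus> (r \<otimes> \<alpha>) \<otimes> (x1 \<ominus> x3))"
      "t \<otimes> (x1 \<oplus> x3 \<ominus> \<one> \<otimes> (x1 \<ominus> x3)) = (t \<otimes> (\<one> \<oplus> \<one>)) \<otimes> x3"
      using c x by (simp_all add: ring_identity_simps)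
    have 1: "t \<otimes> (x0 \<oplus> x3) \<oplus> t \<otimes> (x0 \<ominus> x3) = (t \<otimes> (\<one> \<oplus> \<one>)) \<otimes> x0"
      "\<alpha> \<otimes> (t \<otimes> (x2 \<oplus> r \<otimes> x1) \<ominus> t \<otimes> (x2 \<ominus> r \<otimes> x1)) = (r \<otimes> \<alpha>) \<otimes> ((t \<otimes> (\<one> \<oplus> \<one>)) \<otimes> x1)"
      "t \<otimes> (x2 \<oplus> r \<otimes> x1) \<oplus> t \<otimes> (x2 \<ominus> r \<otimes> x1) = (t \<otimes> (\<one> \<oplus> \<one>)) \<otimes> x2"
      "t \<otimes> (x0 \<oplus> x3) \<ominus> t \<otimes> (x0 \<ominus> x3) = (t \<otimes> (\<one> \<oplus> \<one>)) \<otimes> x3"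
      using c x by (simp_all add: ring_identity_simps)
    show "k (h X) = X" unfolding XY h_def k_def prod.case 0(1,2,4,5) ra 0(3,6) tt using x by simp
    show "h (k X) = X" unfolding XY h_def k_def prod.case 1 ra tt using x by simp
  qed
  have "bij_betw h (carrier ?A) (carrier ?B)"
  proof (rule bij_betw_byWitness[of _ k])
    show "\<forall>a\<in>carrier ?A. k (h a) = a" using kh by blast
    have "carrier ?B = carrier ?A" by (simp add: quaternion_algebra_def matrix_algebra2_def)
    then show "\<forall>a\<in>carrier ?B. h (k a) = a" using kh by blast
    show "h ` carrier ?A \<subseteq> carrier ?B" using hom by (auto dest: ring_hom_memE(1))
    show "k ` carrier ?B \<subseteq> carrier ?A"
      using c by (auto simp: k_def quaternion_algebra_def matrix_algebra2_def)
  qed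
  moreover have "h (s \<odot>\<^bsub>?A\<^esub> X) = s \<odot>\<^bsub>?B\<^esub> h X" if s: "s \<in> carrier R" and X: "X \<in> carrier ?A" for s X
  proof -
    from X obtain x0 x1 x2 x3 where XY: "X = (x0, x1, x2, x3)"
      and x: "x0 \<in> carrier R" "x1 \<in> carrier R" "x2 \<in> carrier R" "x3 \<in> carrier R"
      by (auto simp: quaternion_algebra_def)
    have 1: "s \<otimes> x0 \<oplus> s \<otimes> x2 = s \<otimes> (x0 \<oplus> x2)"
      "\<alpha> \<otimes> (s \<otimes> x1 \<ominus> s \<otimes> x3) = s \<otimes> (\<alpha> \<otimes> (x1 \<ominus> x3))"
      "s \<otimes> x1 \<oplus> s \<otimes> x3 = s \<otimes> (x1 \<oplus> x3)"
      "s \<otimes> x0 \<ominus> s \<otimes> x2 = s \<otimes> (x0 \<ominus> x2)"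
      using c x s by (simp_all add: ring_identity_simps)
    show ?thesis using 1 by (simp add: XY h_def quaternion_algebra_def matrix_algebra2_def)
  qed
  ultimately show ?thesis
    unfolding algebra_isomorphic_def ring_iso_def using hom by blast
qed

lemma quaternion_algebra_norm_split:
  assumes "\<alpha> \<in> carrier R" "\<alpha> \<noteq> \<zero>" "\<one> \<oplus> \<one> \<noteq> \<zero>" "f \<in> carrier R" "g \<in> carrier R"
    and "\<beta> = f \<otimes> f \<ominus> \<alpha> \<otimes> (g \<otimes> g)" "\<beta> \<noteq> \<zero>"
  shows "algebra_isomorphic R (quaternion_algebra R \<alpha> \<beta>) (matrix_algebra2 R)"
proof (rule algebra_isomorphic_trans[OF quaternion_algebra_norm_twist quaternion_algebra_one_split])
  show "\<beta> = \<one> \<otimes> (f \<otimes> f \<ominus> \<alpha> \<otimes> (g \<otimes> g))" using assms by simp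
  show "f \<otimes> f \<ominus> \<alpha> \<otimes> (g \<otimes> g) \<noteq> \<zero>" using assms(6,7) by simp
qed (use assms(1-5) in simp_all)

text \<open>A split algebra contains the preimage of a nilpotent matrix. A nonzero element of square
  zero has no scalar part, so it is a pure quaternion, and its square is the ternary form at its
  coordinates. A hypothetical splitting thus becomes the solution of an equation.\<close>

lemma quaternion_algebra_split_isotropic:
  assumes c: "\<alpha> \<in> carrier R" "\<beta> \<in> carrier R" and two: "\<one> \<oplus> \<one> \<noteq> \<zero>"
    and iso: "algebra_isomorphic R (quaternion_algebra R \<alpha> \<beta>) (matrix_algebra2 R)"
  obtains x1 x2 x3 where "x1 \<in> carrier R" "x2 \<in> carrier R" "x3 \<in> carrier R"
    "(x1, x2, x3) \<noteq> (\<zero>, \<zero>, \<zero>)"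
    "\<alpha> \<otimes> (x1 \<otimes> x1) \<oplus> \<beta> \<otimes> (x2 \<otimes> x2) \<ominus> (\<alpha> \<otimes> \<beta>) \<otimes> (x3 \<otimes> x3) = \<zero>"
proof -
  let ?A = "quaternion_algebra R \<alpha> \<beta>" and ?B = "matrix_algebra2 R"
  obtain h where h: "h \<in> ring_hom ?A ?B" "bij_betw h (carrier ?A) (carrier ?B)"
    and sm: "\<forall>s\<in>carrier R. \<forall>x\<in>carrier ?A. h (s \<odot>\<^bsub>?A\<^esub> x) = s \<odot>\<^bsub>?B\<^esub> h x"
    using iso unfolding algebra_isomorphic_def ring_iso_def by blast
  \<comment> \<open>The matrix unit in the upper right corner is nonzero and has square
    zero.\<close>
  have "(\<zero>, \<one>, \<zero>, \<zero>) \<in> carrier ?B" by (simp add: matrix_algebra2_def)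
  then obtain X where X: "X \<in> carrier ?A" and hX: "h X = (\<zero>, \<one>, \<zero>, \<zero>)"
    using bij_betw_imp_surj_on[OF h(2)] by (metis (no_types, lifting) image_iff)
  from X obtain x0 x1 x2 x3 where XY: "X = (x0, x1, x2, x3)"
      and x: "x0 \<in> carrier R" "x1 \<in> carrier R" "x2 \<in> carrier R" "x3 \<in> carrier R"
    by (auto simp: quaternion_algebra_def)
  have Z: "(\<zero>, \<zero>, \<zero>, \<zero>) \<in> carrier ?A" by (simp add: quaternion_algebra_def)
  have "h (\<zero> \<odot>\<^bsub>?A\<^esub> X) = \<zero> \<odot>\<^bsub>?B\<^esub> h X" using sm X by blast
  then have h0: "h (\<zero>, \<zero>, \<zero>, \<zero>) = (\<zero>, \<zero>, \<zero>, \<zero>)"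
    unfolding hX using x by (simp add: XY quaternion_algebra_def matrix_algebra2_def)
  have XX: "X \<otimes>\<^bsub>?A\<^esub> X \<in> carrier ?A" using c x by (simp add: XY quaternion_algebra_def)
  have "h (X \<otimes>\<^bsub>?A\<^esub> X) = h X \<otimes>\<^bsub>?B\<^esub> h X" using h(1) X by (simp add: ring_hom_memE(2))
  also have "\<dots> = h (\<zero>, \<zero>, \<zero>, \<zero>)" unfolding hX h0 by (simp add: matrix_algebra2_def)
  finally have "X \<otimes>\<^bsub>?A\<^esub> X = (\<zero>, \<zero>, \<zero>, \<zero>)"
    by (rule inj_onD[OF bij_betw_imp_inj_on[OF h(2)] _ XX Z])
  then have e: "x0 \<otimes> x0 \<oplus> \<alpha> \<otimes> (x1 \<otimes> x1) \<oplus> \<beta> \<otimes> (x2 \<otimes> x2) \<ominus> (\<alpha> \<otimes> \<beta>) \<otimes> (x3 \<otimes> x3) = \<zero>"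
    "x0 \<otimes> x1 \<oplus> x1 \<otimes> x0 \<oplus> \<beta> \<otimes> (x3 \<otimes> x2 \<ominus> x2 \<otimes> x3) = \<zero>"
    "x0 \<otimes> x2 \<oplus> x2 \<otimes> x0 \<oplus> \<alpha> \<otimes> (x1 \<otimes> x3 \<ominus> x3 \<otimes> x1) = \<zero>"
    "x0 \<otimes> x3 \<oplus> x3 \<otimes> x0 \<oplus> (x1 \<otimes> x2 \<ominus> x2 \<otimes> x1) = \<zero>"
    unfolding XY quaternion_algebra_def monoid.simps prod.case prod.inject by blast+
  \<comment> \<open>The coordinates commute, so the commutator terms cancel and the three imaginary
    coordinates of the square are 2 x0 x1, 2 x0 x2, 2 x0 x3.\<close>
  have r: "x0 \<otimes> x1 \<oplus> x1 \<otimes> x0 \<oplus> \<beta> \<otimes> (x3 \<otimes> x2 \<ominus> x2 \<otimes> x3) = (\<one> \<oplus> \<one>) \<otimes> (x0 \<otimes> x1)"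
    "x0 \<otimes> x2 \<oplus> x2 \<otimes> x0 \<oplus> \<alpha> \<otimes> (x1 \<otimes> x3 \<ominus> x3 \<otimes> x1) = (\<one> \<oplus> \<one>) \<otimes> (x0 \<otimes> x2)"
    "x0 \<otimes> x3 \<oplus> x3 \<otimes> x0 \<oplus> (x1 \<otimes> x2 \<ominus> x2 \<otimes> x1) = (\<one> \<oplus> \<one>) \<otimes> (x0 \<otimes> x3)"
    using c x by (simp_all add: ring_identity_simps)
  have x0: "x0 = \<zero>"
  proof (rule ccontr)
    assume "x0 \<noteq> \<zero>"
    then have "x1 = \<zero>" "x2 = \<zero>" "x3 = \<zero>"
      using e(2-4) two x unfolding r by (auto simp: integral_iff)
    then show False using e(1) c x \<open>x0 \<noteq> \<zero>\<close> by (simp add: integral_iff a_minus_def)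
  qed
  have "X \<noteq> (\<zero>, \<zero>, \<zero>, \<zero>)" using hX h0 by auto
  then have "(x1, x2, x3) \<noteq> (\<zero>, \<zero>, \<zero>)" using x0 XY by auto
  moreover have "\<alpha> \<otimes> (x1 \<otimes> x1) \<oplus> \<beta> \<otimes> (x2 \<otimes> x2) \<ominus> (\<alpha> \<otimes> \<beta>) \<otimes> (x3 \<otimes> x3) = \<zero>"
    using e(1) c x by (simp add: x0)
  ultimately show ?thesis using that x by blast
qed

end

section \<open>Norms and residues\<close>

lemma int_dvd_less_imp_zero:
  fixes m d :: int
  assumes "m dvd d" "\<bar>d\<bar> < m"
  shows "d = 0"
  using dvd_imp_le_int[OF _ assms(1)] assms(2) by fastforce

text \<open>Euler's criterion gives a congruence modulo p between two numbers in {-1, 0, 1}; they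
  differ by at most 2, which is less than p.\<close>

lemma Legendre_mult:
  fixes p :: nat
  assumes "prime p" "2 < p"
  shows "Legendre (m * n) p = Legendre m p * Legendre n p"
proof -
  have "[Legendre (m * n) p = (m * n) ^ ((p - 1) div 2)] (mod p)"
    using euler_criterion[OF assms] .
  also have "(m * n) ^ ((p - 1) div 2) = m ^ ((p - 1) div 2) * n ^ ((p - 1) div 2)"
    by (rule power_mult_distrib)
  also have "[m ^ ((p - 1) div 2) * n ^ ((p - 1) div 2) = Legendre m p * Legendre n p] (mod p)"
    by (intro cong_mult cong_sym[OF euler_criterion[OF assms]])
  finally have "int p dvd Legendre (m * n) p - Legendre m p * Legendre n p"
    by (simp add: cong_iff_dvd_diff)
  moreover have "\<bar>Legendre (m * n) p - Legendre m p * Legendre n p\<bar> \<le> 2"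
    by (auto simp: Legendre_def)
  ultimately show ?thesis
    using assms(2) int_dvd_less_imp_zero[of "int p" "Legendre (m * n) p - Legendre m p * Legendre n p"] by simp
qed

lemma Legendre_square:
  assumes "prime (p::nat)" "\<not> int p dvd n"
  shows "Legendre (n * n) p = 1"
proof -
  have "\<not> int p dvd n * n"
    using assms by (simp add: prime_dvd_mult_iff)
  then show ?thesis
    by (auto simp: Legendre_def cong_0_iff QuadRes_def power2_eq_square intro!: exI[of _ n])
qed

text \<open>Gauss's lemma for p = 8k + 5: among the doubles 2, 4, ..., p - 1, those exceeding (p -
  1)/2 = 4k + 2 are the doubles of 2k + 2, ..., 4k + 2. There are 2k + 1 of them, an odd
  number.\<close>

lemma Legendre_two:
  fixes p :: nat
  assumes "prime p" "p mod 8 = 5"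
  shows "Legendre 2 p = -1"
proof -
  obtain k where k: "p = 8 * k + 5" using assms(2) by (metis mult_div_mod_eq)
  interpret GAUSS p 2
  proof
    show "[2 \<noteq> 0] (mod int p)" unfolding cong_0_iff k by (auto dest: zdvd_imp_le)
  qed (use assms k in auto)
  have A: "A = {1..4 * int k + 2}" unfolding A_def by (auto simp: k)
  have C: "C = (\<lambda>x. x * 2) ` A"
    unfolding C_def B_def image_image by (rule image_cong) (use A in \<open>auto simp: k\<close>)
  have "E = (\<lambda>x. x * 2) ` {2 * int k + 2..4 * int k + 2}"
    unfolding E_def C A by (auto simp: image_iff k)
  also have "card \<dots> = card {2 * int k + 2..4 * int k + 2}"
    by (rule card_image) (auto simp: inj_on_def)
  finally have "card E = 2 * k + 1" by simp
  then show ?thesis using gauss_lemma by simp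
qed

lemma Legendre_minus_one:
  fixes p :: nat
  assumes "prime p" "p mod 4 = 1"
  shows "Legendre (-1) p = 1"
proof -
  obtain k where k: "p = 4 * k + 1" using assms(2) by (metis mult_div_mod_eq)
  have p2: "2 < p" using assms k prime_ge_2_nat[of p] by (cases "p = 2") auto
  have "[Legendre (-1) p = (-1) ^ ((p - 1) div 2)] (mod p)"
    using euler_criterion[OF assms(1) p2] .
  also have "(-1) ^ ((p - 1) div 2) = (1::int)" by (simp add: k)
  finally have "int p dvd Legendre (-1) p - 1" by (simp add: cong_iff_dvd_diff)
  moreover have "\<bar>Legendre (-1) p - 1\<bar> \<le> 2" by (auto simp: Legendre_def)
  ultimately show ?thesis
    using p2 int_dvd_less_imp_zero[of "int p" "Legendre (-1) p - 1"] by simp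
qed

text \<open>\<open>QuadRes\<close> counts multiples of the modulus as residues, so the symbol 0
  belongs to the positive side.\<close>

lemma QuadRes_iff_Legendre:
  "QuadRes p n \<longleftrightarrow> Legendre n p \<noteq> -1"
proof -
  have "QuadRes p n" if "[n = 0] (mod p)"
    using that cong_sym unfolding QuadRes_def by (intro exI[of _ 0]) auto
  then show ?thesis by (auto simp: Legendre_def)
qed

section \<open>Norm forms modulo a prime\<close>

lemma prime_inverse_mod:
  fixes l g :: int
  assumes "prime l" "\<not> l dvd g"
  obtains h where "[g * h = 1] (mod l)"
proof -
  have "coprime g l" using prime_imp_coprime[OF assms] by (rule coprime_commute[THEN iffD1])
  then show ?thesis using that by (metis cong_solve_coprime_int)
qed

text \<open>If g were a unit modulo l, then f/g would be a square root of p.\<close>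

lemma norm_anisotropic_mod:
  fixes l :: int
  assumes "prime l" "\<not> QuadRes l p" "l dvd f\<^sup>2 - p * g\<^sup>2"
  shows "l dvd f \<and> l dvd g"
proof -
  have g: "l dvd g"
  proof (rule ccontr)
    assume "\<not> l dvd g"
    then obtain h where h: "[g * h = 1] (mod l)" using prime_inverse_mod assms(1) by blast
    have "[f\<^sup>2 = p * g\<^sup>2] (mod l)" using assms(3) by (simp add: cong_iff_dvd_diff)
    then have "[f\<^sup>2 * h\<^sup>2 = p * g\<^sup>2 * h\<^sup>2] (mod l)" by (rule cong_scalar_right)
    moreover have "[(g * h)\<^sup>2 = 1\<^sup>2] (mod l)" using h by (rule cong_pow)
    then have "[p * (g * h)\<^sup>2 = p * 1\<^sup>2] (mod l)" by (rule cong_scalar_left)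
    ultimately have "[(f * h)\<^sup>2 = p] (mod l)"
      by (simp add: power_mult_distrib mult.assoc) (metis cong_trans)
    then show False using assms(2) unfolding QuadRes_def by blast
  qed
  then have "l dvd f\<^sup>2"
    using dvd_add[OF assms(3), of "p * g\<^sup>2"] by (simp add: power2_eq_square)
  then show ?thesis using g assms(1) by (simp add: prime_dvd_power_iff)
qed

lemma multiplicity_square_mult:
  fixes l k n :: int
  assumes "prime l" "k \<noteq> 0" "n \<noteq> 0"
  shows "multiplicity l (k * k * n) = 2 * multiplicity l k + multiplicity l n"
proof -
  have l: "prime_elem l" using assms(1) by (rule prime_imp_prime_elem)
  have "multiplicity l (k * k * n) = multiplicity l (k * k) + multiplicity l n"
    using assms by (intro prime_elem_multiplicity_mult_distrib[OF l]) auto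
  also have "multiplicity l (k * k) = multiplicity l k + multiplicity l k"
    using assms by (intro prime_elem_multiplicity_mult_distrib[OF l]) auto
  finally show ?thesis by simp
qed

lemma odd_square_mod_8:
  fixes f :: int
  assumes "odd f" shows "f\<^sup>2 mod 8 = 1"
proof -
  obtain k where k: "f = 2 * k + 1" using assms by (rule oddE)
  have "even (k * (k + 1))" by simp
  then obtain m where m: "k * (k + 1) = 2 * m" by (rule evenE)
  have "f\<^sup>2 = 4 * (k * (k + 1)) + 1" unfolding k by (simp add: algebra_simps power2_eq_square)
  then have "f\<^sup>2 = 1 + 8 * m" unfolding m by simp
  then show ?thesis by simp
qed

text \<open>If w is not represented, then f^2 - w is a residue for every f: otherwise its product
  with the non-residue p is a residue, and dividing by p yields a representation of w. So the
  squares are closed under subtraction of w. Starting from 0 they contain every -kw, and k = l - 1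
  gives w itself, which is then represented with g = 0.\<close>

lemma unit_norm_mod_odd:
  fixes l :: nat and p w :: int
  assumes l: "prime l" "l \<noteq> 2" and np: "\<not> QuadRes l p"
  shows "\<exists>f g. [f\<^sup>2 - p * g\<^sup>2 = w] (mod l)"
proof (rule ccontr)
  assume contra: "\<nexists>f g. [f\<^sup>2 - p * g\<^sup>2 = w] (mod l)"
  have l2: "2 < l" using prime_ge_2_nat[OF l(1)] l(2) by simp
  have lp: "prime (int l)" using l(1) by simp
  have "[0 = p] (mod l) \<Longrightarrow> QuadRes l p" unfolding QuadRes_def by (rule exI[of _ 0]) simp
  then have "\<not> int l dvd p" using np cong_0_iff cong_sym by blast
  then obtain h where h: "[p * h = 1] (mod l)" using prime_inverse_mod[OF lp] by blast
  have step: "QuadRes l (f\<^sup>2 - w)" for f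
  proof (rule ccontr)
    assume "\<not> QuadRes l (f\<^sup>2 - w)"
    then have "Legendre ((f\<^sup>2 - w) * p) l = 1"
      using np by (simp add: Legendre_mult[OF l(1) l2] QuadRes_iff_Legendre)
    then have "QuadRes l ((f\<^sup>2 - w) * p)" by (simp add: QuadRes_iff_Legendre)
    then obtain g where g: "[g\<^sup>2 = (f\<^sup>2 - w) * p] (mod l)" by (auto simp: QuadRes_def)
    have "[f\<^sup>2 - p * (g * h)\<^sup>2 = f\<^sup>2 - p * h\<^sup>2 * ((f\<^sup>2 - w) * p)] (mod l)"
      using cong_scalar_left[OF g, of "p * h\<^sup>2"] by (intro cong_diff cong_refl) (simp add: power_mult_distrib mult_ac)
    also have "f\<^sup>2 - p * h\<^sup>2 * ((f\<^sup>2 - w) * p) = f\<^sup>2 - (f\<^sup>2 - w) * (p * h)\<^sup>2"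
      by (simp add: power_mult_distrib power2_eq_square mult_ac)
    also have "[\<dots> = f\<^sup>2 - (f\<^sup>2 - w) * 1\<^sup>2] (mod l)"
      by (intro cong_diff cong_refl cong_scalar_left cong_pow h)
    finally have "[f\<^sup>2 - p * (g * h)\<^sup>2 = w] (mod l)" by simp
    then show False using contra by blast
  qed
  have mult: "QuadRes l (- int k * w)" for k
  proof (induction k)
    case 0
    show ?case unfolding QuadRes_def by (rule exI[of _ 0]) simp
  next
    case (Suc k)
    then obtain f where f: "[f\<^sup>2 = - int k * w] (mod l)" by (auto simp: QuadRes_def)
    obtain g where "[g\<^sup>2 = f\<^sup>2 - w] (mod l)" using step by (auto simp: QuadRes_def)
    also have "[f\<^sup>2 - w = - int k * w - w] (mod l)" using f by (intro cong_diff cong_refl)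
    also have "- int k * w - w = - int (Suc k) * w" by (simp add: algebra_simps)
    finally show ?case by (auto simp: QuadRes_def)
  qed
  obtain f where "[f\<^sup>2 = - int (l - 1) * w] (mod l)" using mult by (auto simp: QuadRes_def)
  also have "- int (l - 1) * w = w - int l * w" using l2 by (simp add: of_nat_diff algebra_simps)
  also have "[\<dots> = w] (mod l)" by (simp add: cong_iff_dvd_diff)
  finally have "[f\<^sup>2 - p * 0\<^sup>2 = w] (mod l)" by simp
  then show False using contra by blast
qed

section \<open>Hensel lifting of square roots\<close>

lemma hensel_sqrt_odd:
  fixes l s w :: int
  assumes l: "prime l" "l \<noteq> 2" and s: "\<not> l dvd s" "[s\<^sup>2 = w] (mod l)"
  shows "\<exists>r. [r = s] (mod l) \<and> [r\<^sup>2 = w] (mod l ^ Suc n)"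
proof (induction n)
  case 0
  show ?case using s by (intro exI[of _ s]) auto
next
  case (Suc n)
  then obtain r where r: "[r = s] (mod l)" "[r\<^sup>2 = w] (mod l ^ Suc n)" by blast
  obtain t where t: "r\<^sup>2 - w = l ^ Suc n * t" using r(2) unfolding cong_iff_dvd_diff by blast
  have "\<not> l dvd 2" using l primes_dvd_imp_eq[of l 2] by auto
  moreover have "\<not> l dvd r" using r(1) s(1) by (simp add: cong_dvd_iff)
  ultimately have "\<not> l dvd 2 * r" using l by (simp add: prime_dvd_mult_iff)
  then obtain h where h: "[2 * r * h = 1] (mod l)" using prime_inverse_mod[OF l(1)] by blast
  \<comment> \<open>Newton's step: h inverts the derivative 2r modulo l, and t is the error of r
    divided by \<open>l ^ Suc n\<close>.\<close>
  define r' where "r' = r - l ^ Suc n * (h * t)"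
  have "[t * (1 - 2 * r * h) = t * (1 - 1)] (mod l)"
    by (intro cong_scalar_left cong_diff cong_refl h)
  then have "l dvd t * (1 - 2 * r * h)" by (simp add: cong_0_iff)
  then have "l ^ Suc n * l dvd l ^ Suc n * (t * (1 - 2 * r * h))" by (intro mult_dvd_mono) auto
  moreover have "l ^ Suc n * l dvd l ^ Suc n * (l ^ Suc n * (h * t)\<^sup>2)"
    by (intro mult_dvd_mono) auto
  ultimately have "l ^ Suc n * l dvd l ^ Suc n * (t * (1 - 2 * r * h)) + l ^ Suc n * (l ^ Suc n * (h * t)\<^sup>2)"
    by (rule dvd_add)
  also have "\<dots> = (r\<^sup>2 - w) - 2 * r * (l ^ Suc n * (h * t)) + (l ^ Suc n * (h * t))\<^sup>2"
    unfolding t by (simp add: algebra_simps power2_eq_square)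
  also have "\<dots> = r'\<^sup>2 - w" unfolding r'_def by (simp add: algebra_simps power2_eq_square)
  finally have "[r'\<^sup>2 = w] (mod l ^ Suc (Suc n))" by (simp add: cong_iff_dvd_diff mult.commute)
  moreover have "[r' = s] (mod l)"
  proof -
    have "[r' = r] (mod l)" unfolding r'_def cong_iff_dvd_diff by simp
    then show ?thesis using r(1) cong_trans by blast
  qed
  ultimately show ?case by blast
qed

text \<open>At 2 the derivative 2r is not a unit. The lift therefore starts from a square modulo 8,
  and the correction \<open>2 ^ (n + 2) * t\<close> sits one power below the error
  \<open>2 ^ (n + 3) * t\<close>. The new error contains t(1 + r), which is even because r is odd.
  All corrections are multiples of 4, so the class modulo 4 survives.\<close>

lemma hensel_sqrt_two:
  fixes s w :: int
  assumes s: "odd s" "[s\<^sup>2 = w] (mod 8)"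
  shows "\<exists>r. [r = s] (mod 4) \<and> [r\<^sup>2 = w] (mod 2 ^ (n + 3))"
proof (induction n)
  case 0
  show ?case using s by (intro exI[of _ s]) auto
next
  case (Suc n)
  then obtain r where r: "[r = s] (mod 4)" "[r\<^sup>2 = w] (mod 2 ^ (n + 3))" by blast
  obtain t where t: "r\<^sup>2 - w = 2 ^ (n + 3) * t" using r(2) unfolding cong_iff_dvd_diff by blast
  have "4 dvd r - s" using r(1) by (simp add: cong_iff_dvd_diff)
  then have ro: "odd r" using s(1) by presburger
  define r' where "r' = r + 2 ^ (n + 2) * t"
  have "even (t * (1 + r))" using ro by simp
  then have "2 ^ (n + 3) * 2 dvd 2 ^ (n + 3) * (t * (1 + r)) + 2 ^ (n + 3) * (2 * 2 ^ n * t\<^sup>2)"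
    by (intro dvd_add mult_dvd_mono) auto
  also have "2 ^ (n + 3) * (t * (1 + r)) + 2 ^ (n + 3) * (2 * 2 ^ n * t\<^sup>2)
      = (r\<^sup>2 - w) + 2 * r * (2 ^ (n + 2) * t) + (2 ^ (n + 2) * t)\<^sup>2"
    unfolding t by (simp add: algebra_simps power2_eq_square power_add)
  also have "\<dots> = r'\<^sup>2 - w" unfolding r'_def by (simp add: algebra_simps power2_eq_square)
  finally have "[r'\<^sup>2 = w] (mod 2 ^ (Suc n + 3))" by (simp add: cong_iff_dvd_diff power_add mult.commute)
  moreover have "[r' = s] (mod 4)"
  proof -
    have "[r' = r] (mod 4)" unfolding r'_def cong_iff_dvd_diff by (simp add: power_add)
    then show ?thesis using r(1) cong_trans by blast
  qed
  ultimately show ?case by blast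
qed

text \<open>The precision at which a unit must have a square root for that root to lift to every
  power of l.\<close>

definition hensel_modulus :: "int \<Rightarrow> int" where
  "hensel_modulus l = (if l = 2 then 8 else l)"

text \<open>The class in which the lifted root stays and is unique. At 2 the modulus 4 separates an
  odd root from its negative.\<close>

definition hensel_radius :: "int \<Rightarrow> int" where
  "hensel_radius l = (if l = 2 then 4 else l)"

lemma hensel_sqrt:
  fixes l s w :: int
  assumes l: "prime l" and s: "\<not> l dvd s" "[s\<^sup>2 = w] (mod hensel_modulus l)"
  shows "\<exists>r. [r = s] (mod hensel_radius l) \<and> [r\<^sup>2 = w] (mod l ^ n)"
proof (cases "l = 2")
  case True
  then obtain r where "[r = s] (mod 4)" "[r\<^sup>2 = w] (mod 2 ^ (n + 3))"
    using hensel_sqrt_two[of s w n] s by (auto simp: hensel_modulus_def)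
  moreover from this(2) have "[r\<^sup>2 = w] (mod 2 ^ n)"
    by (rule cong_dvd_modulus) (simp add: power_add)
  ultimately show ?thesis using True by (auto simp: hensel_radius_def)
next
  case False
  then obtain r where "[r = s] (mod l)" "[r\<^sup>2 = w] (mod l ^ Suc n)"
    using hensel_sqrt_odd[of l s w n] l s by (auto simp: hensel_modulus_def)
  moreover from this(2) have "[r\<^sup>2 = w] (mod l ^ n)"
    by (rule cong_dvd_modulus) simp
  ultimately show ?thesis using False by (auto simp: hensel_radius_def)
qed

text \<open>The factor r + r' of the difference of squares is congruent to 2s. For odd l it is a
  unit; for l = 2 it is twice an odd number, and this factor 2 is the loss from
  \<open>l ^ Suc n\<close> to \<open>l ^ n\<close>.\<close>

lemma hensel_unique:
  fixes l s r r' :: int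
  assumes l: "prime l" and s: "\<not> l dvd s"
    and r: "[r = s] (mod hensel_radius l)" "[r' = s] (mod hensel_radius l)"
    and eq: "[r\<^sup>2 = r'\<^sup>2] (mod l ^ Suc n)"
  shows "[r = r'] (mod l ^ n)"
proof (cases "l = 2")
  case False
  have "l dvd r - s + (r' - s)"
    using r False by (intro dvd_add) (auto simp: hensel_radius_def cong_iff_dvd_diff)
  then have "l dvd (r + r') - 2 * s" by (simp add: algebra_simps)
  moreover have "\<not> l dvd 2" using l False primes_dvd_imp_eq[of l 2] by auto
  then have "\<not> l dvd 2 * s" using l s by (simp add: prime_dvd_mult_iff)
  ultimately have "\<not> l dvd r + r'" by (metis dvd_diff_right_iff dvd_diff_left_iff)
  then have "coprime (l ^ Suc n) (r + r')" using l by (simp add: prime_imp_coprime)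
  moreover have "l ^ Suc n dvd (r - r') * (r + r')"
    using eq by (simp add: cong_iff_dvd_diff algebra_simps power2_eq_square)
  ultimately have "l ^ Suc n dvd r - r'" by (simp add: coprime_dvd_mult_left_iff)
  then show ?thesis unfolding cong_iff_dvd_diff by (rule dvd_trans[rotated]) simp
next
  case True
  have "4 dvd r - s" "4 dvd r' - s" using r True by (auto simp: hensel_radius_def cong_iff_dvd_diff)
  then obtain i j where ij: "r = s + 4 * i" "r' = s + 4 * j" 
    by (auto elim!: dvdE simp: algebra_simps diff_eq_eq)
  define k where "k = s + 2 * i + 2 * j"
  have k: "r + r' = 2 * k" "odd k" using s True by (simp_all add: ij k_def)
  have "2 * 2 ^ n dvd (r - r') * (r + r')"
    using eq True by (simp add: cong_iff_dvd_diff algebra_simps power2_eq_square)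
  then have "2 * 2 ^ n dvd 2 * ((r - r') * k)" unfolding k(1) by (simp only: mult_ac)
  then have "2 ^ n dvd (r - r') * k" by simp
  moreover have "coprime (2 ^ n) k" using k(2) by (simp add: coprime_left_2_iff_odd)
  ultimately show ?thesis unfolding cong_iff_dvd_diff True by (simp add: coprime_dvd_mult_left_iff)
qed

section \<open>Arithmetic of the two equations over the integers\<close>

locale surface_parameters =
  fixes p a b :: int
  assumes prime_p: "prime p"
    and disc: "(a + b - 1)\<^sup>2 - 4 * a * b = p"
    and four_a: "[4 * a = 1] (mod p)" and four_b: "[4 * b = 1] (mod p)"
    and odd_a: "odd a" and odd_b: "odd b"
begin

text \<open>With a = 2i + 1 and b = 2j + 1 the discriminant is 4i(i - 1) + 4j(j - 1) - 8ij - 3, and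
  products of neighbours are even.\<close>

lemma p_mod_8: "p mod 8 = 5"
proof -
  obtain i j where ij: "a = 2 * i + 1" "b = 2 * j + 1" using odd_a odd_b by (auto elim!: oddE)
  have "even (i * (i - 1))" "even (j * (j - 1))" by auto
  then obtain m n where mn: "i * (i - 1) = 2 * m" "j * (j - 1) = 2 * n" by (metis evenE)
  have "p = 4 * (i * (i - 1)) + 4 * (j * (j - 1)) - 8 * (i * j) - 3"
    unfolding disc[symmetric] ij by (simp add: algebra_simps power2_eq_square)
  then have "p = 5 + 8 * (m + n - i * j - 1)" unfolding mn by simp
  then have "p mod 8 = (5 + 8 * (m + n - i * j - 1)) mod 8" by (rule arg_cong)
  then show ?thesis by (simp only: mod_mult_self2) simp
qed

lemma p_pos: "p > 0" using prime_p by (rule prime_gt_0_int)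

lemma p_gt_4: "p > 4" using p_pos p_mod_8 by presburger

lemma nat_p: "prime (nat p)" "2 < nat p" "int (nat p) = p" "nat p mod 8 = 5" "nat p mod 4 = 1"
proof -
  show "prime (nat p)" using prime_p prime_int_nat_transfer[of p] by blast
  show "nat p mod 8 = 5" using p_mod_8 p_pos nat_mod_distrib[of p 8] by simp
  then show "nat p mod 4 = 1" using mod_mod_cancel[of 4 8 "nat p"] by simp
qed (use p_gt_4 in auto)

lemma Legendre_p_mult: "Legendre (m * n) p = Legendre m p * Legendre n p"
  using Legendre_mult[OF nat_p(1,2)] nat_p(3) by simp

lemma Legendre_p_square: "\<not> p dvd n \<Longrightarrow> Legendre (n * n) p = 1"
  using Legendre_square[OF nat_p(1)] nat_p(3) by simp

lemma Legendre_p_two: "Legendre 2 p = -1"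
  using Legendre_two[OF nat_p(1,4)] nat_p(3) by simp

lemma Legendre_p_minus_one: "Legendre (-1) p = 1"
  using Legendre_minus_one[OF nat_p(1,5)] nat_p(3) by simp

text \<open>The prime \<open>2\<close> is inert because \<open>p \<equiv> 5 (mod 8)\<close>, although \<open>p\<close> is a residue modulo \<open>2\<close>.\<close>

definition inert :: "int \<Rightarrow> bool" where
  "inert l \<longleftrightarrow> prime l \<and> l \<noteq> p \<and> (l = 2 \<or> \<not> QuadRes l p)"

text \<open>Such an l is odd with p a residue modulo l, and reciprocity carries no sign because p is
  1 modulo 4.\<close>

lemma Legendre_p_split_prime:
  assumes "prime l" "l \<noteq> p" "\<not> inert l"
  shows "Legendre l p = 1"
proof -
  have l: "l \<noteq> 2" "QuadRes l p" using assms by (auto simp: inert_def)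
  have l2: "l > 2" using prime_ge_2_int[OF assms(1)] l(1) by simp
  have "[p \<noteq> 0] (mod l)"
    unfolding cong_0_iff using primes_dvd_imp_eq[OF assms(1) prime_p] assms(2) by blast
  then have "Legendre p l = 1" using l(2) by (simp add: Legendre_def)
  moreover have "Legendre l p * Legendre p l = (-1) ^ (nat ((l - 1) div 2 * ((p - 1) div 2)))"
    using Quadratic_Reciprocity_int[of l p] assms(2) l2 nat_p(1) p_gt_4
      prime_int_nat_transfer[of l] assms(1) by linarith
  moreover have "even (nat ((l - 1) div 2 * ((p - 1) div 2)))"
  proof -
    have "even ((p - 1) div 2)" using p_mod_8 by presburger
    then show ?thesis using l2 p_gt_4 by (subst even_nat_iff) (auto intro!: mult_nonneg_nonneg)
  qed
  ultimately show ?thesis by simp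
qed

text \<open>Non-inert primes other than p are residues modulo p, and so is -1; inert primes enter n
  only through squares. The induction strips one non-inert prime or the square of an inert
  one.\<close>

lemma Legendre_p_even_inert:
  assumes "n \<noteq> 0" "\<not> p dvd n" "\<And>l. inert l \<Longrightarrow> even (multiplicity l n)"
  shows "Legendre n p = 1"
  using assms
proof (induction "nat \<bar>n\<bar>" arbitrary: n rule: less_induct)
  case less
  show ?case
  proof (cases "is_unit n")
    case True
    then have "n = 1 \<or> n = -1" by (auto simp: abs_if split: if_splits)
    then show ?thesis using Legendre_p_minus_one Legendre_p_square[of 1] less.prems(2) by auto
  next
    case False
    then obtain l where l: "prime l" "l dvd n" using less.prems(1) prime_divisor_exists by blast
    have lp: "l \<noteq> p" using l less.prems(2) by blast
    have l2: "l \<ge> 2" using l(1) by (rule prime_ge_2_int)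
    show ?thesis
    proof (cases "inert l")
      case False
      obtain m where m: "n = l * m" using l(2) by blast
      have "Legendre m p = 1"
      proof (rule less.hyps)
        show "nat \<bar>m\<bar> < nat \<bar>n\<bar>" using l2 less.prems(1) by (auto simp: m abs_mult)
        show "m \<noteq> 0" "\<not> p dvd m" using less.prems m by auto
        fix l' assume l': "inert l'"
        then have "l' \<noteq> l" "prime l'" using False by (auto simp: inert_def)
        then have "multiplicity l' l = 0"
          using l(1) by (metis not_dvd_imp_multiplicity_0 primes_dvd_imp_eq)
        then have "multiplicity l' n = multiplicity l' m"
          unfolding m using \<open>prime l'\<close> \<open>m \<noteq> 0\<close> l(1)
          by (subst prime_elem_multiplicity_mult_distrib) auto
        then show "even (multiplicity l' m)" using less.prems(3)[OF l'] by simp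
      qed
      then show ?thesis
        unfolding m Legendre_p_mult using Legendre_p_split_prime[OF l(1) lp False] by simp
    next
      case True
      have "multiplicity l n > 0"
        using l less.prems(1) by (intro multiplicity_gt_zero_iff[THEN iffD2]) auto
      then have "2 \<le> multiplicity l n" using less.prems(3)[OF True] by presburger
      then have "l\<^sup>2 dvd n" by (rule multiplicity_dvd')
      then obtain m where m: "n = l * l * m" by (auto simp: power2_eq_square)
      have "Legendre m p = 1"
      proof (rule less.hyps)
        have "1 * \<bar>m\<bar> < (l * l) * \<bar>m\<bar>"
          using l2 less.prems(1) mult_mono[of 2 l 2 l] by (intro mult_strict_right_mono) (auto simp: m)
        then show "nat \<bar>m\<bar> < nat \<bar>n\<bar>" by (auto simp: m abs_mult)
        show m0: "m \<noteq> 0" "\<not> p dvd m" using less.prems m by auto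
        fix l' assume l': "inert l'"
        then have "prime l'" by (simp add: inert_def)
        then have "multiplicity l' n = 2 * multiplicity l' l + multiplicity l' m"
          unfolding m using m0(1) prime_gt_0_int[OF l(1)] by (intro multiplicity_square_mult) auto
        then show "even (multiplicity l' m)" using less.prems(3)[OF l'] by simp
      qed
      moreover have "\<not> p dvd l" using less.prems(2) by (auto simp: m)
      ultimately show ?thesis
        unfolding m Legendre_p_mult[of "l * l"] using Legendre_p_square by simp
    qed
  qed
qed

lemma norm_parity:
  "odd f \<Longrightarrow> odd g \<Longrightarrow> (f\<^sup>2 - p * g\<^sup>2) mod 8 = 4"
proof -
  assume "odd f" "odd g"
  then have "f\<^sup>2 mod 8 = 1" "g\<^sup>2 mod 8 = 1"
    by (simp_all add: odd_square_mod_8)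
  then have "8 dvd f\<^sup>2 - 1" "8 dvd g\<^sup>2 - 1" "8 dvd p - 5"
    using p_mod_8 by presburger+
  then have "8 dvd (f\<^sup>2 - 1) - p * (g\<^sup>2 - 1) - (p - 5)" by (intro dvd_diff[OF dvd_diff[OF _ dvd_mult]])
  then have "8 dvd f\<^sup>2 - p * g\<^sup>2 + 4" by (simp add: algebra_simps)
  then show ?thesis by presburger
qed

text \<open>Descent: a common divisor l of f and g takes the factor l^2 out of the norm. Otherwise l
  does not divide the norm, except that for l = 2 both f and g may be odd; the norm is then 4 modulo
  8 and has valuation exactly 2.\<close>

lemma inert_multiplicity_norm:
  assumes "inert l" "f\<^sup>2 - p * g\<^sup>2 \<noteq> 0"
  shows "even (multiplicity l (f\<^sup>2 - p * g\<^sup>2))"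
  using assms(2)
proof (induction "nat \<bar>f\<^sup>2 - p * g\<^sup>2\<bar>" arbitrary: f g rule: less_induct)
  case less
  let ?n = "f\<^sup>2 - p * g\<^sup>2"
  have l: "prime l" "l \<noteq> p" using assms(1) by (auto simp: inert_def)
  show ?case
  proof (cases "l dvd f \<and> l dvd g")
    case True
    then obtain f' g' where fg: "f = l * f'" "g = l * g'" by (auto elim!: dvdE)
    have n: "?n = l * l * (f'\<^sup>2 - p * g'\<^sup>2)" unfolding fg by (simp add: algebra_simps power2_eq_square)
    have n0: "f'\<^sup>2 - p * g'\<^sup>2 \<noteq> 0" using less.prems n by auto
    have "1 * \<bar>f'\<^sup>2 - p * g'\<^sup>2\<bar> < (l * l) * \<bar>f'\<^sup>2 - p * g'\<^sup>2\<bar>"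
      using prime_ge_2_int[OF l(1)] n0 mult_mono[of 2 l 2 l] by (intro mult_strict_right_mono) auto
    then have "nat \<bar>f'\<^sup>2 - p * g'\<^sup>2\<bar> < nat \<bar>?n\<bar>"
      unfolding n by (auto simp: abs_mult)
    then have "even (multiplicity l (f'\<^sup>2 - p * g'\<^sup>2))" using less.hyps n0 by blast
    moreover have "multiplicity l ?n = 2 + multiplicity l (f'\<^sup>2 - p * g'\<^sup>2)"
    proof -
      have ll: "multiplicity l l = 1" using l(1) by (intro multiplicity_self) auto
      show ?thesis unfolding n using multiplicity_square_mult[OF l(1) _ n0, of l] l(1) ll by force
    qed
    ultimately show ?thesis by simp
  next
    case False
    show ?thesis
    proof (cases "l dvd ?n")
      case True
      have "l = 2" using norm_anisotropic_mod[OF l(1) _ True] False assms(1) by (auto simp: inert_def)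
      have "odd p" using p_mod_8 by presburger
      then have "odd f" "odd g" using False True unfolding \<open>l = 2\<close> by auto
      then have 4: "?n mod 8 = 4" by (rule norm_parity)
      have "multiplicity 2 ?n = 2"
      proof (rule multiplicity_eqI)
        have "4 dvd ?n" "\<not> 8 dvd ?n" using 4 by presburger+
        then show "2\<^sup>2 dvd ?n" "\<not> 2 ^ Suc 2 dvd ?n" by simp_all
      qed
      then show ?thesis unfolding \<open>l = 2\<close> by simp
    qed (simp add: not_dvd_imp_multiplicity_0)
  qed
qed

text \<open>The difference of the equations is z^2 - y^2 = q(u, v), and both uv and 4aq are norms.
  For odd inert l, anisotropy forces a common divisor of u and v to divide every coordinate, and
  then keeps q a unit. The case l = 2 needs the equations modulo 8, hence the exponent 3.\<close>

lemma inert_primitive: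
  assumes l: "inert l"
    and e1: "l ^ 3 dvd y\<^sup>2 - p * x\<^sup>2 - u * v"
    and e2: "l ^ 3 dvd z\<^sup>2 - p * x\<^sup>2 - (u + v) * (a * u + b * v)"
    and prim: "\<not> (l dvd x \<and> l dvd y \<and> l dvd z \<and> l dvd u \<and> l dvd v)"
  shows "\<not> (l dvd u \<and> l dvd v)" and "\<not> l dvd (z - y) * (z + y)"
proof -
  have lp: "prime l" using l by (simp add: inert_def)
  define q where "q = a * u\<^sup>2 + (a + b - 1) * (u * v) + b * v\<^sup>2"
  have "l ^ 3 dvd (z\<^sup>2 - p * x\<^sup>2 - (u + v) * (a * u + b * v)) - (y\<^sup>2 - p * x\<^sup>2 - u * v)"
    using e2 e1 by (rule dvd_diff)
  also have "\<dots> = (z - y) * (z + y) - q"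
    unfolding q_def by (simp add: algebra_simps power2_eq_square)
  finally have q3: "l ^ 3 dvd (z - y) * (z + y) - q" .
  have l3: "l ^ 2 dvd l ^ 3" "l dvd l ^ 3" by (auto simp: power3_eq_cube power2_eq_square)
  have "\<not> (l dvd u \<and> l dvd v) \<and> \<not> l dvd q"
  proof (cases "l = 2")
    case False
    then have nq: "\<not> QuadRes l p" using l by (simp add: inert_def)
    have "\<not> (l dvd u \<and> l dvd v)"
    proof
      assume uv: "l dvd u \<and> l dvd v"
      then have "l\<^sup>2 dvd u * v" by (auto simp: power2_eq_square intro: mult_dvd_mono)
      moreover have "l\<^sup>2 dvd y\<^sup>2 - p * x\<^sup>2 - u * v" using l3(1) e1 by (rule dvd_trans)
      ultimately have "l\<^sup>2 dvd y\<^sup>2 - p * x\<^sup>2"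
        using dvd_add[of "l\<^sup>2" "y\<^sup>2 - p * x\<^sup>2 - u * v" "u * v"] by simp
      then have "l dvd y\<^sup>2 - p * x\<^sup>2" by (rule dvd_trans[rotated]) (simp add: power2_eq_square)
      then have xy: "l dvd y" "l dvd x" using norm_anisotropic_mod[OF lp nq, of y x] by blast+
      have "l dvd z\<^sup>2 - p * x\<^sup>2 - (u + v) * (a * u + b * v)" using l3(2) e2 by (rule dvd_trans)
      then have "l dvd z\<^sup>2 - p * x\<^sup>2 - (u + v) * (a * u + b * v) + (p * x\<^sup>2 + (u + v) * (a * u + b * v))"
        using uv xy by (intro dvd_add[OF _ dvd_add]) (auto simp: power2_eq_square)
      then have "l dvd z" using lp by (simp add: prime_dvd_power_iff)
      then show False using prim xy uv by blast
    qed
    moreover have "\<not> l dvd q"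
    proof
      assume "l dvd q"
      \<comment> \<open>Completing the square: the discriminant of the form q is p.\<close>
      have "4 * a * q = (2 * a * u + (a + b - 1) * v)\<^sup>2 - ((a + b - 1)\<^sup>2 - 4 * a * b) * v\<^sup>2"
        unfolding q_def by (simp add: algebra_simps power2_eq_square)
      then have "4 * a * q = (2 * a * u + (a + b - 1) * v)\<^sup>2 - p * v\<^sup>2" unfolding disc .
      moreover have "l dvd 4 * a * q" using \<open>l dvd q\<close> by simp
      ultimately have *: "l dvd 2 * a * u + (a + b - 1) * v" "l dvd v"
        using norm_anisotropic_mod[OF lp nq, of "2 * a * u + (a + b - 1) * v" v] by simp_all
      then have "l dvd 2 * a * u" using dvd_diff[OF *(1), of "(a + b - 1) * v"] by simp
      moreover have "\<not> l dvd 2" using False primes_dvd_imp_eq[OF lp, of 2] by auto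
      moreover have "\<not> l dvd a"
      proof
        assume "l dvd a"
        \<comment> \<open>Modulo a divisor l of a, the discriminant p would be the square of b -
          1.\<close>
        then have "l dvd a * (a + 2 * (b - 1) - 4 * b)" by simp
        also have "a * (a + 2 * (b - 1) - 4 * b) = p - (b - 1)\<^sup>2"
          unfolding disc[symmetric] by (simp add: algebra_simps power2_eq_square)
        finally have "[(b - 1)\<^sup>2 = p] (mod l)" by (metis cong_iff_dvd_diff cong_sym)
        then show False using nq unfolding QuadRes_def by blast
      qed
      ultimately have "l dvd u" using lp by (simp add: prime_dvd_mult_iff)
      then show False using * \<open>\<not> (l dvd u \<and> l dvd v)\<close> by blast
    qed
    ultimately show ?thesis by blast
  next
    case True
    have oddp: "odd p" using p_mod_8 by presburger
    have e: "8 dvd y\<^sup>2 - p * x\<^sup>2 - u * v" "8 dvd z\<^sup>2 - p * x\<^sup>2 - (u + v) * (a * u + b * v)"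
      using e1 e2 unfolding True by simp_all
    then have e': "even (y\<^sup>2 - p * x\<^sup>2 - u * v)" "even (z\<^sup>2 - p * x\<^sup>2 - (u + v) * (a * u + b * v))"
      by presburger+
    have "\<not> (even u \<and> even v)"
    proof
      assume uv: "even u \<and> even v"
      then have par: "even y = even x" "even z = even x" using e' oddp by auto
      show False
      proof (cases "even x")
        case True
        then show ?thesis using prim par uv unfolding \<open>l = 2\<close> by blast
      next
        case False
        \<comment> \<open>With x, y, z odd both norms are 4 modulo 8. After halving u and v, both rs
          and (r + s)(ar + bs) must be odd; but r + s is even when r and s are odd.\<close>
        obtain r s where rs: "u = 2 * r" "v = 2 * s" using uv by (auto elim!: evenE)
        have 1: "(y\<^sup>2 - p * x\<^sup>2) mod 8 = 4" "(z\<^sup>2 - p * x\<^sup>2) mod 8 = 4"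
          using norm_parity par False by blast+
        have "(u * v) mod 8 = 4" "((u + v) * (a * u + b * v)) mod 8 = 4"
          using e 1 by (metis mod_eq_dvd_iff)+
        moreover have "u * v = 4 * (r * s)" "(u + v) * (a * u + b * v) = 4 * ((r + s) * (a * r + b * s))"
          unfolding rs by (simp_all add: algebra_simps)
        ultimately have "(4 * (r * s)) mod 8 = 4" "(4 * ((r + s) * (a * r + b * s))) mod 8 = 4"
          by simp_all
        moreover have "odd w" if "(4 * w) mod 8 = 4" for w :: int using that by presburger
        ultimately have "odd (r * s)" "odd ((r + s) * (a * r + b * s))" by blast+
        then show False by simp
      qed
    qed
    \<comment> \<open>Modulo 2 the form is u^2 + uv + v^2, whose only zero is (0, 0).\<close>
    moreover have "odd q" if "\<not> (even u \<and> even v)"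
      unfolding q_def using that odd_a odd_b by auto
    ultimately show ?thesis unfolding True by blast
  qed
  then show "\<not> (l dvd u \<and> l dvd v)" and "\<not> l dvd (z - y) * (z + y)"
    using dvd_trans[OF l3(2) q3] dvd_diff[of l "(z - y) * (z + y)" "(z - y) * (z + y) - q"] by auto
qed

text \<open>Each of u and z - y may vanish modulo p. Admitting v and z + y as alternatives always
  leaves a unit of each kind, and the square identity holds for all four combinations.\<close>

lemma p_primitive:
  assumes e1: "p ^ 3 dvd y\<^sup>2 - p * x\<^sup>2 - u * v"
    and e2: "p ^ 3 dvd z\<^sup>2 - p * x\<^sup>2 - (u + v) * (a * u + b * v)"
    and prim: "\<not> (p dvd x \<and> p dvd y \<and> p dvd z \<and> p dvd u \<and> p dvd v)"
  obtains d t where "d = u \<or> d = v" "t = z - y \<or> t = z + y" "\<not> p dvd d" "\<not> p dvd t"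
    "\<not> QuadRes p (d * t)"
proof -
  have np2: "\<not> p dvd 2" using p_gt_4 zdvd_not_zless by fastforce
  have p3: "p ^ 2 dvd p ^ 3" "p dvd p ^ 3" by (auto simp: power3_eq_cube power2_eq_square)
  have "p dvd (y\<^sup>2 - p * x\<^sup>2 - u * v) + p * x\<^sup>2" using dvd_trans[OF p3(2) e1] by (rule dvd_add) simp
  then have y2: "p dvd y\<^sup>2 - u * v" by (simp add: algebra_simps)
  obtain i j where ij: "4 * a = 1 + p * i" "4 * b = 1 + p * j"
    using four_a four_b by (metis cong_iff_lin cong_sym mult.commute)
  have "p dvd 4 * (z\<^sup>2 - p * x\<^sup>2 - (u + v) * (a * u + b * v)) + p * (4 * x\<^sup>2 + (u + v) * (i * u + j * v))"
    using dvd_trans[OF p3(2) e2] by (intro dvd_add[OF dvd_mult dvd_triv_left])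
  also have "4 * (z\<^sup>2 - p * x\<^sup>2 - (u + v) * (a * u + b * v)) = 4 * z\<^sup>2 - 4 * p * x\<^sup>2 - (u + v) * (4 * a * u + 4 * b * v)"
    by (simp add: algebra_simps)
  also have "\<dots> + p * (4 * x\<^sup>2 + (u + v) * (i * u + j * v)) = (2 * z - (u + v)) * (2 * z + (u + v))"
    unfolding ij by (simp add: algebra_simps power2_eq_square)
  finally have "p dvd (2 * z - (u + v)) * (2 * z + (u + v))" .
  then have "p dvd 2 * z - (u + v) \<or> p dvd 2 * z + (u + v)" using prime_p by (simp add: prime_dvd_mult_iff)
  \<comment> \<open>The sign records which of 2z = u + v and 2z = -(u + v) holds modulo p.\<close>
  then obtain \<epsilon> :: int where \<epsilon>: "\<epsilon> = 1 \<or> \<epsilon> = -1" and z: "p dvd 2 * \<epsilon> * z - (u + v)"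
  proof
    assume "p dvd 2 * z + (u + v)"
    moreover have "2 * -1 * z - (u + v) = - (2 * z + (u + v))" by simp
    ultimately have "p dvd 2 * -1 * z - (u + v)" by (simp only: dvd_minus_iff)
    then show ?thesis using that[of "-1"] by blast
  qed (use that[of 1] in auto)
  have \<epsilon>2: "\<epsilon> * \<epsilon> = 1" using \<epsilon> by auto
  have nonres: "\<not> QuadRes p (d * t)"
    if dt: "d = u \<or> d = v" "t = z - y \<or> t = z + y" "\<not> p dvd d" "\<not> p dvd t" for d t
  proof -
    obtain \<eta> :: int where \<eta>: "\<eta> = 1 \<or> \<eta> = -1" "t = z - \<eta> * y" using dt(2) that by (metis diff_minus_eq_add minus_mult_left mult_1)
    \<comment> \<open>For d = u as for d = v, d(u + v) = d^2 + uv, which is d^2 + y^2 modulo p.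
      Replacing 2\<epsilon>z by u + v therefore turns 2\<epsilon>dt into a complete square.\<close>
    have sq: "p dvd 2 * \<epsilon> * (d * t) - (d - \<epsilon> * \<eta> * y) * (d - \<epsilon> * \<eta> * y)"
    proof -
      have "p dvd d * (2 * \<epsilon> * z - (u + v)) - (y\<^sup>2 - u * v)" using z y2 by simp
      also have "\<eta> * \<eta> = 1" using \<eta>(1) by auto
      then have "d * (2 * \<epsilon> * z - (u + v)) - (y\<^sup>2 - u * v)
         = 2 * \<epsilon> * (d * t) - (d - \<epsilon> * \<eta> * y) * (d - \<epsilon> * \<eta> * y)"
        using dt(1) \<epsilon> \<eta> by (auto simp: algebra_simps power2_eq_square)
      finally show ?thesis .
    qed
    have n: "\<not> p dvd 2 * \<epsilon> * (d * t)"
      using prime_p np2 dt \<epsilon> by (auto simp: prime_dvd_mult_iff)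
    have "QuadRes p (2 * \<epsilon> * (d * t))"
      using sq unfolding QuadRes_def by (auto simp: cong_iff_dvd_diff power2_eq_square dvd_diff_commute intro!: exI[of _ "d - \<epsilon> * \<eta> * y"])
    then have "1 = Legendre (2 * \<epsilon> * (d * t)) p" using n by (simp add: Legendre_def cong_0_iff)
    also have "\<dots> = Legendre 2 p * Legendre \<epsilon> p * Legendre (d * t) p" by (simp add: Legendre_p_mult)
    also have "Legendre \<epsilon> p = 1"
      using \<epsilon> Legendre_p_minus_one Legendre_p_square[of 1] prime_p by auto
    finally have "Legendre (d * t) p = -1" by (simp add: Legendre_p_two)
    then show ?thesis by (simp add: QuadRes_iff_Legendre)
  qed
  have uv: "\<not> p dvd u \<or> \<not> p dvd v"
  proof (rule ccontr)
    assume "\<not> (\<not> p dvd u \<or> \<not> p dvd v)"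
    then have uv: "p dvd u" "p dvd v" by auto
    then have "p dvd y\<^sup>2 - u * v + u * v" using y2 by (intro dvd_add) auto
    then have y: "p dvd y" using prime_p by (simp add: prime_dvd_power_iff)
    have "p dvd (2 * \<epsilon> * z - (u + v)) + (u + v)" using z uv by (intro dvd_add) auto
    then have "p dvd z" using prime_p np2 \<epsilon> by (auto simp: prime_dvd_mult_iff)
    \<comment> \<open>Precision p^2 is used here: once p divides u, v and y, the first equation
      leaves p^2 dividing px^2, so p divides x as well.\<close>
    have "p\<^sup>2 dvd u * v" "p\<^sup>2 dvd y\<^sup>2" using uv y by (auto simp: power2_eq_square intro: mult_dvd_mono)
    then have "p\<^sup>2 dvd y\<^sup>2 - u * v - (y\<^sup>2 - p * x\<^sup>2 - u * v)"
      by (rule dvd_diff[OF dvd_diff[OF _ _] dvd_trans[OF p3(1) e1], rotated])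
    then have "p * p dvd p * x\<^sup>2" by (simp add: power2_eq_square)
    then have "p dvd x\<^sup>2" using p_pos by simp
    then have "p dvd x" using prime_p by (simp add: prime_dvd_power_iff)
    then show False using prim uv y \<open>p dvd z\<close> by blast
  qed
  have zy: "\<not> p dvd z - y \<or> \<not> p dvd z + y"
  proof (rule ccontr)
    assume "\<not> (\<not> p dvd z - y \<or> \<not> p dvd z + y)"
    then have *: "p dvd z - y" "p dvd z + y" by auto
    have "p dvd 2 * z" "p dvd 2 * y" using dvd_add[OF *] dvd_diff[OF *(2,1)] by auto
    then have zy: "p dvd z" "p dvd y" using prime_p np2 by (auto simp: prime_dvd_mult_iff)
    have "p dvd y\<^sup>2 - (y\<^sup>2 - u * v)" using zy y2 by (intro dvd_diff[OF _ y2]) (simp add: power2_eq_square)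
    then have 1: "p dvd u \<or> p dvd v" using prime_p by (simp add: prime_dvd_mult_iff)
    have "p dvd 2 * \<epsilon> * z - (2 * \<epsilon> * z - (u + v))" using zy by (intro dvd_diff[OF _ z]) simp
    then have "p dvd u + v" by simp
    then show False using 1 uv by (metis dvd_add_right_iff dvd_add_left_iff)
  qed
  show ?thesis using uv zy nonres that by blast
qed

text \<open>The integer dt receives two Legendre symbols: -1 from its reduction modulo p, and 1
  because inert primes divide it to even powers. Indeed t is prime to every inert l, and d times the
  other one of u, v is the norm y^2 - px^2, of even valuation, while l divides at most one of u and
  v.\<close>

lemma no_integral_points:
  assumes e1: "y\<^sup>2 - p * x\<^sup>2 = u * v"
    and e2: "z\<^sup>2 - p * x\<^sup>2 = (u + v) * (a * u + b * v)"
    and prim: "Gcd {x, y, z, u, v} = 1"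
  shows False
proof -
  have np: "\<not> (l dvd x \<and> l dvd y \<and> l dvd z \<and> l dvd u \<and> l dvd v)" if "prime l" for l :: int
  proof
    assume "l dvd x \<and> l dvd y \<and> l dvd z \<and> l dvd u \<and> l dvd v"
    then have "l dvd Gcd {x, y, z, u, v}" by (intro Gcd_greatest) auto
    then show False using that unfolding prim by (simp add: not_prime_unit)
  qed
  obtain d t where dt: "d = u \<or> d = v" "t = z - y \<or> t = z + y" "\<not> p dvd d" "\<not> p dvd t"
    "\<not> QuadRes p (d * t)"
    using p_primitive[of y x u v z] e1 e2 np[OF prime_p] by auto
  have "Legendre (d * t) p = 1"
  proof (rule Legendre_p_even_inert)
    show "d * t \<noteq> 0" "\<not> p dvd d * t" using dt(3,4) prime_p by (auto simp: prime_dvd_mult_iff)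
    fix l assume l: "inert l"
    then have lp: "prime l" by (simp add: inert_def)
    have pr: "\<not> (l dvd u \<and> l dvd v)" "\<not> l dvd (z - y) * (z + y)"
      using inert_primitive[OF l, of y x u v z] e1 e2 np[OF lp] by auto
    have "\<not> l dvd t" using pr(2) dt(2) by auto
    then have t: "multiplicity l t = 0" by (rule not_dvd_imp_multiplicity_0)
    have d: "even (multiplicity l d)"
    proof (cases "l dvd d")
      case True
      define d' where "d' = (if d = u then v else u)"
      have dd: "d * d' = u * v" "\<not> l dvd d'" using True pr(1) dt(1) by (auto simp: d'_def)
      have "even (multiplicity l (d * d'))"
      proof -
        have "y\<^sup>2 - p * x\<^sup>2 \<noteq> 0" unfolding e1 dd(1)[symmetric] using dd(2) dt(3) by auto
        then show ?thesis unfolding dd(1) e1[symmetric] by (rule inert_multiplicity_norm[OF l])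
      qed
      also have "multiplicity l (d * d') = multiplicity l d + multiplicity l d'"
        using lp dt(3) dd(2) by (intro prime_elem_multiplicity_mult_distrib) auto
      finally show ?thesis using dd(2) by (simp add: not_dvd_imp_multiplicity_0)
    qed (simp add: not_dvd_imp_multiplicity_0)
    have "multiplicity l (d * t) = multiplicity l d + multiplicity l t"
      using lp dt(3,4) by (intro prime_elem_multiplicity_mult_distrib) auto
    then show "even (multiplicity l (d * t))" using t d by simp
  qed
  then show False using dt(5) by (simp add: QuadRes_iff_Legendre)
qed

lemma inert_unit_norm_mod:
  assumes "inert l" "\<not> l dvd w"
  shows "\<exists>f g. [f\<^sup>2 - p * g\<^sup>2 = w] (mod hensel_modulus l)"
proof (cases "l = 2")
  case False
  have l: "prime l" "\<not> QuadRes l p" using assms(1) False by (auto simp: inert_def)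
  have l0: "l \<ge> 0" using prime_gt_0_int[OF l(1)] by simp
  then have "prime (nat l)" using l(1) prime_int_nat_transfer by blast
  then show ?thesis
    using unit_norm_mod_odd[of "nat l" p w] False l l0 by (auto simp: hensel_modulus_def)
next
  case True
  then have "odd w" using assms(2) by simp
  have p8: "8 dvd p - 5" using p_mod_8 by presburger
  \<comment> \<open>Modulo 8 the norm form is f^2 - 5g^2, with values 1, 3, 5, 7 at the pairs 1, 0
    and 0, 1 and 1, 2 and 2, 1.\<close>
  have "w mod 8 = 1 \<or> w mod 8 = 3 \<or> w mod 8 = 5 \<or> w mod 8 = 7" using \<open>odd w\<close> by presburger
  then obtain f g :: int where "8 dvd f\<^sup>2 - 5 * g\<^sup>2 - w"
  proof (elim disjE)
    assume "w mod 8 = 1" then have "8 dvd 1\<^sup>2 - 5 * 0\<^sup>2 - w" by simp presburger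
    then show ?thesis using that by blast
  next
    assume "w mod 8 = 3" then have "8 dvd 0\<^sup>2 - 5 * 1\<^sup>2 - w" by simp presburger
    then show ?thesis using that by blast
  next
    assume "w mod 8 = 5" then have "8 dvd 1\<^sup>2 - 5 * 2\<^sup>2 - w" by simp presburger
    then show ?thesis using that by blast
  next
    assume "w mod 8 = 7" then have "8 dvd 2\<^sup>2 - 5 * 1\<^sup>2 - w" by simp presburger
    then show ?thesis using that by blast
  qed
  then have "8 dvd (f\<^sup>2 - 5 * g\<^sup>2 - w) - (p - 5) * g\<^sup>2" using p8 by (intro dvd_diff[OF _ dvd_mult2])
  also have "\<dots> = f\<^sup>2 - p * g\<^sup>2 - w" by (simp add: algebra_simps)
  finally show ?thesis using True by (auto simp: hensel_modulus_def cong_iff_dvd_diff)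
qed

end

section \<open>Primality of the surface ideal\<close>

lemma UNIV_coord: "UNIV = {Cx, Cy, Cz, Cu, Cv}"
  using coord.exhaust by auto

lemma finite_UNIV_coord [simp]: "finite (UNIV :: coord set)"
  by (simp add: UNIV_coord)

definition pmonom :: "(coord \<Rightarrow>\<^sub>0 nat) \<Rightarrow> (coord \<Rightarrow> 'a) \<Rightarrow> 'a::comm_monoid_mult" where
  "pmonom m c = (\<Prod>i\<in>UNIV. c i ^ Poly_Mapping.lookup m i)"

text \<open>The target is any field of characteristic 0, so that rational terms of Cauchy sequences,
  real points and complex points of the cone share one evaluation map.\<close>

definition peval :: "rpoly \<Rightarrow> (coord \<Rightarrow> 'a) \<Rightarrow> 'a::field_char_0" where
  "peval F c = (\<Sum>m\<in>Poly_Mapping.keys F. of_rat (Poly_Mapping.lookup F m) * pmonom m c)"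

abbreviation pconst :: "rat \<Rightarrow> rpoly" where
  "pconst q \<equiv> Poly_Mapping.single 0 q"

lemma pmonom_add: "pmonom (m + n) c = pmonom m c * pmonom n c"
  by (simp add: pmonom_def lookup_add power_add prod.distrib)

lemma peval_superset:
  assumes "finite S" "Poly_Mapping.keys F \<subseteq> S"
  shows "peval F c = (\<Sum>m\<in>S. of_rat (Poly_Mapping.lookup F m) * pmonom m c)"
  unfolding peval_def using assms
  by (intro sum.mono_neutral_left) (auto simp: in_keys_iff)

lemma peval_zero [simp]: "peval 0 c = 0"
  by (simp add: peval_def)

lemma peval_add [simp]: "peval (F + G) c = peval F c + peval G c"
proof -
  let ?S = "Poly_Mapping.keys F \<union> Poly_Mapping.keys G"
  have "Poly_Mapping.keys (F + G) \<subseteq> ?S" by (rule Poly_Mapping.keys_add)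
  then show ?thesis
    by (simp add: peval_superset[of ?S] lookup_add of_rat_add distrib_right sum.distrib)
qed

lemma peval_sum: "peval (\<Sum>x\<in>S. f x) c = (\<Sum>x\<in>S. peval (f x) c)"
  by (induction S rule: infinite_finite_induct) auto

lemma peval_single: "peval (Poly_Mapping.single m q) c = of_rat q * pmonom m c"
  by (cases "q = 0") (simp_all add: peval_def)

lemma rpoly_expand:
  "F = (\<Sum>m\<in>Poly_Mapping.keys F. Poly_Mapping.single m (Poly_Mapping.lookup F m))"
proof (rule poly_mapping_eqI)
  fix m
  show "Poly_Mapping.lookup F m = Poly_Mapping.lookup
      (\<Sum>m\<in>Poly_Mapping.keys F. Poly_Mapping.single m (Poly_Mapping.lookup F m)) m"
    by (simp add: lookup_sum lookup_single when_def in_keys_iff)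
qed

lemma peval_mult [simp]: "peval (F * G) c = peval F c * peval G c"
proof -
  have "F * G = (\<Sum>m\<in>Poly_Mapping.keys F. \<Sum>n\<in>Poly_Mapping.keys G.
      Poly_Mapping.single (m + n) (Poly_Mapping.lookup F m * Poly_Mapping.lookup G n))"
    by (subst (1) rpoly_expand[of F], subst (1) rpoly_expand[of G]) (simp add: sum_product mult_single)
  then have "peval (F * G) c = (\<Sum>m\<in>Poly_Mapping.keys F. \<Sum>n\<in>Poly_Mapping.keys G.
      of_rat (Poly_Mapping.lookup F m) * pmonom m c * (of_rat (Poly_Mapping.lookup G n) * pmonom n c))"
    by (simp add: peval_sum peval_single of_rat_mult pmonom_add mult_ac)
  then show ?thesis by (simp add: peval_def sum_product)
qed

lemma peval_const [simp]: "peval (pconst q) c = of_rat q"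
  by (simp add: peval_single pmonom_def)

lemma peval_one [simp]: "peval 1 c = 1"
  using peval_const[of 1 c] by simp

lemma peval_of_int [simp]: "peval (of_int k) c = of_int k"
  using peval_const[of "of_int k" c] by (simp del: peval_const)

lemma peval_numeral [simp]: "peval (numeral k) c = numeral k"
  using peval_of_int[of "numeral k" c] by simp

lemma peval_uminus [simp]: "peval (- F) c = - peval F c"
  using peval_add[of F "- F" c] by (simp del: peval_add add: eq_neg_iff_add_eq_0 add.commute)

lemma peval_diff [simp]: "peval (F - G) c = peval F c - peval G c"
  using peval_add[of F "- G" c] by simp

lemma peval_power [simp]: "peval (F ^ k) c = peval F c ^ k"
  by (induction k) auto

lemma peval_pvar [simp]: "peval (pvar i) c = c i"
proof -
  have "pmonom (Poly_Mapping.single i 1) c = (\<Prod>j\<in>UNIV. if j = i then c j else 1)"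
    unfolding pmonom_def by (intro prod.cong) (auto simp: lookup_single when_def)
  also have "\<dots> = c i" by simp
  finally show ?thesis by (simp add: pvar_def peval_single)
qed

lemma pvar_power: "pvar i ^ k = Poly_Mapping.single (Poly_Mapping.single i k) 1"
  by (induction k) (auto simp: pvar_def mult_single single_add[symmetric])

text \<open>Properties stable under sums and products need only be checked on generators of the
  polynomial ring.\<close>

lemma rpoly_induct [case_names const var add mult]:
  assumes const: "\<And>q. P (pconst q)" and var: "\<And>i. P (pvar i)"
    and add: "\<And>F G. P F \<Longrightarrow> P G \<Longrightarrow> P (F + G)" and mult: "\<And>F G. P F \<Longrightarrow> P G \<Longrightarrow> P (F * G)"
  shows "P F"
proof -
  have one: "P 1" using const[of 1] by simp
  have pow: "P (pvar i ^ k)" for i k by (induction k) (auto intro: one var mult)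
  have "P (Poly_Mapping.single m q)" for m q
  proof -
    let ?l = "Poly_Mapping.lookup m"
    have "m = Poly_Mapping.single Cx (?l Cx) + (Poly_Mapping.single Cy (?l Cy) +
       (Poly_Mapping.single Cz (?l Cz) + (Poly_Mapping.single Cu (?l Cu) + Poly_Mapping.single Cv (?l Cv))))"
    proof (rule poly_mapping_eqI)
      fix i show "?l i = Poly_Mapping.lookup (Poly_Mapping.single Cx (?l Cx) + (Poly_Mapping.single Cy (?l Cy) +
       (Poly_Mapping.single Cz (?l Cz) + (Poly_Mapping.single Cu (?l Cu) + Poly_Mapping.single Cv (?l Cv))))) i"
        by (cases i) (simp_all add: lookup_add lookup_single)
    qed
    then have "Poly_Mapping.single m q = pconst q * (pvar Cx ^ ?l Cx * (pvar Cy ^ ?l Cy *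
       (pvar Cz ^ ?l Cz * (pvar Cu ^ ?l Cu * pvar Cv ^ ?l Cv))))"
      by (simp add: pvar_power mult_single)
    then show ?thesis by (auto intro!: const pow mult)
  qed
  then have "P (\<Sum>m\<in>S. Poly_Mapping.single m (Poly_Mapping.lookup F m))" for S
    by (induction S rule: infinite_finite_induct) (auto intro: add simp: const[of 0, simplified])
  then show ?thesis by (subst rpoly_expand)
qed

lemma nat_digit_unique:
  fixes a a' b b' N :: nat
  assumes "a < N" "a' < N" "a + N * b = a' + N * b'"
  shows "a = a' \<and> b = b'"
proof -
  have "(a + N * b) mod N = a" "(a' + N * b') mod N = a'" using assms(1,2) by simp_all
  then show ?thesis using assms by auto
qed

text \<open>Kronecker substitution: evaluation at \<open>t, t\<^sup>N, t\<^bsup>N\<^sup>2\<^esup>, \<dots>\<close> separates the monomials.\<close>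

lemma rpoly_eq_zero_if_vanishes:
  assumes van: "\<And>c :: coord \<Rightarrow> real. peval F c = 0"
  shows "F = 0"
proof (rule ccontr)
  assume "F \<noteq> 0"
  then obtain m0 where m0: "m0 \<in> Poly_Mapping.keys F" using keys_eq_empty[of F] by blast
  let ?l = "Poly_Mapping.lookup :: (coord \<Rightarrow>\<^sub>0 nat) \<Rightarrow> coord \<Rightarrow> nat"
  define N where "N = Suc (Max ((\<lambda>(m, i). ?l m i) ` (Poly_Mapping.keys F \<times> UNIV)))"
  have N: "?l m i < N" if "m \<in> Poly_Mapping.keys F" for m i
    unfolding N_def less_Suc_eq_le using that by (intro Max_ge) force+
  define \<kappa> where "\<kappa> m = ?l m Cx + N * (?l m Cy + N * (?l m Cz + N * (?l m Cu + N * ?l m Cv)))" for m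
  have inj: "m = n" if "m \<in> Poly_Mapping.keys F" "n \<in> Poly_Mapping.keys F" "\<kappa> m = \<kappa> n" for m n
  proof -
    have x: "?l m Cx = ?l n Cx" and 1: "?l m Cy + N * (?l m Cz + N * (?l m Cu + N * ?l m Cv))
        = ?l n Cy + N * (?l n Cz + N * (?l n Cu + N * ?l n Cv))"
      using nat_digit_unique[OF N N] that unfolding \<kappa>_def by blast+
    have y: "?l m Cy = ?l n Cy" and 2: "?l m Cz + N * (?l m Cu + N * ?l m Cv)
        = ?l n Cz + N * (?l n Cu + N * ?l n Cv)"
      using nat_digit_unique[OF N N 1] that by blast+
    have z: "?l m Cz = ?l n Cz" and 3: "?l m Cu + N * ?l m Cv = ?l n Cu + N * ?l n Cv"
      using nat_digit_unique[OF N N 2] that by blast+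
    have u: "?l m Cu = ?l n Cu" and v: "?l m Cv = ?l n Cv"
      using nat_digit_unique[OF N N 3] that by blast+
    show "m = n"
    proof (rule poly_mapping_eqI)
      fix i show "?l m i = ?l n i" using x y z u v by (cases i) auto
    qed
  qed
  define e where "e i = (case i of Cx \<Rightarrow> 1 | Cy \<Rightarrow> N | Cz \<Rightarrow> N * N | Cu \<Rightarrow> N * (N * N) | Cv \<Rightarrow> N * (N * (N * N)))" for i
  define q :: "real poly" where
    "q = (\<Sum>m\<in>Poly_Mapping.keys F. monom (of_rat (Poly_Mapping.lookup F m)) (\<kappa> m))"
  have "poly q t = peval F (\<lambda>i. t ^ e i)" for t
  proof -
    have "pmonom m (\<lambda>i. t ^ e i) = t ^ \<kappa> m" for m
      by (simp add: pmonom_def UNIV_coord e_def \<kappa>_def flip: power_mult power_add)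
         (simp add: algebra_simps)
    then show ?thesis by (simp add: q_def poly_sum poly_monom peval_def)
  qed
  then have "q = 0" using van by (simp add: poly_all_0_iff_0[symmetric])
  then have "0 = coeff q (\<kappa> m0)" by simp
  also have "\<dots> = (\<Sum>m\<in>Poly_Mapping.keys F. if m = m0 then of_rat (Poly_Mapping.lookup F m) else 0)"
    unfolding q_def coeff_sum coeff_monom using inj m0 by (intro sum.cong) auto
  also have "\<dots> = of_rat (Poly_Mapping.lookup F m0)" using m0 by simp
  finally show False using m0 by (simp add: in_keys_iff)
qed

text \<open>On a line, vanishing becomes a question about a one-variable polynomial, which has only
  finitely many roots unless it is zero.\<close>

lemma peval_line:
  "\<exists>q :: real poly. \<forall>t. peval F (\<lambda>i. c i + t * d i) = poly q t"
proof (induction F rule: rpoly_induct)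
  case (const q)
  show ?case by (rule exI[of _ "[:of_rat q:]"]) simp
next
  case (var i)
  show ?case by (rule exI[of _ "[:c i, d i:]"]) simp
next
  case (add F G)
  then obtain q r where "\<forall>t. peval F (\<lambda>i. c i + t * d i) = poly q t" "\<forall>t. peval G (\<lambda>i. c i + t * d i) = poly r t"
    by blast
  then show ?case by (intro exI[of _ "q + r"]) simp
next
  case (mult F G)
  then obtain q r where "\<forall>t. peval F (\<lambda>i. c i + t * d i) = poly q t" "\<forall>t. peval G (\<lambda>i. c i + t * d i) = poly r t"
    by blast
  then show ?case by (intro exI[of _ "q * r"]) simp
qed

lemma of_real_of_rat: "complex_of_real (of_rat q) = of_rat q"
  by (cases q) (simp add: of_rat_rat of_real_divide)

lemma peval_complex_of_real: "peval F (\<lambda>i. complex_of_real (c i)) = of_real (peval F c)"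
  by (induction F rule: rpoly_induct) (auto simp: of_real_of_rat)

text \<open>The polynomials in \<open>x, u, v\<close> alone, over which the coordinate ring is free with basis
  \<open>1, y, z, yz\<close>.\<close>

inductive_set base_ring :: "rpoly set" where
  const: "pconst q \<in> base_ring"
| x: "pvar Cx \<in> base_ring"
| u: "pvar Cu \<in> base_ring"
| v: "pvar Cv \<in> base_ring"
| add: "F \<in> base_ring \<Longrightarrow> G \<in> base_ring \<Longrightarrow> F + G \<in> base_ring"
| mult: "F \<in> base_ring \<Longrightarrow> G \<in> base_ring \<Longrightarrow> F * G \<in> base_ring"

lemma base_ring_consts: "0 \<in> base_ring" "1 \<in> base_ring" "of_int k \<in> base_ring"
  using base_ring.const[of 0] base_ring.const[of 1] base_ring.const[of "of_int k"] by simp_all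

lemma peval_base_ring:
  assumes "A \<in> base_ring" "c Cx = c' Cx" "c Cu = c' Cu" "c Cv = c' Cv"
  shows "peval A c = peval A c'"
  using assms by (induction A rule: base_ring.induct) auto

section \<open>The surface ideal and normal forms modulo it\<close>

context
  fixes p a b :: int
begin

abbreviation (input) "I \<equiv> surface_ideal p a b"

lemma surface_ideal_add: "F \<in> I \<Longrightarrow> G \<in> I \<Longrightarrow> F + G \<in> I"
proof -
  assume "F \<in> I" "G \<in> I"
  then obtain A B A' B' where "F = A * quadric1 p + B * quadric2 p a b" "G = A' * quadric1 p + B' * quadric2 p a b"
    unfolding surface_ideal_def by blast
  then have "F + G = (A + A') * quadric1 p + (B + B') * quadric2 p a b" by (simp add: algebra_simps)
  then show ?thesis unfolding surface_ideal_def by blast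
qed

lemma surface_ideal_mult: "F \<in> I \<Longrightarrow> G * F \<in> I"
proof -
  assume "F \<in> I"
  then obtain A B where "F = A * quadric1 p + B * quadric2 p a b"
    unfolding surface_ideal_def by blast
  then have "G * F = (G * A) * quadric1 p + (G * B) * quadric2 p a b" by (simp add: algebra_simps)
  then show ?thesis unfolding surface_ideal_def by blast
qed

lemma surface_ideal_mult2: "F \<in> I \<Longrightarrow> F * G \<in> I"
  using surface_ideal_mult[of F G] by (simp add: mult.commute)

lemma surface_ideal_uminus: "F \<in> I \<Longrightarrow> - F \<in> I"
  using surface_ideal_mult[of F "-1"] by simp

lemma surface_ideal_diff: "F \<in> I \<Longrightarrow> G \<in> I \<Longrightarrow> F - G \<in> I"
  using surface_ideal_add[OF _ surface_ideal_uminus] by simp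

lemma surface_ideal_zero: "0 \<in> I"
  unfolding surface_ideal_def by (auto intro!: exI[of _ 0])

lemma quadrics_in_surface_ideal: "quadric1 p \<in> I" "quadric2 p a b \<in> I"
proof -
  have "quadric1 p = 1 * quadric1 p + 0 * quadric2 p a b" "quadric2 p a b = 0 * quadric1 p + 1 * quadric2 p a b"
    by simp_all
  then show "quadric1 p \<in> I" "quadric2 p a b \<in> I" unfolding surface_ideal_def by blast+
qed

lemma peval_surface_ideal:
  assumes "F \<in> I" "peval (quadric1 p) c = 0" "peval (quadric2 p a b) c = 0"
  shows "peval F c = 0"
  using assms by (auto simp: surface_ideal_def)

text \<open>The quadrics are monic in y and in z respectively and rewrite y^2 and z^2 as elements of
  \<open>base_ring\<close>. This is the spanning half of freeness; independence emerges in the proof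
  of \<open>in_surface_ideal_if_vanishes\<close>.\<close>

lemma surface_normal_form:
  "\<exists>A\<in>base_ring. \<exists>B\<in>base_ring. \<exists>C\<in>base_ring. \<exists>D\<in>base_ring.
     F - (A + B * pvar Cy + C * pvar Cz + D * (pvar Cy * pvar Cz)) \<in> I"
proof (induction F rule: rpoly_induct)
  case (const q)
  show ?case using base_ring.const[of q] base_ring_consts surface_ideal_zero
    by (intro bexI[of _ "pconst q"] bexI[of _ 0 base_ring]) simp_all
next
  case (var i)
  have *: ?case if "pvar i \<in> base_ring"
    using that base_ring_consts surface_ideal_zero by (intro bexI[of _ "pvar i"] bexI[of _ 0 base_ring]) simp_all
  show ?case
  proof (cases i)
    case Cy
    then show ?thesis using base_ring_consts surface_ideal_zero
      by (intro bexI[of _ 0 base_ring] bexI[of _ 1 base_ring]) simp_all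
  next
    case Cz
    then show ?thesis using base_ring_consts surface_ideal_zero
      by (intro bexI[of _ 0 base_ring] bexI[of _ 1 base_ring]) simp_all
  qed (use * base_ring.intros in auto)
next
  case (add F G)
  from add.IH(1) obtain A B C D where
    m: "A \<in> base_ring" "B \<in> base_ring" "C \<in> base_ring" "D \<in> base_ring"
    and i: "F - (A + B * pvar Cy + C * pvar Cz + D * (pvar Cy * pvar Cz)) \<in> I"
    by (elim bexE) (rule that; assumption)
  from add.IH(2) obtain A' B' C' D' where
    m': "A' \<in> base_ring" "B' \<in> base_ring" "C' \<in> base_ring" "D' \<in> base_ring"
    and i': "G - (A' + B' * pvar Cy + C' * pvar Cz + D' * (pvar Cy * pvar Cz)) \<in> I"
    by (elim bexE) (rule that; assumption)
  have "F + G - ((A + A') + (B + B') * pvar Cy + (C + C') * pvar Cz + (D + D') * (pvar Cy * pvar Cz)) \<in> I"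
    using surface_ideal_add[OF i i'] by (simp add: algebra_simps)
  then show ?case by (intro bexI) (assumption, (intro base_ring.add m m')+)
next
  case (mult F G)
  from mult.IH(1) obtain A B C D where
    m: "A \<in> base_ring" "B \<in> base_ring" "C \<in> base_ring" "D \<in> base_ring"
    and i: "F - (A + B * pvar Cy + C * pvar Cz + D * (pvar Cy * pvar Cz)) \<in> I"
    by (elim bexE) (rule that; assumption)
  from mult.IH(2) obtain A' B' C' D' where
    m': "A' \<in> base_ring" "B' \<in> base_ring" "C' \<in> base_ring" "D' \<in> base_ring"
    and i': "G - (A' + B' * pvar Cy + C' * pvar Cz + D' * (pvar Cy * pvar Cz)) \<in> I"
    by (elim bexE) (rule that; assumption)
  define f where "f = of_int p * (pvar Cx * pvar Cx) + pvar Cu * pvar Cv"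
  define g where "g = of_int p * (pvar Cx * pvar Cx) + (pvar Cu + pvar Cv) * (of_int a * pvar Cu + of_int b * pvar Cv)"
  have fg: "f \<in> base_ring" "g \<in> base_ring"
    unfolding f_def g_def by (intro base_ring.intros base_ring_consts)+
  define y z where "y = pvar Cy" and "z = pvar Cz"
  have q: "quadric1 p = y * y - f" "quadric2 p a b = z * z - g"
    by (simp_all add: quadric1_def quadric2_def f_def g_def y_def z_def power2_eq_square algebra_simps)
  define N N' where "N = A + B * y + C * z + D * (y * z)" and "N' = A' + B' * y + C' * z + D' * (y * z)"
  \<comment> \<open>Multiplication table of 1, y, z, yz under the rules y^2 = f and z^2 = g.\<close>
  define A2 B2 C2 D2 where "A2 = A * A' + B * B' * f + C * C' * g + D * D' * (f * g)"
    and "B2 = A * B' + B * A' + (C * D' + D * C') * g"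
    and "C2 = A * C' + C * A' + (B * D' + D * B') * f"
    and "D2 = A * D' + D * A' + (B * C' + C * B')"
  have m2: "A2 \<in> base_ring" "B2 \<in> base_ring" "C2 \<in> base_ring" "D2 \<in> base_ring"
    unfolding A2_def B2_def C2_def D2_def by (intro base_ring.add base_ring.mult m m' fg)+
  have "F * G - (A2 + B2 * y + C2 * z + D2 * (y * z)) =
      G * (F - N) + N * (G - N')
      + (B * B' + (B * D' + D * B') * z + D * D' * (z * z)) * (y * y - f)
      + (C * C' + (C * D' + D * C') * y + D * D' * f) * (z * z - g)"
    unfolding N_def N'_def A2_def B2_def C2_def D2_def by (simp add: algebra_simps)
  also have "\<dots> \<in> I"
    unfolding q[symmetric] unfolding N_def N'_def y_def z_def
    by (intro surface_ideal_add surface_ideal_mult quadrics_in_surface_ideal i i')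
  finally show ?case unfolding y_def z_def by (intro bexI) (assumption, (rule m2)+)
qed

end

section \<open>Points of the cone with imaginary z, and primality\<close>

lemma poly_eq_zero_if_near:
  fixes q :: "real poly"
  assumes "\<forall>\<^sub>F t in at_right 0. poly q t = 0"
  shows "q = 0"
proof (rule ccontr)
  assume "q \<noteq> 0"
  obtain e where "e > 0" and e: "\<And>t. 0 < t \<Longrightarrow> t < e \<Longrightarrow> poly q t = 0"
    using assms unfolding eventually_at_right_field by blast
  have "{0<..<e} \<subseteq> {t. poly q t = 0}" using e by auto
  then have "finite {0<..<e}" using poly_roots_finite[OF \<open>q \<noteq> 0\<close>] by (rule finite_subset)
  then show False using \<open>e > 0\<close> infinite_Ioo by blast
qed

context surface_parameters
begin

text \<open>The binary form au^2 + (a + b - 1)uv + bv^2 has positive discriminant p, hence takes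
  negative values. The sign of w leaves room for a real x in
  \<open>negative_region_nonempty\<close>.\<close>

lemma quadratic_form_negative:
  "\<exists>w::real. w \<le> 0 \<and> a + (a + b - 1) * w + b * w\<^sup>2 < 0"
proof -
  have ab: "a \<noteq> 0" "b \<noteq> 0" using odd_a odd_b by auto
  consider "a < 0" | "a > 0" "b > 0" | "b < 0" using ab by linarith
  then show ?thesis
  proof cases
    case 1
    then show ?thesis by (intro exI[of _ 0]) simp
  next
    case 2
    let ?c = "real_of_int (a + b - 1)"
    have "?c * ?c - 4 * a * b = real_of_int ((a + b - 1)\<^sup>2 - 4 * a * b)" by (simp add: power2_eq_square)
    then have d: "?c * ?c - 4 * a * b = p" unfolding disc .
    \<comment> \<open>The vertex of the parabola, where 4b times the value is -p.\<close>
    define w where "w = - ?c / (2 * b)"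
    have "4 * b * (a + ?c * w + b * w\<^sup>2) = - p"
    proof -
      have "4 * B * (A + C * (- C / (2 * B)) + B * (- C / (2 * B))\<^sup>2) = 4 * A * B - C * C"
        if "B \<noteq> 0" for A B C :: real
        using that by (simp add: field_simps power2_eq_square)
      from this[of b a ?c] show ?thesis using ab d by (simp add: w_def)
    qed
    moreover have "real_of_int p > 0" using p_pos by simp
    ultimately have "4 * b * (a + ?c * w + b * w\<^sup>2) < 0" by linarith
    then have "a + ?c * w + b * w\<^sup>2 < 0" using 2 by (simp add: mult_less_0_iff)
    moreover have "w \<le> 0" unfolding w_def using 2 by (intro divide_nonpos_pos) auto
    ultimately show ?thesis by (intro exI[of _ w]) simp
  next
    case 3
    \<comment> \<open>Chosen so that (|a| + |a + b - 1|)n - n^2 is exactly -n.\<close>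
    define n where "n = real_of_int (\<bar>a\<bar> + \<bar>a + b - 1\<bar> + 1)"
    have n: "n \<ge> 1" by (simp add: n_def)
    have "a + (a + b - 1) * (- n) + b * (- n)\<^sup>2 \<le> \<bar>a\<bar> * n + \<bar>a + b - 1\<bar> * n + (-1) * n\<^sup>2"
    proof (intro add_mono)
      show "a \<le> real_of_int \<bar>a\<bar> * n" using n mult_left_mono[of 1 n "real_of_int \<bar>a\<bar>"] by simp
      have "real_of_int (- (a + b - 1)) * n \<le> real_of_int \<bar>a + b - 1\<bar> * n"
        using n by (intro mult_right_mono) linarith+
      then show "real_of_int (a + b - 1) * (- n) \<le> real_of_int \<bar>a + b - 1\<bar> * n"
        by (simp add: algebra_simps)
      have "real_of_int b * n\<^sup>2 \<le> (-1) * n\<^sup>2" using 3 by (intro mult_right_mono) auto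
      then show "real_of_int b * (- n)\<^sup>2 \<le> (-1) * n\<^sup>2" by simp
    qed
    also have "\<dots> = - n" by (simp add: n_def algebra_simps power2_eq_square)
    finally show ?thesis using n by (intro exI[of _ "- n"]) simp
  qed
qed

text \<open>The two expressions will be the squares of y and of z. At u = 1, v = w they differ by
  the negative value of the binary form; with e half its absolute value, px^2 = e - w makes them e
  and -e.\<close>

lemma negative_region_nonempty:
  "\<exists>(x::real) (u::real) (v::real). u > 0 \<and> p * x\<^sup>2 + u * v > 0 \<and> p * x\<^sup>2 + (u + v) * (a * u + b * v) < 0"
proof -
  obtain w :: real where w: "w \<le> 0" "a + (a + b - 1) * w + b * w\<^sup>2 < 0"
    using quadratic_form_negative by blast
  define e where "e = - (a + (a + b - 1) * w + b * w\<^sup>2) / 2"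
  have e: "e > 0" using w(2) by (simp add: e_def)
  define x where "x = sqrt ((e - w) / p)"
  have px: "p * x\<^sup>2 = e - w" using e w(1) p_pos by (simp add: x_def)
  have "e - w + (1 + w) * (a * 1 + b * w) = e + (a + (a + b - 1) * w + b * w\<^sup>2)"
    by (simp add: algebra_simps power2_eq_square)
  also have "\<dots> = - e" unfolding e_def by (simp add: field_simps)
  finally show ?thesis using e px by (intro exI[of _ x] exI[of _ 1] exI[of _ w]) simp
qed

definition cone_point :: "'a \<Rightarrow> 'a \<Rightarrow> 'a \<Rightarrow> 'a \<Rightarrow> 'a \<Rightarrow> coord \<Rightarrow> 'a" where
  "cone_point x y z u v i = (case i of Cx \<Rightarrow> x | Cy \<Rightarrow> y | Cz \<Rightarrow> z | Cu \<Rightarrow> u | Cv \<Rightarrow> v)"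

lemma cone_point_simps [simp]:
  "cone_point x y z u v Cx = x" "cone_point x y z u v Cy = y" "cone_point x y z u v Cz = z"
  "cone_point x y z u v Cu = u" "cone_point x y z u v Cv = v"
  by (simp_all add: cone_point_def)

text \<open>The region is open and nonempty. On the line from one of its points to an arbitrary
  point the polynomial vanishes for small parameters, hence identically, in particular at parameter
  1.\<close>

lemma base_ring_vanishing:
  assumes A: "A \<in> base_ring"
    and van: "\<And>(x::real) (u::real) (v::real). u > 0 \<Longrightarrow> p * x\<^sup>2 + u * v > 0 \<Longrightarrow> p * x\<^sup>2 + (u + v) * (a * u + b * v) < 0
      \<Longrightarrow> peval A (cone_point x 0 0 u v) = 0"
  shows "A = 0"
proof (rule rpoly_eq_zero_if_vanishes)
  fix c :: "coord \<Rightarrow> real"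
  obtain x u v :: real where w: "u > 0" "p * x\<^sup>2 + u * v > 0" "p * x\<^sup>2 + (u + v) * (a * u + b * v) < 0"
    using negative_region_nonempty by blast
  define d where "d i = c i - cone_point x 0 0 u v i" for i
  obtain q :: "real poly" where q: "\<And>t. peval A (\<lambda>i. cone_point x 0 0 u v i + t * d i) = poly q t"
    using peval_line by metis
  let ?x = "\<lambda>t. x + t * d Cx" and ?u = "\<lambda>t. u + t * d Cu" and ?v = "\<lambda>t. v + t * d Cv"
  \<comment> \<open>The limits keep the shape with 0 substituted for t, in which the limit rules
    produce them.\<close>
  have "(?u \<longlongrightarrow> u + 0 * d Cu) (at_right 0)"
    "((\<lambda>t. p * (?x t)\<^sup>2 + ?u t * ?v t) \<longlongrightarrow> p * (x + 0 * d Cx)\<^sup>2 + (u + 0 * d Cu) * (v + 0 * d Cv)) (at_right 0)"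
    "((\<lambda>t. p * (?x t)\<^sup>2 + (?u t + ?v t) * (a * ?u t + b * ?v t)) \<longlongrightarrow>
       p * (x + 0 * d Cx)\<^sup>2 + ((u + 0 * d Cu) + (v + 0 * d Cv)) * (a * (u + 0 * d Cu) + b * (v + 0 * d Cv))) (at_right 0)"
    by (intro tendsto_intros)+
  then have "\<forall>\<^sub>F t in at_right 0. ?u t > 0" "\<forall>\<^sub>F t in at_right 0. p * (?x t)\<^sup>2 + ?u t * ?v t > 0"
    "\<forall>\<^sub>F t in at_right 0. p * (?x t)\<^sup>2 + (?u t + ?v t) * (a * ?u t + b * ?v t) < 0"
    using w by (auto elim!: order_tendstoD)
  then have "\<forall>\<^sub>F t in at_right 0. poly q t = 0"
  proof eventually_elim
    case (elim t)
    have "poly q t = peval A (cone_point (?x t) 0 0 (?u t) (?v t))"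
      unfolding q[symmetric] by (rule peval_base_ring[OF A]) simp_all
    also have "\<dots> = 0" using van elim by blast
    finally show ?case .
  qed
  then have "q = 0" by (rule poly_eq_zero_if_near)
  then have "peval A (\<lambda>i. cone_point x 0 0 u v i + 1 * d i) = 0" unfolding q by simp
  then show "peval A c = 0" by (simp add: d_def)
qed

text \<open>At a point with z imaginary and the other coordinates real, the real and imaginary parts
  separate A + By from C + Dy in the normal form. Both signs of y are allowed over the same x, u, v,
  which separates A from B and C from D. All four thus vanish on an open region, and so are
  zero.\<close>

lemma in_surface_ideal_if_vanishes:
  assumes van: "\<And>(x::real) (y::real) (w::real) (u::real) (v::real). u > 0 \<Longrightarrow> y\<^sup>2 - p * x\<^sup>2 = u * v \<Longrightarrow>
      - (w\<^sup>2) - p * x\<^sup>2 = (u + v) * (a * u + b * v) \<Longrightarrow> w \<noteq> 0 \<Longrightarrow>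
      peval F (cone_point (of_real x) (of_real y) (\<i> * of_real w) (of_real u) (of_real v)) = 0"
  shows "F \<in> surface_ideal p a b"
proof -
  obtain A B C D where m: "A \<in> base_ring" "B \<in> base_ring" "C \<in> base_ring" "D \<in> base_ring"
    and nf: "F - (A + B * pvar Cy + C * pvar Cz + D * (pvar Cy * pvar Cz)) \<in> surface_ideal p a b"
    using surface_normal_form[of F p a b] by (elim bexE) (rule that; assumption)
  have "peval A (cone_point x 0 0 u v) = 0 \<and> peval B (cone_point x 0 0 u v) = 0 \<and>
      peval C (cone_point x 0 0 u v) = 0 \<and> peval D (cone_point x 0 0 u v) = 0"
    if w: "u > 0" "p * x\<^sup>2 + u * v > 0" "p * x\<^sup>2 + (u + v) * (a * u + b * v) < 0" for x u v :: real
  proof -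
    define y where "y = sqrt (p * x\<^sup>2 + u * v)"
    define z where "z = sqrt (- (p * x\<^sup>2 + (u + v) * (a * u + b * v)))"
    have y: "y \<noteq> 0" "y\<^sup>2 = p * x\<^sup>2 + u * v" and z: "z \<noteq> 0" "z\<^sup>2 = - (p * x\<^sup>2 + (u + v) * (a * u + b * v))"
      using w by (simp_all add: y_def z_def)
    have e: "peval E (cone_point (of_real x) Y Z (of_real u) (of_real v)) = complex_of_real (peval E (cone_point x 0 0 u v))"
      if "E \<in> base_ring" for E Y Z
      unfolding peval_complex_of_real[symmetric] by (rule peval_base_ring[OF that]) simp_all
    have *: "peval A (cone_point x 0 0 u v) + peval B (cone_point x 0 0 u v) * s = 0 \<and>
       peval C (cone_point x 0 0 u v) + peval D (cone_point x 0 0 u v) * s = 0" if s: "s\<^sup>2 = p * x\<^sup>2 + u * v" for s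
    proof -
      let ?c = "cone_point (of_real x) (of_real s) (\<i> * of_real z) (of_real u) (of_real v)"
      have F0: "peval F ?c = 0" using van[of u s x v z] w s z by (simp add: algebra_simps)
      have sq: "(complex_of_real s)\<^sup>2 = of_real (p * x\<^sup>2 + u * v)"
        "(complex_of_real z)\<^sup>2 = of_real (- (p * x\<^sup>2 + (u + v) * (a * u + b * v)))"
        unfolding s[symmetric] z(2)[symmetric] by simp_all
      have "peval (F - (A + B * pvar Cy + C * pvar Cz + D * (pvar Cy * pvar Cz))) ?c = 0"
        by (rule peval_surface_ideal[OF nf])
           (simp_all add: quadric1_def quadric2_def power_mult_distrib sq)
      then have "peval (A + B * pvar Cy + C * pvar Cz + D * (pvar Cy * pvar Cz)) ?c = 0"
        using F0 unfolding peval_diff[of F] by (simp only: diff_0 neg_equal_0_iff_equal)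
      then have "of_real (peval A (cone_point x 0 0 u v) + peval B (cone_point x 0 0 u v) * s)
        + \<i> * of_real (z * (peval C (cone_point x 0 0 u v) + peval D (cone_point x 0 0 u v) * s)) = (0 :: complex)"
        by (simp add: e m algebra_simps)
      then show ?thesis using z(1) by (simp add: complex_eq_iff)
    qed
    show ?thesis using *[of y] *[of "- y"] y by auto
  qed
  then have "A = 0" "B = 0" "C = 0" "D = 0"
    using base_ring_vanishing m by blast+
  then show ?thesis using nf by simp
qed

text \<open>In the chart u = 1 the point has coordinates X, Y, \<zeta>, W, and S restores the
  homogeneous scale. Since \<zeta>^2 is polynomial in t, every value reduces to an expression linear
  in \<zeta>.\<close>

lemma peval_cone_norm:
  fixes S X Y :: "real poly"
  shows "\<exists>\<alpha> \<beta> :: real poly. \<forall>t \<zeta>. \<zeta>\<^sup>2 = of_real (poly D t) \<longrightarrow>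
    peval F (cone_point (of_real (poly (S * X) t)) (of_real (poly (S * Y) t)) (of_real (poly S t) * \<zeta>)
       (of_real (poly S t)) (of_real (poly (S * W) t)))
    = complex_of_real (poly \<alpha> t) + \<zeta> * complex_of_real (poly \<beta> t)"
proof (induction F rule: rpoly_induct)
  case (const q)
  show ?case by (rule exI[of _ "[:of_rat q:]"], rule exI[of _ 0]) (simp add: of_real_of_rat)
next
  case (var i)
  show ?case
  proof (cases i)
    case Cx
    show ?thesis by (rule exI[of _ "S * X"], rule exI[of _ 0]) (simp add: Cx)
  next
    case Cy
    show ?thesis by (rule exI[of _ "S * Y"], rule exI[of _ 0]) (simp add: Cy)
  next
    case Cz
    show ?thesis by (rule exI[of _ 0], rule exI[of _ S]) (simp add: Cz)
  next
    case Cu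
    show ?thesis by (rule exI[of _ S], rule exI[of _ 0]) (simp add: Cu)
  next
    case Cv
    show ?thesis by (rule exI[of _ "S * W"], rule exI[of _ 0]) (simp add: Cv)
  qed
next
  case (add F G)
  then obtain \<alpha> \<beta> \<alpha>' \<beta>' where "\<forall>t \<zeta>. \<zeta>\<^sup>2 = of_real (poly D t) \<longrightarrow>
    peval F (cone_point (of_real (poly (S * X) t)) (of_real (poly (S * Y) t)) (of_real (poly S t) * \<zeta>)
       (of_real (poly S t)) (of_real (poly (S * W) t)))
    = complex_of_real (poly \<alpha> t) + \<zeta> * complex_of_real (poly \<beta> t)"
   "\<forall>t \<zeta>. \<zeta>\<^sup>2 = of_real (poly D t) \<longrightarrow>
    peval G (cone_point (of_real (poly (S * X) t)) (of_real (poly (S * Y) t)) (of_real (poly S t) * \<zeta>)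
       (of_real (poly S t)) (of_real (poly (S * W) t)))
    = complex_of_real (poly \<alpha>' t) + \<zeta> * complex_of_real (poly \<beta>' t)" by blast
  then show ?case
    by (intro exI[of _ "\<alpha> + \<alpha>'"] exI[of _ "\<beta> + \<beta>'"]) (simp add: algebra_simps)
next
  case (mult F G)
  then obtain \<alpha> \<beta> \<alpha>' \<beta>' where *: "\<forall>t \<zeta>. \<zeta>\<^sup>2 = of_real (poly D t) \<longrightarrow>
    peval F (cone_point (of_real (poly (S * X) t)) (of_real (poly (S * Y) t)) (of_real (poly S t) * \<zeta>)
       (of_real (poly S t)) (of_real (poly (S * W) t)))
    = complex_of_real (poly \<alpha> t) + \<zeta> * complex_of_real (poly \<beta> t)"
   "\<forall>t \<zeta>. \<zeta>\<^sup>2 = of_real (poly D t) \<longrightarrow>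
    peval G (cone_point (of_real (poly (S * X) t)) (of_real (poly (S * Y) t)) (of_real (poly S t) * \<zeta>)
       (of_real (poly S t)) (of_real (poly (S * W) t)))
    = complex_of_real (poly \<alpha>' t) + \<zeta> * complex_of_real (poly \<beta>' t)" by blast
  have "(complex_of_real r + \<zeta> * of_real s) * (of_real r' + \<zeta> * of_real s')
      = of_real (r * r' + d * (s * s')) + \<zeta> * of_real (r * s' + s * r')"
    if "\<zeta>\<^sup>2 = of_real d" for r s r' s' d and \<zeta> :: complex
  proof -
    have "(complex_of_real r + \<zeta> * of_real s) * (of_real r' + \<zeta> * of_real s')
      = of_real r * of_real r' + \<zeta>\<^sup>2 * (of_real s * of_real s') + \<zeta> * (of_real r * of_real s' + of_real s * of_real r')"
      by (simp add: algebra_simps power2_eq_square)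
    then show ?thesis unfolding that by simp
  qed
  then show ?case using *
    by (intro exI[of _ "\<alpha> * \<alpha>' + D * (\<beta> * \<beta>')"] exI[of _ "\<alpha> * \<beta>' + \<beta> * \<alpha>'"]) simp
qed

text \<open>A polynomial outside the ideal is nonzero at a point of the cone with \<open>z\<close> imaginary and the other
  coordinates real. There \<open>z/u\<close> is a square root of a negative number \<open>D\<close>, so that the norm
  \<open>\<alpha>\<^sup>2 - D\<beta>\<^sup>2\<close> of its value \<open>\<alpha> + \<beta>z/u\<close> is nonzero as well. Along the line through two such points these
  norms are real polynomials in one variable, and a product of nonzero ones is nonzero.\<close>

theorem surface_ideal_prime:
  assumes "F * G \<in> surface_ideal p a b"
  shows "F \<in> surface_ideal p a b \<or> G \<in> surface_ideal p a b"
proof (rule ccontr)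
  assume "\<not> (F \<in> surface_ideal p a b \<or> G \<in> surface_ideal p a b)"
  then have notin: "F \<notin> surface_ideal p a b" "G \<notin> surface_ideal p a b" by auto
  let ?P = "\<lambda>F (x::real) (y::real) (w::real) (u::real) (v::real). u > 0 \<and> y\<^sup>2 - p * x\<^sup>2 = u * v \<and>
      - (w\<^sup>2) - p * x\<^sup>2 = (u + v) * (a * u + b * v) \<and> w \<noteq> 0 \<and>
      peval F (cone_point (of_real x) (of_real y) (\<i> * of_real w) (of_real u) (of_real v)) \<noteq> 0"
  have ex: "\<exists>x y w u v. ?P F x y w u v" if "F \<notin> surface_ideal p a b" for F
    using in_surface_ideal_if_vanishes[of F] that by blast
  obtain x0 y0 w0 u0 v0 where P0: "?P F x0 y0 w0 u0 v0" using ex[OF notin(1)] by blast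
  obtain x1 y1 w1 u1 v1 where P1: "?P G x1 y1 w1 u1 v1" using ex[OF notin(2)] by blast
  \<comment> \<open>S, X and Y interpolate u, x/u and y/u linearly between the two points, at t = 0
    and t = 1. The quadrics then dictate W for v/u and D for (z/u)^2.\<close>
  define S where "S = [:u0, u1 - u0:]"
  define X where "X = [:x0 / u0, x1 / u1 - x0 / u0:]"
  define Y where "Y = [:y0 / u0, y1 / u1 - y0 / u0:]"
  define W where "W = Y\<^sup>2 - [:of_int p:] * X\<^sup>2"
  define D where "D = [:of_int p:] * X\<^sup>2 + (1 + W) * ([:of_int a:] + [:of_int b:] * W)"
  let ?pt = "\<lambda>t \<zeta>. cone_point (of_real (poly (S * X) t)) (of_real (poly (S * Y) t)) (of_real (poly S t) * \<zeta>)
       (of_real (poly S t)) (complex_of_real (poly (S * W) t))"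
  obtain \<alpha> \<beta> where F: "\<And>t \<zeta>. \<zeta>\<^sup>2 = of_real (poly D t) \<Longrightarrow>
      peval F (?pt t \<zeta>) = complex_of_real (poly \<alpha> t) + \<zeta> * complex_of_real (poly \<beta> t)"
    using peval_cone_norm[of D F S X Y W] by blast
  obtain \<alpha>' \<beta>' where G: "\<And>t \<zeta>. \<zeta>\<^sup>2 = of_real (poly D t) \<Longrightarrow>
      peval G (?pt t \<zeta>) = complex_of_real (poly \<alpha>' t) + \<zeta> * complex_of_real (poly \<beta>' t)"
    using peval_cone_norm[of D G S X Y W] by blast
  have point: "poly D t = - ((w / u)\<^sup>2) \<and> cone_point (of_real x) (of_real y) (\<i> * of_real w) (of_real u) (of_real v) = ?pt t (\<i> * of_real (w / u))"
    if P: "(u::real) > 0" "y\<^sup>2 - p * x\<^sup>2 = u * v" "- (w\<^sup>2) - p * x\<^sup>2 = (u + v) * (a * u + b * v)"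
      and t: "poly S t = u" "poly X t = x / u" "poly Y t = y / u" for x y w u v t :: real
  proof -
    have "poly W t = (y\<^sup>2 - p * x\<^sup>2) / u\<^sup>2"
      unfolding W_def by (simp add: t power_divide diff_divide_distrib)
    also have "\<dots> = v / u" unfolding P(2) using P(1) by (simp add: power2_eq_square)
    finally have W: "poly W t = v / u" .
    have "poly D t = p * (x / u)\<^sup>2 + (1 + v / u) * (a + b * (v / u))"
      unfolding D_def by (simp add: t W)
    also have "\<dots> = (p * x\<^sup>2 + (u + v) * (a * u + b * v)) / u\<^sup>2"
      using P(1) by (simp add: field_simps power2_eq_square)
    also have "\<dots> = - ((w / u)\<^sup>2)" unfolding P(3)[symmetric] by (simp add: power_divide)
    finally have D: "poly D t = - ((w / u)\<^sup>2)" .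
    have "cone_point (of_real x) (of_real y) (\<i> * of_real w) (of_real u) (of_real v) i = ?pt t (\<i> * of_real (w / u)) i" for i
      using P(1) by (cases i) (simp_all add: t W)
    then show ?thesis using D by blast
  qed
  have norm_nz: "r\<^sup>2 - d * s\<^sup>2 \<noteq> 0" if "complex_of_real r + \<zeta> * of_real s \<noteq> 0" "d < 0" for r s d :: real and \<zeta>
  proof
    assume "r\<^sup>2 - d * s\<^sup>2 = 0"
    moreover have "- (d * s\<^sup>2) \<ge> 0" using that(2) by (simp add: mult_nonpos_nonneg)
    moreover have "r\<^sup>2 \<ge> 0" by simp
    ultimately have "r\<^sup>2 = 0" "d * s\<^sup>2 = 0" by linarith+
    then show False using that by simp
  qed
  define N where "N = (\<alpha>\<^sup>2 - D * \<beta>\<^sup>2) * (\<alpha>'\<^sup>2 - D * \<beta>'\<^sup>2)"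
  have "poly (\<alpha>\<^sup>2 - D * \<beta>\<^sup>2) 0 \<noteq> 0"
  proof -
    have p: "poly D 0 = - ((w0 / u0)\<^sup>2)" "cone_point (of_real x0) (of_real y0) (\<i> * of_real w0) (of_real u0) (of_real v0) = ?pt 0 (\<i> * of_real (w0 / u0))"
      using point[of u0 y0 x0 v0 w0 0] P0 by (auto simp: S_def X_def Y_def)
    have "complex_of_real (poly \<alpha> 0) + (\<i> * of_real (w0 / u0)) * of_real (poly \<beta> 0) \<noteq> 0"
    proof -
      have "(\<i> * complex_of_real (w0 / u0))\<^sup>2 = of_real (poly D 0)"
        unfolding p(1) power_mult_distrib by simp
      from F[OF this] show ?thesis using P0 unfolding p(2) by argo
    qed
    moreover have "poly D 0 < 0" unfolding p(1) using P0 by simp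
    ultimately show ?thesis using norm_nz unfolding poly_diff poly_mult poly_power by blast
  qed
  moreover have "poly (\<alpha>'\<^sup>2 - D * \<beta>'\<^sup>2) 1 \<noteq> 0"
  proof -
    have p: "poly D 1 = - ((w1 / u1)\<^sup>2)" "cone_point (of_real x1) (of_real y1) (\<i> * of_real w1) (of_real u1) (of_real v1) = ?pt 1 (\<i> * of_real (w1 / u1))"
      using point[of u1 y1 x1 v1 w1 1] P1 by (auto simp: S_def X_def Y_def)
    have "complex_of_real (poly \<alpha>' 1) + (\<i> * of_real (w1 / u1)) * of_real (poly \<beta>' 1) \<noteq> 0"
    proof -
      have "(\<i> * complex_of_real (w1 / u1))\<^sup>2 = of_real (poly D 1)"
        unfolding p(1) power_mult_distrib by simp
      from G[OF this] show ?thesis using P1 unfolding p(2) by argo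
    qed
    moreover have "poly D 1 < 0" unfolding p(1) using P1 by simp
    ultimately show ?thesis using norm_nz unfolding poly_diff poly_mult poly_power by blast
  qed
  ultimately have "N \<noteq> 0" unfolding N_def by (metis mult_eq_0_iff poly_0)
  then obtain t where t: "poly N t \<noteq> 0" using poly_all_0_iff_0 by blast
  \<comment> \<open>At this t the sign of D(t) is unknown, so \<zeta> is a complex root. A nonzero
    norm still makes \<alpha> + \<beta>\<zeta> nonzero, being its product with \<alpha> -
    \<beta>\<zeta>.\<close>
  define \<zeta> where "\<zeta> = csqrt (of_real (poly D t))"
  have \<zeta>: "\<zeta>\<^sup>2 = of_real (poly D t)" by (simp add: \<zeta>_def)
  have fac: "complex_of_real r + \<zeta> * of_real s \<noteq> 0" if "r\<^sup>2 - poly D t * s\<^sup>2 \<noteq> 0" for r s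
  proof
    assume "complex_of_real r + \<zeta> * of_real s = 0"
    moreover have "(complex_of_real r + \<zeta> * of_real s) * (of_real r - \<zeta> * of_real s) = (of_real r)\<^sup>2 - \<zeta>\<^sup>2 * (of_real s)\<^sup>2"
      by (simp add: algebra_simps power2_eq_square)
    moreover have "\<dots> = complex_of_real (r\<^sup>2 - poly D t * s\<^sup>2)" unfolding \<zeta> by simp
    ultimately show False using that by (metis mult_zero_left of_real_eq_0_iff)
  qed
  have "peval F (?pt t \<zeta>) \<noteq> 0" "peval G (?pt t \<zeta>) \<noteq> 0"
    unfolding F[OF \<zeta>] G[OF \<zeta>] using t by (auto intro!: fac simp: N_def)
  moreover have "peval (F * G) (?pt t \<zeta>) = 0"
    by (rule peval_surface_ideal[OF assms])
       (simp_all add: quadric1_def quadric2_def power_mult_distrib \<zeta> D_def W_def, simp_all add: algebra_simps power2_eq_square)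
  ultimately show False by simp
qed

end

section \<open>The function field and the Brauer class\<close>

lemma homogeneous_add: "homogeneous d F \<Longrightarrow> homogeneous d G \<Longrightarrow> homogeneous d (F + G)"
  using Poly_Mapping.keys_add[of F G] unfolding homogeneous_def by blast

lemma homogeneous_uminus: "homogeneous d F \<Longrightarrow> homogeneous d (- F)"
  unfolding homogeneous_def by (simp add: in_keys_iff)

lemma homogeneous_diff: "homogeneous d F \<Longrightarrow> homogeneous d G \<Longrightarrow> homogeneous d (F - G)"
  using homogeneous_add[OF _ homogeneous_uminus] by simp

lemma homogeneous_mult:
  assumes "homogeneous d F" "homogeneous e G"
  shows "homogeneous (d + e) (F * G)"
  unfolding homogeneous_def
proof
  fix m assume "m \<in> Poly_Mapping.keys (F * G)"
  then obtain k l where "m = k + l" "k \<in> Poly_Mapping.keys F" "l \<in> Poly_Mapping.keys G"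
    using Poly_Mapping.keys_mult[of F G] by blast
  then show "(\<Sum>i\<in>UNIV. Poly_Mapping.lookup m i) = d + e"
    using assms by (simp add: homogeneous_def lookup_add sum.distrib)
qed

lemma homogeneous_zero: "homogeneous d 0"
  by (simp add: homogeneous_def)

lemma homogeneous_of_int: "homogeneous 0 (of_int k)"
proof -
  have "homogeneous 0 (pconst (of_int k))" by (simp add: homogeneous_def del: single_of_int)
  then show ?thesis by simp
qed

lemma homogeneous_one: "homogeneous 0 1"
  using homogeneous_of_int[of 1] by simp

lemma homogeneous_scale: "homogeneous d F \<Longrightarrow> homogeneous d (of_int k * F)"
  using homogeneous_mult[OF homogeneous_of_int] by fastforce

lemma homogeneous_scale2: "homogeneous d F \<Longrightarrow> homogeneous d (numeral k * F)"
  using homogeneous_scale[of d F "numeral k"] by simp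

lemma homogeneous_pvar: "homogeneous 1 (pvar i)"
proof -
  have "(\<Sum>j\<in>UNIV. Poly_Mapping.lookup (Poly_Mapping.single i (1::nat)) j) = (\<Sum>j\<in>UNIV. if j = i then 1 else 0)"
    by (intro sum.cong) (auto simp: lookup_single when_def)
  then show ?thesis by (simp add: homogeneous_def pvar_def)
qed

text \<open>The operations of \<open>function_field\<close> are unions over all representatives;
  independence of the representatives collapses such a union to a single class.\<close>

lemma UN_pairs_const:
  assumes "\<And>A B A' B'. (A, B) \<in> X \<Longrightarrow> (A', B') \<in> Y \<Longrightarrow> f A B A' B' = Z" "X \<noteq> {}" "Y \<noteq> {}"
  shows "(\<Union>(A, B)\<in>X. \<Union>(A', B')\<in>Y. f A B A' B') = Z"
proof -
  have "(\<Union>(A, B)\<in>X. \<Union>(A', B')\<in>Y. f A B A' B') = (\<Union>_\<in>X. \<Union>_\<in>Y. Z)"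
    using assms(1) by (intro SUP_cong refl) (auto split: prod.splits)
  then show ?thesis using assms(2,3) by simp
qed

section \<open>The field of homogeneous fractions modulo the ideal\<close>

context surface_parameters
begin

abbreviation "FP \<equiv> fraction_pairs p a b"
abbreviation "SI \<equiv> surface_ideal p a b"
abbreviation "rf \<equiv> ratfun p a b"
abbreviation "FF \<equiv> function_field p a b"

lemma notin_surface_ideal_mult: "F \<notin> SI \<Longrightarrow> G \<notin> SI \<Longrightarrow> F * G \<notin> SI"
  using surface_ideal_prime by blast

lemma one_notin_surface_ideal: "1 \<notin> SI"
proof
  assume "1 \<in> SI"
  then have "peval 1 (\<lambda>_. 0 :: real) = 0"
    by (rule peval_surface_ideal) (simp_all add: quadric1_def quadric2_def)
  then show False by simp
qed

lemma fraction_pairsI: "homogeneous d G \<Longrightarrow> homogeneous d H \<Longrightarrow> H \<notin> SI \<Longrightarrow> (G, H) \<in> FP"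
  unfolding fraction_pairs_def by blast

lemma fraction_pairs_mult: "(G, H) \<in> FP \<Longrightarrow> (G', H') \<in> FP \<Longrightarrow> (G * G', H * H') \<in> FP"
  using homogeneous_mult notin_surface_ideal_mult unfolding fraction_pairs_def by blast

lemma fraction_pairs_add: 
  assumes "(G, H) \<in> FP" "(G', H') \<in> FP" shows "(G * H' + G' * H, H * H') \<in> FP"
proof -
  obtain d e where d: "homogeneous d G" "homogeneous d H" "homogeneous e G'" "homogeneous e H'"
    using assms unfolding fraction_pairs_def by blast
  have "homogeneous (d + e) (G * H' + G' * H)"
    using homogeneous_mult[OF d(1,4)] homogeneous_mult[OF d(3,2)] by (simp add: homogeneous_add add.commute)
  moreover have "homogeneous (d + e) (H * H')" using homogeneous_mult[OF d(2,4)] .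
  moreover have "H * H' \<notin> SI" using assms notin_surface_ideal_mult unfolding fraction_pairs_def by blast
  ultimately show ?thesis by (rule fraction_pairsI)
qed

lemma fraction_pairs_uminus: "(G, H) \<in> FP \<Longrightarrow> (- G, H) \<in> FP"
  using homogeneous_uminus unfolding fraction_pairs_def by blast

lemma fraction_pairs_const: "(of_int k, 1) \<in> FP" "(0, 1) \<in> FP" "(1, 1) \<in> FP"
  using homogeneous_of_int homogeneous_one homogeneous_zero one_notin_surface_ideal
  by (auto intro!: fraction_pairsI)

lemma fraction_pairs_notin: "(G, H) \<in> FP \<Longrightarrow> H \<notin> SI"
  unfolding fraction_pairs_def by blast

lemma ratfun_self: "(G, H) \<in> FP \<Longrightarrow> (G, H) \<in> rf G H"
  by (simp add: ratfun_def surface_ideal_zero)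

text \<open>Transitivity of equality of fractions: H can be cancelled because the ideal is prime and
  H lies outside it.\<close>

lemma ratfun_eq_aux:
  assumes "(G, H) \<in> FP" "(G', H') \<in> FP" "G * H' - G' * H \<in> SI" "(A, B) \<in> FP"
    "G * B - A * H \<in> SI"
  shows "G' * B - A * H' \<in> SI"
proof -
  have "H * (G' * B - A * H') = H' * (G * B - A * H) - B * (G * H' - G' * H)"
    by (simp add: algebra_simps)
  also have "\<dots> \<in> SI"
    by (intro surface_ideal_diff[OF surface_ideal_mult[OF assms(5)] surface_ideal_mult[OF assms(3)]])
  finally show ?thesis using surface_ideal_prime fraction_pairs_notin assms(1) by blast
qed

lemma ratfun_eq_iff:
  assumes "(G, H) \<in> FP" "(G', H') \<in> FP"
  shows "rf G H = rf G' H' \<longleftrightarrow> G * H' - G' * H \<in> SI"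
proof
  assume "rf G H = rf G' H'"
  then have "(G', H') \<in> rf G H" using ratfun_self[OF assms(2)] by simp
  then show "G * H' - G' * H \<in> SI" by (simp add: ratfun_def)
next
  assume *: "G * H' - G' * H \<in> SI"
  then have "- (G * H' - G' * H) \<in> SI" by (rule surface_ideal_uminus)
  then have "G' * H - G * H' \<in> SI" by simp
  then show "rf G H = rf G' H'"
    using ratfun_eq_aux[OF assms *] ratfun_eq_aux[OF assms(2,1)] unfolding ratfun_def by blast
qed

lemma ratfunE: "(A, B) \<in> rf G H \<Longrightarrow> (A, B) \<in> FP \<and> G * B - A * H \<in> SI"
  by (simp add: ratfun_def)

lemma ratfun_mult:
  assumes "(G, H) \<in> FP" "(G', H') \<in> FP"
  shows "rf G H \<otimes>\<^bsub>FF\<^esub> rf G' H' = rf (G * G') (H * H')"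
proof -
  have "rf (A * A') (B * B') = rf (G * G') (H * H')" if "(A, B) \<in> rf G H" "(A', B') \<in> rf G' H'" for A B A' B'
  proof -
    note e = ratfunE[OF that(1)] ratfunE[OF that(2)]
    have "A * A' * (H * H') - G * G' * (B * B') =
       - ((G * B - A * H) * (G' * B') + (G' * B' - A' * H') * (A * H))" by (simp add: algebra_simps)
    also have "\<dots> \<in> SI"
      using e by (intro surface_ideal_uminus surface_ideal_add surface_ideal_mult2) auto
    finally show ?thesis using e assms by (subst ratfun_eq_iff) (auto intro: fraction_pairs_mult)
  qed
  note eq = this
  have ne: "rf G H \<noteq> {}" "rf G' H' \<noteq> {}" using ratfun_self assms by blast+
  show ?thesis unfolding function_field_def monoid.simps ring.simps
    by (rule UN_pairs_const[OF _ ne]) (rule eq; assumption)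
qed

lemma ratfun_add:
  assumes "(G, H) \<in> FP" "(G', H') \<in> FP"
  shows "rf G H \<oplus>\<^bsub>FF\<^esub> rf G' H' = rf (G * H' + G' * H) (H * H')"
proof -
  have "rf (A * B' + A' * B) (B * B') = rf (G * H' + G' * H) (H * H')"
    if "(A, B) \<in> rf G H" "(A', B') \<in> rf G' H'" for A B A' B'
  proof -
    note e = ratfunE[OF that(1)] ratfunE[OF that(2)]
    have "(A * B' + A' * B) * (H * H') - (G * H' + G' * H) * (B * B') =
       - ((G * B - A * H) * (H' * B') + (G' * B' - A' * H') * (B * H))" by (simp add: algebra_simps)
    also have "\<dots> \<in> SI"
      using e by (intro surface_ideal_uminus surface_ideal_add surface_ideal_mult2) auto
    finally show ?thesis using e assms by (subst ratfun_eq_iff) (auto intro: fraction_pairs_add)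
  qed
  note eq = this
  have ne: "rf G H \<noteq> {}" "rf G' H' \<noteq> {}" using ratfun_self assms by blast+
  show ?thesis unfolding function_field_def monoid.simps ring.simps
    by (rule UN_pairs_const[OF _ ne]) (rule eq; assumption)
qed

lemma function_field_carrier: "x \<in> carrier FF \<longleftrightarrow> (\<exists>G H. (G, H) \<in> FP \<and> x = rf G H)"
  by (auto simp: function_field_def)

lemma ratfun_carrier: "(G, H) \<in> FP \<Longrightarrow> rf G H \<in> carrier FF"
  by (auto simp: function_field_carrier)

lemma function_field_zero: "\<zero>\<^bsub>FF\<^esub> = rf 0 1" and function_field_one: "\<one>\<^bsub>FF\<^esub> = rf 1 1"
  by (simp_all add: function_field_def)

lemma ratfun_eqI:
  assumes "(G, H) \<in> FP" "(G', H') \<in> FP" "G * H' = G' * H"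
  shows "rf G H = rf G' H'"
  using assms surface_ideal_zero by (simp add: ratfun_eq_iff)

lemmas ratfun_simps = ratfun_mult ratfun_add function_field_zero function_field_one
  fraction_pairs_mult fraction_pairs_add fraction_pairs_const ratfun_carrier

lemma function_field_cring: "cring FF"
proof (rule cringI)
  show "abelian_group FF"
  proof (rule abelian_groupI)
    fix x assume "x \<in> carrier FF"
    then obtain G H where x: "(G, H) \<in> FP" "x = rf G H" by (auto simp: function_field_carrier)
    show "\<zero>\<^bsub>FF\<^esub> \<oplus>\<^bsub>FF\<^esub> x = x"
      using x by (simp add: ratfun_simps)
    have "rf (- G) H \<oplus>\<^bsub>FF\<^esub> x = \<zero>\<^bsub>FF\<^esub>"
      unfolding x(2) using x(1) fraction_pairs_uminus[OF x(1)]
      by (simp add: ratfun_add function_field_zero del: mult_minus_left)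
         (intro ratfun_eqI fraction_pairs_add fraction_pairs_const; simp)
    then show "\<exists>y\<in>carrier FF. y \<oplus>\<^bsub>FF\<^esub> x = \<zero>\<^bsub>FF\<^esub>"
      using fraction_pairs_uminus[OF x(1)] ratfun_carrier by blast
    fix y assume "y \<in> carrier FF"
    then obtain G' H' where y: "(G', H') \<in> FP" "y = rf G' H'" by (auto simp: function_field_carrier)
    show "x \<oplus>\<^bsub>FF\<^esub> y \<in> carrier FF" using x y by (simp add: ratfun_simps)
    show "x \<oplus>\<^bsub>FF\<^esub> y = y \<oplus>\<^bsub>FF\<^esub> x" using x y by (simp add: ratfun_simps mult.commute add.commute)
    fix z assume "z \<in> carrier FF"
    then obtain G2 H2 where z: "(G2, H2) \<in> FP" "z = rf G2 H2" by (auto simp: function_field_carrier)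
    show "x \<oplus>\<^bsub>FF\<^esub> y \<oplus>\<^bsub>FF\<^esub> z = x \<oplus>\<^bsub>FF\<^esub> (y \<oplus>\<^bsub>FF\<^esub> z)"
      using x y z by (simp add: ratfun_simps algebra_simps)
  qed (simp add: ratfun_simps)
  show "comm_monoid FF"
  proof (rule comm_monoidI)
    fix x assume "x \<in> carrier FF"
    then obtain G H where x: "(G, H) \<in> FP" "x = rf G H" by (auto simp: function_field_carrier)
    show "\<one>\<^bsub>FF\<^esub> \<otimes>\<^bsub>FF\<^esub> x = x" using x by (simp add: ratfun_simps)
    fix y assume "y \<in> carrier FF"
    then obtain G' H' where y: "(G', H') \<in> FP" "y = rf G' H'" by (auto simp: function_field_carrier)
    show "x \<otimes>\<^bsub>FF\<^esub> y \<in> carrier FF" using x y by (simp add: ratfun_simps)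
    show "x \<otimes>\<^bsub>FF\<^esub> y = y \<otimes>\<^bsub>FF\<^esub> x" using x y by (simp add: ratfun_simps mult.commute)
    fix z assume "z \<in> carrier FF"
    then obtain G2 H2 where z: "(G2, H2) \<in> FP" "z = rf G2 H2" by (auto simp: function_field_carrier)
    show "x \<otimes>\<^bsub>FF\<^esub> y \<otimes>\<^bsub>FF\<^esub> z = x \<otimes>\<^bsub>FF\<^esub> (y \<otimes>\<^bsub>FF\<^esub> z)"
      using x y z by (simp add: ratfun_simps mult.assoc)
  qed (simp add: ratfun_simps)
  fix x y z assume "x \<in> carrier FF" "y \<in> carrier FF" "z \<in> carrier FF"
  then obtain G H G' H' G2 H2 where x: "(G, H) \<in> FP" "x = rf G H" and y: "(G', H') \<in> FP" "y = rf G' H'"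
    and z: "(G2, H2) \<in> FP" "z = rf G2 H2" unfolding function_field_carrier by blast
  show "(x \<oplus>\<^bsub>FF\<^esub> y) \<otimes>\<^bsub>FF\<^esub> z = x \<otimes>\<^bsub>FF\<^esub> z \<oplus>\<^bsub>FF\<^esub> y \<otimes>\<^bsub>FF\<^esub> z"
    unfolding x(2) y(2) z(2) using x(1) y(1) z(1) by (simp add: ratfun_simps)
      (intro ratfun_eqI fraction_pairs_mult fraction_pairs_add; simp add: algebra_simps)
qed

lemma ratfun_eq_zero_iff: "(G, H) \<in> FP \<Longrightarrow> rf G H = \<zero>\<^bsub>FF\<^esub> \<longleftrightarrow> G \<in> SI"
  unfolding function_field_zero by (subst ratfun_eq_iff) (auto simp: fraction_pairs_const)

lemma function_field_field: "field FF"
proof -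
  interpret cring FF by (rule function_field_cring)
  have nt: "\<one>\<^bsub>FF\<^esub> \<noteq> \<zero>\<^bsub>FF\<^esub>"
    using one_notin_surface_ideal ratfun_eq_zero_iff[of 1 1] by (simp add: fraction_pairs_const function_field_one)
  show ?thesis
  proof (rule cring_fieldI2)
    show "\<zero>\<^bsub>FF\<^esub> \<noteq> \<one>\<^bsub>FF\<^esub>" using nt by simp
    fix x assume x: "x \<in> carrier FF" "x \<noteq> \<zero>\<^bsub>FF\<^esub>"
    then obtain G H where G: "(G, H) \<in> FP" "x = rf G H" by (auto simp: function_field_carrier)
    then have "G \<notin> SI" using x ratfun_eq_zero_iff by auto
    then have H: "(H, G) \<in> FP" using G(1) unfolding fraction_pairs_def by blast
    have "x \<otimes>\<^bsub>FF\<^esub> rf H G = \<one>\<^bsub>FF\<^esub>"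
      unfolding G(2) ratfun_mult[OF G(1) H] function_field_one
      by (rule ratfun_eqI[OF fraction_pairs_mult[OF G(1) H]]) (simp_all add: fraction_pairs_const mult.commute)
    then show "\<exists>y\<in>carrier FF. x \<otimes>\<^bsub>FF\<^esub> y = \<one>\<^bsub>FF\<^esub>" using ratfun_carrier[OF H] by blast
  qed
qed

lemma ratfun_uminus:
  assumes "(G, H) \<in> FP" shows "\<ominus>\<^bsub>FF\<^esub> rf G H = rf (- G) H"
proof -
  interpret field FF by (rule function_field_field)
  have "rf (- G) H \<oplus>\<^bsub>FF\<^esub> rf G H = \<zero>\<^bsub>FF\<^esub>"
    unfolding ratfun_add[OF fraction_pairs_uminus[OF assms] assms] function_field_zero
    by (intro ratfun_eqI fraction_pairs_add fraction_pairs_const fraction_pairs_uminus assms) simp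
  then show ?thesis
    using assms fraction_pairs_uminus[OF assms] by (intro minus_equality) (auto intro: ratfun_carrier)
qed

text \<open>If (z - y)T1 and uT2 are norms N1 and N2, then T1/T2 equals (z - y)/u times N1 N2
  divided by the square of (z - y)T2, so the two functions differ by a norm.\<close>

lemma brauer_class_isomorphic:
  assumes T: "homogeneous 1 T1" "homogeneous 1 T2" "T1 \<notin> SI" "T2 \<notin> SI"
    and FG: "homogeneous 1 F1" "homogeneous 1 G1" "homogeneous 1 F2" "homogeneous 1 G2"
    and zy: "pvar Cz - pvar Cy \<notin> SI" and u: "pvar Cu \<notin> SI"
    and n1: "(pvar Cz - pvar Cy) * T1 - (F1 * F1 - of_int p * (G1 * G1)) \<in> SI"
    and n2: "pvar Cu * T2 - (F2 * F2 - of_int p * (G2 * G2)) \<in> SI"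
  shows "algebra_isomorphic FF (quaternion_algebra FF (rf (of_int p) 1) (rf T1 T2)) (brauer_class p a b)"
proof -
  interpret field FF by (rule function_field_field)
  define z where "z = pvar Cz - pvar Cy"
  \<comment> \<open>E is the denominator of the norm element, and P + Qi is the product of F1 + G1 i
    and F2 + G2 i with i^2 = p, so that P^2 - pQ^2 is the product of the two norms.\<close>
  define E where "E = z * T2"
  define P where "P = F1 * F2 + of_int p * (G1 * G2)"
  define Q where "Q = F1 * G2 + G1 * F2"
  have hz: "homogeneous 1 z" unfolding z_def by (intro homogeneous_diff homogeneous_pvar)
  have E: "homogeneous (1 + 1) E" "E \<notin> SI"
    unfolding E_def by (rule homogeneous_mult[OF hz T(2)])
      (rule notin_surface_ideal_mult[OF zy[folded z_def] T(4)])
  have PQ: "homogeneous (1 + 1) P" "homogeneous (1 + 1) Q"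
    unfolding P_def Q_def by (intro homogeneous_add homogeneous_scale homogeneous_mult FG)+
  have fp: "(P, E) \<in> FP" "(Q, E) \<in> FP" "(T1, T2) \<in> FP" "(z, pvar Cu) \<in> FP" "(of_int p, 1) \<in> FP"
    using fraction_pairsI[OF PQ(1) E] fraction_pairsI[OF PQ(2) E] fraction_pairsI[OF T(1,2,4)]
      fraction_pairsI[OF hz homogeneous_pvar u] fraction_pairs_const by auto
  let ?f = "rf P E" and ?g = "rf Q E" and ?\<alpha> = "rf (of_int p) 1"
  have g2: "(of_int p * (Q * Q), 1 * (E * E)) \<in> FP"
    using fp by (intro fraction_pairs_mult)
  have N: "?f \<otimes>\<^bsub>FF\<^esub> ?f \<ominus>\<^bsub>FF\<^esub> ?\<alpha> \<otimes>\<^bsub>FF\<^esub> (?g \<otimes>\<^bsub>FF\<^esub> ?g)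
      = rf (P * P * (1 * (E * E)) + - (of_int p * (Q * Q)) * (E * E)) (E * E * (1 * (E * E)))"
    unfolding a_minus_def ratfun_mult[OF fp(1,1)] ratfun_mult[OF fp(2,2)]
      ratfun_mult[OF fp(5) fraction_pairs_mult[OF fp(2,2)]] ratfun_uminus[OF g2]
    by (rule ratfun_add[OF fraction_pairs_mult[OF fp(1,1)] fraction_pairs_uminus[OF g2]])
  have Nfp: "(P * P * (1 * (E * E)) + - (of_int p * (Q * Q)) * (E * E), E * E * (1 * (E * E))) \<in> FP"
    by (rule fraction_pairs_add[OF fraction_pairs_mult[OF fp(1,1)] fraction_pairs_uminus[OF g2]])
  have eq: "rf T1 T2 = rf z (pvar Cu) \<otimes>\<^bsub>FF\<^esub> (?f \<otimes>\<^bsub>FF\<^esub> ?f \<ominus>\<^bsub>FF\<^esub> ?\<alpha> \<otimes>\<^bsub>FF\<^esub> (?g \<otimes>\<^bsub>FF\<^esub> ?g))"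
    unfolding N ratfun_mult[OF fp(4) Nfp]
  proof (subst ratfun_eq_iff[OF fp(3) fraction_pairs_mult[OF fp(4) Nfp]])
    let ?N1 = "F1 * F1 - of_int p * (G1 * G1)" and ?N2 = "F2 * F2 - of_int p * (G2 * G2)"
    have PQN: "P * P - of_int p * (Q * Q) = ?N1 * ?N2"
      unfolding P_def Q_def by (simp add: algebra_simps)
    have "T1 * (pvar Cu * (E * E * (1 * (E * E)))) - z * (P * P * (1 * (E * E)) + - (of_int p * (Q * Q)) * (E * E)) * T2
      = T1 * pvar Cu * (E * E) * (E * E) - z * T2 * (E * E) * (P * P - of_int p * (Q * Q))"
      by (simp add: algebra_simps)
    also have "\<dots> = z * T2 * (E * E) * ((z * T1 - ?N1) * (pvar Cu * T2) + ?N1 * (pvar Cu * T2 - ?N2))"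
      unfolding PQN by (simp add: E_def algebra_simps)
    also have "\<dots> \<in> SI"
      using n1 n2 unfolding z_def[symmetric]
      by (intro surface_ideal_mult surface_ideal_add[OF surface_ideal_mult2])
    finally show "T1 * (pvar Cu * (E * E * (1 * (E * E)))) - z * (P * P * (1 * (E * E)) + - (of_int p * (Q * Q)) * (E * E)) * T2 \<in> SI" .
  qed
  have "rf T1 T2 \<noteq> \<zero>\<^bsub>FF\<^esub>" using ratfun_eq_zero_iff[OF fp(3)] T(3) by simp
  then have "?f \<otimes>\<^bsub>FF\<^esub> ?f \<ominus>\<^bsub>FF\<^esub> ?\<alpha> \<otimes>\<^bsub>FF\<^esub> (?g \<otimes>\<^bsub>FF\<^esub> ?g) \<noteq> \<zero>\<^bsub>FF\<^esub>"
    using eq ratfun_carrier[OF fp(4)] by auto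
  then show ?thesis
    unfolding brauer_class_def z_def[symmetric]
    using eq fp by (intro quaternion_algebra_norm_twist) (auto intro: ratfun_carrier)
qed

section \<open>The linear forms that can replace z - y and u\<close>

abbreviation "px \<equiv> pvar Cx"
abbreviation "py \<equiv> pvar Cy"
abbreviation "pz \<equiv> pvar Cz"
abbreviation "pu \<equiv> pvar Cu"
abbreviation "pv \<equiv> pvar Cv"

text \<open>Linear forms which, like \<open>z - y\<close> resp.\ \<open>u\<close>, cut out conjugate pairs of planes on a rank 4 quadric
  of the pencil: tangent hyperplanes of \<open>z\<^sup>2 - y\<^sup>2 = au\<^sup>2 + (a + b - 1)uv + bv\<^sup>2\<close>
  resp.\ \<open>y\<^sup>2 - px\<^sup>2 = uv\<close>. Replacing \<open>z - y\<close> or \<open>u\<close> by such a form changes \<open>(z - y)/u\<close>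
  by a norm.\<close>

definition numerator_forms :: "rpoly set" where
  "numerator_forms = {pz - py, of_int (4 * a) * (pz + py),
     of_int (4 * a) * (of_int a * (pz - py) + (pz + py) - of_int (2 * a) * pu - of_int (a + b - 1) * pv)}"

definition denominator_forms :: "rpoly set" where
  "denominator_forms = {pu, pv, pu + pv - 2 * py}"

lemma of_int_p: "of_int p = ((of_int a + of_int b - 1)\<^sup>2 - 4 * of_int a * of_int b :: rpoly)"
  unfolding disc[symmetric] by simp

text \<open>One complex point of the cone at which F does not vanish witnesses
  non-membership.\<close>

lemma notin_surface_ideal_if_point:
  fixes x y z u v :: complex
  assumes "y\<^sup>2 - of_int p * x\<^sup>2 = u * v" "z\<^sup>2 - of_int p * x\<^sup>2 = (u + v) * (of_int a * u + of_int b * v)"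
    "peval F (cone_point x y z u v) \<noteq> 0"
  shows "F \<notin> SI"
  using peval_surface_ideal[of F p a b "cone_point x y z u v"] assms by (auto simp: quadric1_def quadric2_def)

text \<open>For 4a(z + y) the norm is the completed square of 4a(z^2 - y^2). Replacing u by u - (z -
  y) in it changes the norm by 4a(z - y) times a linear form, which together with z + y is the third
  form.\<close>

lemma numerator_form_cases:
  assumes "T \<in> numerator_forms"
  shows "homogeneous 1 T" "T \<notin> SI"
    "\<exists>F G. homogeneous 1 F \<and> homogeneous 1 G \<and> (pz - py) * T - (F * F - of_int p * (G * G)) \<in> SI"
proof -
  define c where "c = a + b - 1"
  define M where "M = of_int a * (pz - py) + (pz + py) - of_int (2 * a) * pu - of_int c * pv"
  have T: "T = pz - py \<or> T = of_int (4 * a) * (pz + py) \<or> T = of_int (4 * a) * M"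
    using assms by (simp add: numerator_forms_def M_def c_def)
  have hM: "homogeneous 1 M"
    unfolding M_def by (intro homogeneous_add homogeneous_diff homogeneous_scale homogeneous_pvar)
  show "homogeneous 1 T"
    using T
    by (elim disjE) (simp only:, intro homogeneous_add homogeneous_diff homogeneous_scale homogeneous_pvar hM)+
  define s where "s = complex_of_real (sqrt p)"
  have s2: "s\<^sup>2 = of_int p" using p_pos unfolding s_def by (simp flip: of_real_power)
  have s0: "s \<noteq> 0" using p_pos unfolding s_def by simp
  have a0: "a \<noteq> 0" using odd_a by auto
  \<comment> \<open>The witnesses have u = v = 0 and x = 1, with y and z square roots of p: opposite
    ones for z - y, equal ones for the other two forms.\<close>
  have 1: "pz - py \<notin> SI"
    by (rule notin_surface_ideal_if_point[of s 1 0 0 "- s"]) (use s0 in \<open>simp_all add: s2\<close>)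
  have 2: "of_int (4 * a) * (pz + py) \<notin> SI" "of_int (4 * a) * M \<notin> SI"
    by (rule notin_surface_ideal_if_point[of s 1 0 0 s]; use s0 a0 in \<open>simp add: s2 M_def\<close>)+
  show "T \<notin> SI" using T 1 2 by auto
  have q: "quadric2 p a b - quadric1 p \<in> SI"
    by (intro surface_ideal_diff quadrics_in_surface_ideal)
  have p: "(of_int p :: rpoly) = of_int c * of_int c - 4 * of_int a * of_int b"
    unfolding of_int_p c_def by (simp add: power2_eq_square)
  have pc: "(of_int c :: rpoly) = of_int a + of_int b - 1" by (simp add: c_def)
  show "\<exists>F G. homogeneous 1 F \<and> homogeneous 1 G \<and> (pz - py) * T - (F * F - of_int p * (G * G)) \<in> SI"
    using T
  proof (elim disjE)
    assume T: "T = pz - py"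
    show ?thesis
      by (rule exI[of _ "pz - py"], rule exI[of _ 0])
         (intro conjI homogeneous_diff homogeneous_pvar homogeneous_zero; simp add: T surface_ideal_zero)
  next
    assume T: "T = of_int (4 * a) * (pz + py)"
    let ?F = "of_int (2 * a) * pu + of_int c * pv"
    have "(pz - py) * T - (?F * ?F - of_int p * (pv * pv)) = of_int (4 * a) * (quadric2 p a b - quadric1 p)"
      unfolding T quadric1_def quadric2_def p
      by (simp add: algebra_simps power2_eq_square) (simp add: pc algebra_simps)
    also have "\<dots> \<in> SI" using q by (rule surface_ideal_mult)
    finally show ?thesis
      by (intro exI[of _ ?F] exI[of _ pv] conjI homogeneous_add homogeneous_scale homogeneous_pvar)
  next
    assume T: "T = of_int (4 * a) * M"
    let ?F = "of_int (2 * a) * (pu - (pz - py)) + of_int c * pv"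
    have "(pz - py) * T - (?F * ?F - of_int p * (pv * pv)) = of_int (4 * a) * (quadric2 p a b - quadric1 p)"
      unfolding T M_def quadric1_def quadric2_def p
      by (simp add: algebra_simps power2_eq_square) (simp add: pc algebra_simps)
    also have "\<dots> \<in> SI" using q by (rule surface_ideal_mult)
    finally show ?thesis
      by (intro exI[of _ ?F] exI[of _ pv] conjI homogeneous_add homogeneous_diff homogeneous_scale homogeneous_pvar)
  qed
qed

text \<open>On the cone uv = y^2 - px^2, and therefore u(u + v - 2y) = (u - y)^2 - px^2.\<close>

lemma denominator_form_cases:
  assumes "T \<in> denominator_forms"
  shows "homogeneous 1 T" "T \<notin> SI"
    "\<exists>F G. homogeneous 1 F \<and> homogeneous 1 G \<and> pu * T - (F * F - of_int p * (G * G)) \<in> SI"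
proof -
  have T: "T = pu \<or> T = pv \<or> T = pu + pv - 2 * py" using assms by (simp add: denominator_forms_def)
  show "homogeneous 1 T"
    using T by (elim disjE) (simp only:, intro homogeneous_add homogeneous_diff homogeneous_scale2 homogeneous_pvar)+
  define s where "s = complex_of_real (sqrt p)"
  have s2: "s\<^sup>2 = of_int p" using p_pos unfolding s_def by (simp flip: of_real_power)
  have s0: "s \<noteq> 0" using p_pos unfolding s_def by simp
  have 1: "pu \<notin> SI"
    by (rule notin_surface_ideal_if_point[of 0 0 1 0 "csqrt (of_int a)"]) simp_all
  have 2: "pv \<notin> SI"
    by (rule notin_surface_ideal_if_point[of 0 0 0 1 "csqrt (of_int b)"]) simp_all
  have 3: "pu + pv - 2 * py \<notin> SI"
    by (rule notin_surface_ideal_if_point[of s 1 0 0 s]) (use s0 in \<open>simp_all add: s2\<close>)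
  show "T \<notin> SI" using T 1 2 3 by auto
  show "\<exists>F G. homogeneous 1 F \<and> homogeneous 1 G \<and> pu * T - (F * F - of_int p * (G * G)) \<in> SI"
    using T
  proof (elim disjE)
    assume T: "T = pu"
    show ?thesis
      by (rule exI[of _ pu], rule exI[of _ 0])
         (intro conjI homogeneous_pvar homogeneous_zero; simp add: T surface_ideal_zero)
  next
    assume T: "T = pv"
    have "pu * T - (py * py - of_int p * (px * px)) = - quadric1 p"
      unfolding T quadric1_def by (simp add: algebra_simps power2_eq_square)
    also have "\<dots> \<in> SI" by (intro surface_ideal_uminus quadrics_in_surface_ideal)
    finally show ?thesis by (intro exI[of _ py] exI[of _ px] conjI homogeneous_pvar)
  next
    assume T: "T = pu + pv - 2 * py"
    have "pu * T - ((pu - py) * (pu - py) - of_int p * (px * px)) = - quadric1 p"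
      unfolding T quadric1_def by (simp add: algebra_simps power2_eq_square)
    also have "\<dots> \<in> SI" by (intro surface_ideal_uminus quadrics_in_surface_ideal)
    finally show ?thesis by (intro exI[of _ "pu - py"] exI[of _ px] conjI homogeneous_diff homogeneous_pvar)
  qed
qed

lemma form_fraction:
  "T1 \<in> numerator_forms \<Longrightarrow> T2 \<in> denominator_forms \<Longrightarrow> (T1, T2) \<in> FP"
  using numerator_form_cases denominator_form_cases fraction_pairsI by blast

lemma brauer_class_forms:
  assumes "T1 \<in> numerator_forms" "T2 \<in> denominator_forms"
  shows "algebra_isomorphic FF (quaternion_algebra FF (rf (of_int p) 1) (rf T1 T2)) (brauer_class p a b)"
proof -
  obtain F1 G1 where 1: "homogeneous 1 F1" "homogeneous 1 G1"
    "(pz - py) * T1 - (F1 * F1 - of_int p * (G1 * G1)) \<in> SI"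
    using numerator_form_cases(3)[OF assms(1)] by blast
  obtain F2 G2 where 2: "homogeneous 1 F2" "homogeneous 1 G2"
    "pu * T2 - (F2 * F2 - of_int p * (G2 * G2)) \<in> SI"
    using denominator_form_cases(3)[OF assms(2)] by blast
  have "pz - py \<notin> SI" by (rule numerator_form_cases(2)) (simp add: numerator_forms_def)
  moreover have "pu \<notin> SI" by (rule denominator_form_cases(2)) (simp add: denominator_forms_def)
  ultimately show ?thesis
    using brauer_class_isomorphic[OF numerator_form_cases(1)[OF assms(1)] denominator_form_cases(1)[OF assms(2)]
      numerator_form_cases(2)[OF assms(1)] denominator_form_cases(2)[OF assms(2)] 1(1,2) 2(1,2)] 1(3) 2(3) by blast
qed

end

section \<open>Completions of the rationals\<close>

text \<open>\<open>padic_val\<close> reads off the reduced fraction; cross-multiplication shows that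
  any fraction computes it.\<close>

lemma padic_val_divide:
  fixes m n :: int
  assumes "prime l" "m \<noteq> 0" "n \<noteq> 0"
  shows "padic_val l (of_int m / of_int n) = int (multiplicity (int l) m) - int (multiplicity (int l) n)"
proof -
  obtain c d where cd: "quotient_of (of_int m / of_int n) = (c, d)" by (cases "quotient_of (of_int m / of_int n :: rat)")
  have d: "d > 0" using quotient_of_denom_pos[OF cd] .
  have eq: "(of_int m / of_int n :: rat) = of_int c / of_int d" using quotient_of_div[OF cd] .
  then have "(of_int (m * d) :: rat) = of_int (c * n)" using d assms(3) by (simp add: field_simps)
  then have md: "m * d = c * n" by (simp only: of_int_eq_iff)
  then have c: "c \<noteq> 0" using d assms by auto
  have l: "prime_elem (int l)" using assms(1) by simp
  have "multiplicity (int l) m + multiplicity (int l) d = multiplicity (int l) c + multiplicity (int l) n"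
    using prime_elem_multiplicity_mult_distrib[OF l assms(2), of d] prime_elem_multiplicity_mult_distrib[OF l c assms(3)] d md
    by simp
  then show ?thesis unfolding padic_val_def cd by simp
qed

lemma rat_as_quotient:
  obtains m n :: int where "n > 0" "coprime m n" "(x::rat) = of_int m / of_int n"
  using quotient_of_div[of x] quotient_of_denom_pos[of x] quotient_of_coprime[of x]
  by (metis surj_pair)

lemma padic_val_mult:
  assumes "prime l" "x \<noteq> 0" "y \<noteq> 0"
  shows "padic_val l (x * y) = padic_val l x + padic_val l y"
proof -
  obtain m n where x: "n > 0" "x = of_int m / of_int n" using rat_as_quotient by metis
  obtain m' n' where y: "n' > 0" "y = of_int m' / of_int n'" using rat_as_quotient by metis
  have m: "m \<noteq> 0" "m' \<noteq> 0" using x y assms by auto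
  have l: "prime_elem (int l)" using assms(1) by simp
  have "x * y = of_int (m * m') / of_int (n * n')" by (simp add: x y)
  then have "padic_val l (x * y) = int (multiplicity (int l) (m * m')) - int (multiplicity (int l) (n * n'))"
    using padic_val_divide[OF assms(1), of "m * m'" "n * n'"] m x y by simp
  also have "\<dots> = padic_val l x + padic_val l y"
    using x y m by (simp add: padic_val_divide[OF assms(1)] prime_elem_multiplicity_mult_distrib[OF l])
  finally show ?thesis .
qed

lemma padic_val_add:
  assumes "prime l" "x \<noteq> 0" "y \<noteq> 0" "x + y \<noteq> 0"
  shows "padic_val l (x + y) \<ge> min (padic_val l x) (padic_val l y)"
proof -
  obtain m n where x: "n > 0" "x = of_int m / of_int n" using rat_as_quotient by metis
  obtain m' n' where y: "n' > 0" "y = of_int m' / of_int n'" using rat_as_quotient by metis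
  have m: "m \<noteq> 0" "m' \<noteq> 0" using x y assms by auto
  have l: "prime_elem (int l)" using assms(1) by simp
  let ?v = "multiplicity (int l)"
  have xy: "x + y = of_int (m * n' + m' * n) / of_int (n * n')" using x y by (simp add: field_simps)
  then have s: "m * n' + m' * n \<noteq> 0" using assms(4) by (metis div_0 of_int_0)
  have "min (?v (m * n')) (?v (m' * n)) \<le> ?v (m * n' + m' * n)"
  proof (rule multiplicity_geI)
    show "m * n' + m' * n \<noteq> 0" by (rule s)
    show "int l ^ min (?v (m * n')) (?v (m' * n)) dvd m * n' + m' * n"
      by (intro dvd_add multiplicity_dvd') auto
  qed (use l in \<open>auto simp: prime_elem_not_unit\<close>)
  moreover have "?v (m * n') = ?v m + ?v n'" "?v (m' * n) = ?v m' + ?v n" "?v (n * n') = ?v n + ?v n'"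
    using m x y by (auto intro!: prime_elem_multiplicity_mult_distrib[OF l])
  moreover have "padic_val l (x + y) = int (?v (m * n' + m' * n)) - int (?v (n * n'))"
    unfolding xy using x y s by (intro padic_val_divide[OF assms(1)]) auto
  moreover have "padic_val l x = int (?v m) - int (?v n)" "padic_val l y = int (?v m') - int (?v n')"
    using x y m by (auto intro!: padic_val_divide[OF assms(1)])
  ultimately show ?thesis by linarith
qed

section \<open>Absolute values, Cauchy sequences and null sequences\<close>

lemma cauchy_seqsD:
  assumes "s \<in> cauchy_seqs v" "e > 0"
  obtains N where "\<And>m n. m \<ge> N \<Longrightarrow> n \<ge> N \<Longrightarrow> place_abs v (s m - s n) < e"
  using assms unfolding cauchy_seqs_def by blast

lemma place_abs_nonneg: "place_abs v x \<ge> 0"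
  by (cases v) auto

lemma place_abs_zero [simp]: "place_abs v 0 = 0"
  by (cases v) auto

context
  fixes v assumes v: "v \<in> places"
begin

lemma place_abs_eq_0_iff: "place_abs v x = 0 \<longleftrightarrow> x = 0"
  using v by (cases v) (auto simp: places_def prime_gt_0_nat)

lemma place_abs_mult: "place_abs v (x * y) = place_abs v x * place_abs v y"
proof (cases v)
  case Infinite
  then show ?thesis by (simp add: abs_mult of_rat_mult)
next
  case (Finite l)
  then have l: "prime l" using v by (auto simp: places_def)
  then have "real l \<noteq> 0" by auto
  then show ?thesis using Finite padic_val_mult[OF l, of x y] by (simp add: power_int_add[symmetric])
qed

lemma place_abs_one: "place_abs v 1 = 1"
  using place_abs_mult[of 1 1] place_abs_eq_0_iff[of 1] by simp

lemma place_abs_uminus: "place_abs v (- x) = place_abs v x"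
proof -
  have "place_abs v (-1) * place_abs v (-1) = 1" using place_abs_mult[of "-1" "-1"] place_abs_one by simp
  then have "place_abs v (-1) = 1" using place_abs_nonneg[of v "-1"] by (simp add: square_eq_1_iff)
  then show ?thesis using place_abs_mult[of "-1" x] by simp
qed

lemma place_abs_diff_commute: "place_abs v (x - y) = place_abs v (y - x)"
  using place_abs_uminus[of "x - y"] by simp

lemma place_abs_inverse: "x \<noteq> 0 \<Longrightarrow> place_abs v (inverse x) = inverse (place_abs v x)"
  using place_abs_mult[of x "inverse x"] place_abs_one place_abs_eq_0_iff[of x] by (simp add: field_simps)

end

lemma place_abs_ultrametric:
  assumes "prime l"
  shows "place_abs (Finite l) (x + y) \<le> max (place_abs (Finite l) x) (place_abs (Finite l) y)"
proof (cases "x = 0 \<or> y = 0 \<or> x + y = 0")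
  case True
  then show ?thesis using place_abs_nonneg[of "Finite l"] by (auto simp: max_def)
next
  case False
  have l: "real l \<ge> 1" using prime_ge_1_nat[OF assms] by simp
  have "- padic_val l (x + y) \<le> max (- padic_val l x) (- padic_val l y)"
    using padic_val_add[OF assms, of x y] False by linarith
  then have "real l powi (- padic_val l (x + y)) \<le> real l powi max (- padic_val l x) (- padic_val l y)"
    by (rule power_int_increasing[OF _ l])
  then show ?thesis using False by (auto simp: max_def split: if_splits)
qed

lemma place_abs_triangle:
  assumes "v \<in> places"
  shows "place_abs v (x + y) \<le> place_abs v x + place_abs v y"
proof (cases v)
  case Infinite
  then show ?thesis using abs_triangle_ineq[of "real_of_rat x" "real_of_rat y"] by (simp add: of_rat_add)
next
  case (Finite l)
  then have "prime l" using assms by (auto simp: places_def)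
  from place_abs_ultrametric[OF this, of x y] show ?thesis
    using place_abs_nonneg[of v x] place_abs_nonneg[of v y] unfolding Finite by linarith
qed

context
  fixes v assumes v: "v \<in> places"
begin

lemma null_seqsI: "(\<lambda>n. place_abs v (s n)) \<longlonglongrightarrow> 0 \<Longrightarrow> s \<in> null_seqs v"
  by (simp add: null_seqs_def)

lemma cauchy_seqs_const: "(\<lambda>_. q) \<in> cauchy_seqs v"
  by (auto simp: cauchy_seqs_def)

lemma cauchy_seqs_bounded:
  assumes "s \<in> cauchy_seqs v"
  obtains B where "B > 0" "\<And>n. place_abs v (s n) \<le> B"
proof -
  obtain N where N: "\<And>m n. m \<ge> N \<Longrightarrow> n \<ge> N \<Longrightarrow> place_abs v (s m - s n) < 1"
    using cauchy_seqsD[OF assms zero_less_one] by blast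
  define B where "B = Max ((\<lambda>n. place_abs v (s n)) ` {..N}) + 1"
  have le: "place_abs v (s n) \<le> B - 1" if "n \<le> N" for n
    unfolding B_def using that by simp
  have "place_abs v (s n) \<le> B" for n
  proof (cases "n \<le> N")
    case True
    then show ?thesis using le by fastforce
  next
    case False
    then have "place_abs v (s n - s N) < 1" using N by simp
    moreover have "place_abs v (s n) \<le> place_abs v (s n - s N) + place_abs v (s N)"
      using place_abs_triangle[OF v, of "s n - s N" "s N"] by simp
    ultimately show ?thesis using le[of N] by simp
  qed
  moreover have "B > 0" using le[of 0] place_abs_nonneg[of v "s 0"] by simp
  ultimately show ?thesis using that by blast
qed

lemma cauchy_seqs_add:
  assumes "s \<in> cauchy_seqs v" "t \<in> cauchy_seqs v"
  shows "(\<lambda>n. s n + t n) \<in> cauchy_seqs v"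
  unfolding cauchy_seqs_def
proof (intro CollectI allI impI)
  fix e :: real assume "e > 0"
  then have e2: "e / 2 > 0" by simp
  obtain N where N: "\<And>m n. m \<ge> N \<Longrightarrow> n \<ge> N \<Longrightarrow> place_abs v (s m - s n) < e / 2"
    using cauchy_seqsD[OF assms(1) e2] by blast
  obtain M where M: "\<And>m n. m \<ge> M \<Longrightarrow> n \<ge> M \<Longrightarrow> place_abs v (t m - t n) < e / 2"
    using cauchy_seqsD[OF assms(2) e2] by blast
  have "place_abs v (s m + t m - (s n + t n)) < e" if "m \<ge> max N M" "n \<ge> max N M" for m n
    using N[of m n] M[of m n] that place_abs_triangle[OF v, of "s m - s n" "t m - t n"] by (simp add: algebra_simps)
  then show "\<exists>N. \<forall>m\<ge>N. \<forall>n\<ge>N. place_abs v (s m + t m - (s n + t n)) < e" by blast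
qed

lemma cauchy_seqs_mult:
  assumes "s \<in> cauchy_seqs v" "t \<in> cauchy_seqs v"
  shows "(\<lambda>n. s n * t n) \<in> cauchy_seqs v"
  unfolding cauchy_seqs_def
proof (intro CollectI allI impI)
  fix e :: real assume e: "e > 0"
  obtain B where B: "B > 0" "\<And>n. place_abs v (s n) \<le> B" using cauchy_seqs_bounded[OF assms(1)] by blast
  obtain C where C: "C > 0" "\<And>n. place_abs v (t n) \<le> C" using cauchy_seqs_bounded[OF assms(2)] by blast
  have e2: "e / (2 * C) > 0" "e / (2 * B) > 0" using e B C by simp_all
  obtain N where N: "\<And>m n. m \<ge> N \<Longrightarrow> n \<ge> N \<Longrightarrow> place_abs v (s m - s n) < e / (2 * C)"
    using cauchy_seqsD[OF assms(1) e2(1)] by blast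
  obtain M where M: "\<And>m n. m \<ge> M \<Longrightarrow> n \<ge> M \<Longrightarrow> place_abs v (t m - t n) < e / (2 * B)"
    using cauchy_seqsD[OF assms(2) e2(2)] by blast
  have "place_abs v (s m * t m - s n * t n) < e" if mn: "m \<ge> max N M" "n \<ge> max N M" for m n
  proof -
    have "s m * t m - s n * t n = (s m - s n) * t m + s n * (t m - t n)" by (simp add: algebra_simps)
    then have "place_abs v (s m * t m - s n * t n)
        \<le> place_abs v (s m - s n) * place_abs v (t m) + place_abs v (s n) * place_abs v (t m - t n)"
      using place_abs_triangle[OF v, of "(s m - s n) * t m" "s n * (t m - t n)"]
      by (simp add: place_abs_mult[OF v])
    also have "place_abs v (s m - s n) * place_abs v (t m) \<le> place_abs v (s m - s n) * C"
      using C place_abs_nonneg by (intro mult_left_mono)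
    also have "\<dots> < e / (2 * C) * C" using N[of m n] mn C by (intro mult_strict_right_mono) auto
    also have "e / (2 * C) * C = e / 2" using C by simp
    also have "place_abs v (s n) * place_abs v (t m - t n) \<le> B * place_abs v (t m - t n)"
      using B place_abs_nonneg by (intro mult_right_mono)
    also have "\<dots> \<le> B * (e / (2 * B))" using M[of m n] mn B by (intro mult_left_mono) auto
    also have "B * (e / (2 * B)) = e / 2" using B by simp
    finally show ?thesis by simp
  qed
  then show "\<exists>N. \<forall>m\<ge>N. \<forall>n\<ge>N. place_abs v (s m * t m - s n * t n) < e" by blast
qed

lemma cauchy_seqs_uminus: "s \<in> cauchy_seqs v \<Longrightarrow> (\<lambda>n. - s n) \<in> cauchy_seqs v"
  using cauchy_seqs_mult[OF cauchy_seqs_const[of "-1"], of s] by simp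

lemma cauchy_seqs_diff:
  "s \<in> cauchy_seqs v \<Longrightarrow> t \<in> cauchy_seqs v \<Longrightarrow> (\<lambda>n. s n - t n) \<in> cauchy_seqs v"
  using cauchy_seqs_add[OF _ cauchy_seqs_uminus] by simp

lemma cauchy_seqs_power: "s \<in> cauchy_seqs v \<Longrightarrow> (\<lambda>n. s n ^ k) \<in> cauchy_seqs v"
  by (induction k) (auto intro: cauchy_seqs_const cauchy_seqs_mult)

lemma cauchy_seqs_sum:
  "(\<And>x. x \<in> S \<Longrightarrow> f x \<in> cauchy_seqs v) \<Longrightarrow> (\<lambda>n. \<Sum>x\<in>S. f x n) \<in> cauchy_seqs v"
  by (induction S rule: infinite_finite_induct) (auto intro: cauchy_seqs_const cauchy_seqs_add)

lemma cauchy_seqs_prod: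
  "(\<And>x. x \<in> S \<Longrightarrow> f x \<in> cauchy_seqs v) \<Longrightarrow> (\<lambda>n. \<Prod>x\<in>S. f x n) \<in> cauchy_seqs v"
  by (induction S rule: infinite_finite_induct) (auto intro: cauchy_seqs_const cauchy_seqs_mult)

lemma null_seqs_cauchy:
  assumes "s \<in> null_seqs v" shows "s \<in> cauchy_seqs v"
  unfolding cauchy_seqs_def
proof (intro CollectI allI impI)
  fix e :: real assume "e > 0"
  then have "\<forall>\<^sub>F n in sequentially. place_abs v (s n) < e / 2"
    using assms order_tendstoD(2)[of "\<lambda>n. place_abs v (s n)" 0 sequentially "e / 2"]
    by (simp add: null_seqs_def)
  then obtain N where N: "\<And>n. n \<ge> N \<Longrightarrow> place_abs v (s n) < e / 2"
    by (auto simp: eventually_sequentially)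
  have "place_abs v (s m - s n) < e" if "m \<ge> N" "n \<ge> N" for m n
    using N[of m] N[of n] that place_abs_triangle[OF v, of "s m" "- s n"] place_abs_uminus[OF v, of "s n"] by simp
  then show "\<exists>N. \<forall>m\<ge>N. \<forall>n\<ge>N. place_abs v (s m - s n) < e" by blast
qed

lemma null_seqs_add:
  assumes "s \<in> null_seqs v" "t \<in> null_seqs v"
  shows "(\<lambda>n. s n + t n) \<in> null_seqs v"
proof -
  have lim: "(\<lambda>n. place_abs v (s n) + place_abs v (t n)) \<longlonglongrightarrow> 0"
    using assms tendsto_add[of "\<lambda>n. place_abs v (s n)" 0 sequentially] unfolding null_seqs_def by fastforce
  show ?thesis
    by (rule null_seqsI, rule tendsto_sandwich[OF _ _ tendsto_const lim])
       (simp_all add: place_abs_nonneg place_abs_triangle[OF v])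
qed

lemma null_seqs_mult:
  assumes "s \<in> null_seqs v" "t \<in> cauchy_seqs v"
  shows "(\<lambda>n. t n * s n) \<in> null_seqs v"
proof -
  obtain B where B: "B > 0" "\<And>n. place_abs v (t n) \<le> B" using cauchy_seqs_bounded[OF assms(2)] by blast
  have lim: "(\<lambda>n. B * place_abs v (s n)) \<longlonglongrightarrow> 0"
    using assms(1) unfolding null_seqs_def by (simp add: tendsto_mult_right_zero)
  have "place_abs v (t n * s n) \<le> B * place_abs v (s n)" for n
    unfolding place_abs_mult[OF v] using B place_abs_nonneg by (intro mult_right_mono)
  then show ?thesis
    by (intro null_seqsI tendsto_sandwich[OF _ _ tendsto_const lim]) (simp_all add: place_abs_nonneg)
qed

lemma null_seqs_zero: "(\<lambda>_. 0) \<in> null_seqs v"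
  by (simp add: null_seqs_def)

lemma null_seqs_uminus: "s \<in> null_seqs v \<Longrightarrow> (\<lambda>n. - s n) \<in> null_seqs v"
  using null_seqs_mult[OF _ cauchy_seqs_const[of "-1"], of s] by simp

lemma null_seqs_diff:
  "s \<in> null_seqs v \<Longrightarrow> t \<in> null_seqs v \<Longrightarrow> (\<lambda>n. s n - t n) \<in> null_seqs v"
  using null_seqs_add[OF _ null_seqs_uminus] by simp

lemma null_seqs_eventually_eq:
  assumes "\<forall>\<^sub>F n in sequentially. s n = t n" "t \<in> null_seqs v"
  shows "s \<in> null_seqs v"
proof -
  have "\<forall>\<^sub>F n in sequentially. place_abs v (t n) = place_abs v (s n)"
    using assms(1) by eventually_elim simp
  then show ?thesis
    using assms(2) unfolding null_seqs_def by (auto intro: Lim_transform_eventually)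
qed

lemma null_seqs_if_eventually_zero: "\<forall>\<^sub>F n in sequentially. s n = 0 \<Longrightarrow> s \<in> null_seqs v"
  by (rule null_seqs_eventually_eq[OF _ null_seqs_zero])

lemma cauchy_not_null_bounded_below:
  assumes "s \<in> cauchy_seqs v" "s \<notin> null_seqs v"
  obtains e N where "e > 0" "\<And>n. n \<ge> N \<Longrightarrow> place_abs v (s n) \<ge> e"
proof -
  have "\<exists>d>0. \<forall>N. \<exists>n\<ge>N. place_abs v (s n) \<ge> d"
  proof (rule ccontr)
    assume "\<not> ?thesis"
    then have *: "\<exists>N. \<forall>n\<ge>N. place_abs v (s n) < d" if "d > 0" for d using that by (meson not_le)
    have "(\<lambda>n. place_abs v (s n)) \<longlonglongrightarrow> 0"
      unfolding LIMSEQ_def using * by (simp add: place_abs_nonneg)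
    then show False using assms(2) by (simp add: null_seqs_def)
  qed
  then obtain d where d: "d > 0" "\<And>N. \<exists>n\<ge>N. place_abs v (s n) \<ge> d" by blast
  obtain N where N: "\<And>m n. m \<ge> N \<Longrightarrow> n \<ge> N \<Longrightarrow> place_abs v (s m - s n) < d / 2"
    using cauchy_seqsD[OF assms(1), of "d / 2"] d(1) by (metis half_gt_zero)
  obtain k where k: "k \<ge> N" "place_abs v (s k) \<ge> d" using d(2) by blast
  have "place_abs v (s n) \<ge> d / 2" if "n \<ge> N" for n
    using place_abs_triangle[OF v, of "s k - s n" "s n"] N[OF k(1) that] k(2) by simp
  then show ?thesis using that[of "d / 2" N] d(1) by simp
qed

text \<open>Both factors would otherwise be bounded away from 0 eventually. Applied to a square, it
  shows that the base is null.\<close>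

lemma null_seqs_mult_cases:
  assumes "s \<in> cauchy_seqs v" "t \<in> cauchy_seqs v" "(\<lambda>n. s n * t n) \<in> null_seqs v"
  shows "s \<in> null_seqs v \<or> t \<in> null_seqs v"
proof (rule ccontr)
  assume "\<not> ?thesis"
  then obtain d N e M where d: "d > 0" "\<And>n. n \<ge> N \<Longrightarrow> place_abs v (s n) \<ge> d"
    and e: "e > 0" "\<And>n. n \<ge> M \<Longrightarrow> place_abs v (t n) \<ge> e"
    using cauchy_not_null_bounded_below assms(1,2) by metis
  have "\<forall>\<^sub>F n in sequentially. place_abs v (s n * t n) < d * e"
    using assms(3) d(1) e(1) unfolding null_seqs_def by (auto intro: order_tendstoD)
  then obtain K where K: "\<And>n. n \<ge> K \<Longrightarrow> place_abs v (s n * t n) < d * e"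
    by (auto simp: eventually_sequentially)
  let ?n = "max K (max N M)"
  have "d * e \<le> place_abs v (s ?n) * place_abs v (t ?n)" using d e place_abs_nonneg by (intro mult_mono) auto
  then show False using K[of ?n] by (simp add: place_abs_mult[OF v])
qed

text \<open>A Cauchy sequence that is not null stays away from 0 eventually, so the default
  \<open>inverse 0 = 0\<close> affects finitely many terms only.\<close>

lemma cauchy_seqs_inverse:
  assumes "s \<in> cauchy_seqs v" "s \<notin> null_seqs v"
  shows "(\<lambda>n. inverse (s n)) \<in> cauchy_seqs v" "\<forall>\<^sub>F n in sequentially. s n \<noteq> 0"
proof -
  obtain d N where d: "d > 0" "\<And>n. n \<ge> N \<Longrightarrow> place_abs v (s n) \<ge> d"
    using cauchy_not_null_bounded_below assms by metis
  have nz: "s n \<noteq> 0" if "n \<ge> N" for n using d(1) d(2)[OF that] by auto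
  then show "\<forall>\<^sub>F n in sequentially. s n \<noteq> 0" by (auto simp: eventually_sequentially)
  show "(\<lambda>n. inverse (s n)) \<in> cauchy_seqs v"
    unfolding cauchy_seqs_def
  proof (intro CollectI allI impI)
    fix e :: real assume "e > 0"
    then have "e * (d * d) > 0" using d(1) by simp
    then obtain M where M: "\<And>m n. m \<ge> M \<Longrightarrow> n \<ge> M \<Longrightarrow> place_abs v (s m - s n) < e * (d * d)"
      using cauchy_seqsD[OF assms(1)] by blast
    have "place_abs v (inverse (s m) - inverse (s n)) < e" if mn: "m \<ge> max N M" "n \<ge> max N M" for m n
    proof -
      have z: "s m \<noteq> 0" "s n \<noteq> 0" using nz mn by auto
      have "inverse (s m) - inverse (s n) = (s n - s m) * inverse (s m * s n)"
        using z by (simp add: field_simps)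
      then have "place_abs v (inverse (s m) - inverse (s n)) = place_abs v (s n - s m) / (place_abs v (s m) * place_abs v (s n))"
        using z by (simp add: place_abs_mult[OF v] place_abs_inverse[OF v] divide_inverse)
      also
      have pos: "place_abs v (s m) > 0" "place_abs v (s n) > 0"
        using place_abs_nonneg[of v "s m"] place_abs_nonneg[of v "s n"] z place_abs_eq_0_iff[OF v]
        by (simp_all add: order.strict_iff_order)
      have "d * d \<le> place_abs v (s m) * place_abs v (s n)" using d mn place_abs_nonneg by (intro mult_mono) auto
      then have "place_abs v (s n - s m) / (place_abs v (s m) * place_abs v (s n)) \<le> place_abs v (s n - s m) / (d * d)"
        using d(1) pos place_abs_nonneg by (intro divide_left_mono mult_pos_pos) auto
      also have "\<dots> < e" using M[of n m] mn d(1) by (simp add: divide_less_eq)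
      finally show ?thesis .
    qed
    then show "\<exists>N. \<forall>m\<ge>N. \<forall>n\<ge>N. place_abs v (inverse (s m) - inverse (s n)) < e" by blast
  qed
qed

lemma cauchy_ring_cring: "cring (cauchy_ring v)"
proof (rule cringI)
  show "abelian_group (cauchy_ring v)"
  proof (rule abelian_groupI)
    fix s assume "s \<in> carrier (cauchy_ring v)"
    then show "\<exists>t\<in>carrier (cauchy_ring v). t \<oplus>\<^bsub>cauchy_ring v\<^esub> s = \<zero>\<^bsub>cauchy_ring v\<^esub>"
      by (intro bexI[of _ "\<lambda>n. - s n"]) (auto simp: cauchy_ring_def cauchy_seqs_uminus)
  qed (auto simp: cauchy_ring_def cauchy_seqs_add cauchy_seqs_const add.assoc add.commute)
  show "comm_monoid (cauchy_ring v)"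
    by (rule comm_monoidI) (auto simp: cauchy_ring_def cauchy_seqs_mult cauchy_seqs_const mult.assoc mult.commute)
qed (auto simp: cauchy_ring_def algebra_simps)

lemma null_seqs_ideal: "ideal (null_seqs v) (cauchy_ring v)"
proof -
  interpret C: cring "cauchy_ring v" by (rule cauchy_ring_cring)
  have m: "\<ominus>\<^bsub>cauchy_ring v\<^esub> s = (\<lambda>n. - s n)" if "s \<in> cauchy_seqs v" for s
    using that by (intro C.minus_equality) (auto simp: cauchy_ring_def cauchy_seqs_uminus)
  show ?thesis
  proof (rule idealI)
    show "ring (cauchy_ring v)" by (rule C.ring_axioms)
    show "subgroup (null_seqs v) (add_monoid (cauchy_ring v))"
    proof (rule C.add.subgroupI)
      show "null_seqs v \<subseteq> carrier (cauchy_ring v)" using null_seqs_cauchy by (auto simp: cauchy_ring_def)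
      show "null_seqs v \<noteq> {}" using null_seqs_zero by blast
      show "\<ominus>\<^bsub>cauchy_ring v\<^esub> s \<in> null_seqs v" if "s \<in> null_seqs v" for s
        using that m[OF null_seqs_cauchy[OF that]] null_seqs_uminus by simp
      show "s \<oplus>\<^bsub>cauchy_ring v\<^esub> t \<in> null_seqs v" if "s \<in> null_seqs v" "t \<in> null_seqs v" for s t
        using that null_seqs_add by (simp add: cauchy_ring_def)
    qed
    fix s t assume s: "s \<in> null_seqs v" and t: "t \<in> carrier (cauchy_ring v)"
    then show "t \<otimes>\<^bsub>cauchy_ring v\<^esub> s \<in> null_seqs v" "s \<otimes>\<^bsub>cauchy_ring v\<^esub> t \<in> null_seqs v"
      using null_seqs_mult[OF s, of t] by (auto simp: cauchy_ring_def mult.commute)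
  qed
qed

end

text \<open>The handle through which computations in the quotient ring become computations with
  sequences.\<close>

definition cls :: "place \<Rightarrow> (nat \<Rightarrow> rat) \<Rightarrow> (nat \<Rightarrow> rat) set" where
  "cls v s = null_seqs v +>\<^bsub>cauchy_ring v\<^esub> s"

lemma completion_of_rat_cls: "completion_of_rat v q = cls v (\<lambda>_. q)"
  by (simp add: completion_of_rat_def cls_def)

section \<open>The completion computed on representatives\<close>

context
  fixes v assumes v: "v \<in> places"
begin

interpretation null: ideal "null_seqs v" "cauchy_ring v"
  by (rule null_seqs_ideal[OF v])

lemma completion_carrier: "X \<in> carrier (completion v) \<longleftrightarrow> (\<exists>s\<in>cauchy_seqs v. X = cls v s)"
  by (auto simp: completion_def FactRing_def A_RCOSETS_def' cls_def a_r_coset_def' cauchy_ring_def)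

lemma cls_carrier: "s \<in> cauchy_seqs v \<Longrightarrow> cls v s \<in> carrier (completion v)"
  by (auto simp: completion_carrier)

lemma cls_mult:
  "s \<in> cauchy_seqs v \<Longrightarrow> t \<in> cauchy_seqs v \<Longrightarrow> cls v s \<otimes>\<^bsub>completion v\<^esub> cls v t = cls v (\<lambda>n. s n * t n)"
  using ring_hom_mult[OF null.rcos_ring_hom, of s t] by (simp add: completion_def cls_def cauchy_ring_def)

lemma cls_add:
  "s \<in> cauchy_seqs v \<Longrightarrow> t \<in> cauchy_seqs v \<Longrightarrow> cls v s \<oplus>\<^bsub>completion v\<^esub> cls v t = cls v (\<lambda>n. s n + t n)"
  using ring_hom_add[OF null.rcos_ring_hom, of s t] by (simp add: completion_def cls_def cauchy_ring_def)

lemma cls_one: "\<one>\<^bsub>completion v\<^esub> = cls v (\<lambda>_. 1)"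
  by (simp add: completion_def cls_def FactRing_def cauchy_ring_def)

lemma cls_zero: "\<zero>\<^bsub>completion v\<^esub> = cls v (\<lambda>_. 0)"
proof -
  have "null_seqs v +>\<^bsub>cauchy_ring v\<^esub> \<zero>\<^bsub>cauchy_ring v\<^esub> = null_seqs v"
    by (rule null.a_coset_add_zero) (rule null.a_subset)
  then show ?thesis by (simp add: completion_def cls_def FactRing_def cauchy_ring_def)
qed

lemma completion_cring: "cring (completion v)"
  unfolding completion_def by (rule null.quotient_is_cring[OF cauchy_ring_cring[OF v]])

lemma cls_eq_zero_iff:
  assumes "s \<in> cauchy_seqs v"
  shows "cls v s = \<zero>\<^bsub>completion v\<^esub> \<longleftrightarrow> s \<in> null_seqs v"
proof -
  have s: "s \<in> carrier (cauchy_ring v)" using assms by (simp add: cauchy_ring_def)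
  have "\<zero>\<^bsub>completion v\<^esub> = null_seqs v" by (simp add: completion_def FactRing_def)
  then show ?thesis unfolding cls_def using null.a_rcos_const[of s] null.a_rcos_self[OF s] by auto
qed

lemma cls_uminus:
  assumes "s \<in> cauchy_seqs v" shows "\<ominus>\<^bsub>completion v\<^esub> cls v s = cls v (\<lambda>n. - s n)"
proof -
  interpret cring "completion v" by (rule completion_cring)
  show ?thesis using assms
    by (intro minus_equality) (auto simp: cls_add cauchy_seqs_uminus[OF v] cls_zero intro: cls_carrier cauchy_seqs_uminus[OF v])
qed

lemma cls_diff:
  assumes "s \<in> cauchy_seqs v" "t \<in> cauchy_seqs v"
  shows "cls v s \<ominus>\<^bsub>completion v\<^esub> cls v t = cls v (\<lambda>n. s n - t n)"
  using assms by (simp add: a_minus_def cls_uminus cls_add cauchy_seqs_uminus[OF v])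

lemma cls_eq_iff:
  assumes "s \<in> cauchy_seqs v" "t \<in> cauchy_seqs v"
  shows "cls v s = cls v t \<longleftrightarrow> (\<lambda>n. s n - t n) \<in> null_seqs v"
proof -
  interpret cring "completion v" by (rule completion_cring)
  have "cls v s = cls v t \<longleftrightarrow> cls v s \<ominus>\<^bsub>completion v\<^esub> cls v t = \<zero>\<^bsub>completion v\<^esub>"
    using assms cls_carrier by simp
  then show ?thesis using assms cls_eq_zero_iff[OF cauchy_seqs_diff[OF v assms]] by (simp add: cls_diff)
qed

lemma completion_field: "field (completion v)"
proof -
  interpret cring "completion v" by (rule completion_cring)
  show ?thesis
  proof (rule cring_fieldI2)
    have "(\<lambda>_. 1) \<notin> null_seqs v" by (simp add: null_seqs_def place_abs_one[OF v] LIMSEQ_const_iff)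
    then show "\<zero>\<^bsub>completion v\<^esub> \<noteq> \<one>\<^bsub>completion v\<^esub>"
      using cls_eq_zero_iff[OF cauchy_seqs_const[OF v, of 1]] by (metis cls_one)
    fix X assume X: "X \<in> carrier (completion v)" "X \<noteq> \<zero>\<^bsub>completion v\<^esub>"
    then obtain s where s: "s \<in> cauchy_seqs v" "X = cls v s" "s \<notin> null_seqs v"
      using cls_eq_zero_iff unfolding completion_carrier by blast
    note i = cauchy_seqs_inverse[OF v s(1,3)]
    have "X \<otimes>\<^bsub>completion v\<^esub> cls v (\<lambda>n. inverse (s n)) = cls v (\<lambda>n. s n * inverse (s n))"
      unfolding s(2) by (rule cls_mult[OF s(1) i(1)])
    also have "\<dots> = cls v (\<lambda>_. 1)"
    proof (subst cls_eq_iff)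
      show "(\<lambda>n. s n * inverse (s n) - 1) \<in> null_seqs v"
        by (rule null_seqs_if_eventually_zero[OF v]) (use i(2) in \<open>eventually_elim, simp\<close>)
    qed (auto intro: cauchy_seqs_mult[OF v] s i cauchy_seqs_const[OF v])
    finally show "\<exists>Y\<in>carrier (completion v). X \<otimes>\<^bsub>completion v\<^esub> Y = \<one>\<^bsub>completion v\<^esub>"
      using cls_carrier[OF i(1)] by (auto simp: cls_one)
  qed
qed

lemma cls_pow:
  assumes "s \<in> cauchy_seqs v" shows "cls v s [^]\<^bsub>completion v\<^esub> (k::nat) = cls v (\<lambda>n. s n ^ k)"
proof -
  interpret cring "completion v" by (rule completion_cring)
  show ?thesis
    by (induction k) (use assms in \<open>auto simp: cls_one cls_mult cauchy_seqs_power[OF v] mult.commute\<close>)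
qed

lemma cls_finsum:
  assumes "finite S" "\<And>x. x \<in> S \<Longrightarrow> f x \<in> cauchy_seqs v"
  shows "(\<Oplus>\<^bsub>completion v\<^esub>x\<in>S. cls v (f x)) = cls v (\<lambda>n. \<Sum>x\<in>S. f x n)"
proof -
  interpret cring "completion v" by (rule completion_cring)
  show ?thesis using assms
  proof (induction S rule: finite_induct)
    case (insert x S)
    then have "(\<Oplus>\<^bsub>completion v\<^esub>x\<in>insert x S. cls v (f x)) = cls v (f x) \<oplus>\<^bsub>completion v\<^esub> (\<Oplus>\<^bsub>completion v\<^esub>x\<in>S. cls v (f x))"
      by (intro finsum_insert) (auto intro: cls_carrier)
    then show ?case using insert cauchy_seqs_sum[OF v, of S f] by (simp add: cls_add)
  qed (simp add: cls_zero)
qed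

lemma cls_finprod:
  assumes "finite S" "\<And>x. x \<in> S \<Longrightarrow> f x \<in> cauchy_seqs v"
  shows "(\<Otimes>\<^bsub>completion v\<^esub>x\<in>S. cls v (f x)) = cls v (\<lambda>n. \<Prod>x\<in>S. f x n)"
proof -
  interpret cring "completion v" by (rule completion_cring)
  show ?thesis using assms
  proof (induction S rule: finite_induct)
    case (insert x S)
    then have "(\<Otimes>\<^bsub>completion v\<^esub>x\<in>insert x S. cls v (f x)) = cls v (f x) \<otimes>\<^bsub>completion v\<^esub> (\<Otimes>\<^bsub>completion v\<^esub>x\<in>S. cls v (f x))"
      by (intro finprod_insert) (auto intro: cls_carrier)
    then show ?case using insert cauchy_seqs_prod[OF v, of S f] by (simp add: cls_mult)
  qed (simp add: cls_one)
qed

lemma cauchy_seqs_peval: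
  assumes "\<And>i. s i \<in> cauchy_seqs v"
  shows "(\<lambda>n. peval F (\<lambda>i. s i n)) \<in> cauchy_seqs v"
  unfolding peval_def pmonom_def
  by (intro cauchy_seqs_sum[OF v] cauchy_seqs_mult[OF v] cauchy_seqs_const[OF v] cauchy_seqs_prod[OF v]
      cauchy_seqs_power[OF v] assms)

text \<open>Together with \<open>cls_eq_zero_iff\<close> this says that an equation holds in the
  completion exactly when its values at the terms form a null sequence.\<close>

lemma eval_rpoly_cls:
  assumes s: "\<And>i. s i \<in> cauchy_seqs v"
  shows "eval_rpoly (completion v) (completion_of_rat v) F (\<lambda>i. cls v (s i)) = cls v (\<lambda>n. peval F (\<lambda>i. s i n))"
proof -
  interpret cring "completion v" by (rule completion_cring)
  have m: "(\<lambda>n. \<Prod>i\<in>UNIV. s i n ^ Poly_Mapping.lookup m i) \<in> cauchy_seqs v" for m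
    by (intro cauchy_seqs_prod[OF v] cauchy_seqs_power[OF v] s)
  have "completion_of_rat v q \<otimes>\<^bsub>completion v\<^esub> (\<Otimes>\<^bsub>completion v\<^esub>i\<in>UNIV. cls v (s i) [^]\<^bsub>completion v\<^esub> Poly_Mapping.lookup m i)
      = cls v (\<lambda>n. q * (\<Prod>i\<in>UNIV. s i n ^ Poly_Mapping.lookup m i))" for q m
    unfolding completion_of_rat_cls cls_pow[OF s]
    by (subst cls_finprod) (simp_all add: cauchy_seqs_power[OF v] s cls_mult cauchy_seqs_const[OF v] m)
  then have "eval_rpoly (completion v) (completion_of_rat v) F (\<lambda>i. cls v (s i)) =
     (\<Oplus>\<^bsub>completion v\<^esub>m\<in>Poly_Mapping.keys F. cls v (\<lambda>n. Poly_Mapping.lookup F m * (\<Prod>i\<in>UNIV. s i n ^ Poly_Mapping.lookup m i)))"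
    by (simp add: eval_rpoly_def)
  also have "\<dots> = cls v (\<lambda>n. peval F (\<lambda>i. s i n))"
    by (subst cls_finsum) (auto intro: cauchy_seqs_mult[OF v] cauchy_seqs_const[OF v] m simp: peval_def pmonom_def)
  finally show ?thesis .
qed

end

section \<open>Integer sequences at a finite place\<close>

declare place_abs.simps [simp del]

lemma padic_val_of_int: "padic_val l (of_int m) = int (multiplicity (int l) m)"
  by (simp add: padic_val_def)

lemma finite_place [simp]: "Finite l \<in> places \<longleftrightarrow> prime l"
  by (auto simp: places_def)

text \<open>The dictionary through which congruences between integers reach the completion and
  return from it.\<close>

lemma place_abs_of_int_le_iff:
  assumes "prime l"
  shows "place_abs (Finite l) (of_int m) \<le> real l powi (- int k) \<longleftrightarrow> int l ^ k dvd m"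
proof (cases "m = 0")
  case False
  have l: "1 < real l" using assms prime_gt_1_nat by simp
  have "real l powi (- int (multiplicity (int l) m)) \<le> real l powi (- int k) \<longleftrightarrow> k \<le> multiplicity (int l) m"
    using power_int_strict_increasing[OF _ l] power_int_increasing[of _ _ "real l"] l
    by (smt (verit, ccfv_SIG) of_nat_le_iff)
  also have "\<dots> \<longleftrightarrow> int l ^ k dvd m"
    using False assms by (intro power_dvd_iff_le_multiplicity[symmetric, THEN trans]) (auto)
  finally show ?thesis using False by (simp add: padic_val_of_int place_abs.simps)
qed simp

lemma powi_minus_tendsto_0:
  assumes "prime (l::nat)"
  shows "(\<lambda>n. real l powi (- int n)) \<longlonglongrightarrow> 0"
proof -
  have "(\<lambda>n. inverse (real l) ^ n) \<longlonglongrightarrow> 0"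
    using prime_gt_1_nat[OF assms] by (intro LIMSEQ_power_zero) (simp add: inverse_less_1_iff)
  then show ?thesis by (simp add: power_int_minus power_inverse)
qed

lemma null_seqs_of_int_iff:
  assumes l: "prime l"
  shows "(\<lambda>n. of_int (t n)) \<in> null_seqs (Finite l) \<longleftrightarrow> (\<forall>k. \<forall>\<^sub>F n in sequentially. int l ^ k dvd t n)"
proof
  assume *: "(\<lambda>n. of_int (t n)) \<in> null_seqs (Finite l)"
  show "\<forall>k. \<forall>\<^sub>F n in sequentially. int l ^ k dvd t n"
  proof
    fix k
    have "\<forall>\<^sub>F n in sequentially. place_abs (Finite l) (of_int (t n)) < real l powi (- int k)"
      using * prime_gt_0_nat[OF l] unfolding null_seqs_def by (auto intro!: order_tendstoD(2))
    then show "\<forall>\<^sub>F n in sequentially. int l ^ k dvd t n"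
      by (rule eventually_mono) (simp add: place_abs_of_int_le_iff[OF l, symmetric])
  qed
next
  assume *: "\<forall>k. \<forall>\<^sub>F n in sequentially. int l ^ k dvd t n"
  show "(\<lambda>n. of_int (t n)) \<in> null_seqs (Finite l)"
  proof (rule null_seqsI, simp add: l, rule order_tendstoI)
    fix e :: real assume "e < 0"
    then show "\<forall>\<^sub>F n in sequentially. e < place_abs (Finite l) (of_int (t n))"
      by (auto intro!: always_eventually less_le_trans[OF _ place_abs_nonneg])
  next
    fix e :: real assume "0 < e"
    then obtain k where k: "real l powi (- int k) < e"
      using order_tendstoD(2)[OF powi_minus_tendsto_0[OF l]] by (auto simp: eventually_sequentially)
    show "\<forall>\<^sub>F n in sequentially. place_abs (Finite l) (of_int (t n)) < e"
      using *[rule_format, of k]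
      by (rule eventually_mono) (rule le_less_trans[OF _ k], simp add: place_abs_of_int_le_iff[OF l])
  qed
qed

lemma cauchy_seqs_of_intD:
  assumes l: "prime l" and t: "(\<lambda>n. of_int (t n)) \<in> cauchy_seqs (Finite l)"
  obtains N where "\<And>m n. m \<ge> N \<Longrightarrow> n \<ge> N \<Longrightarrow> [t m = t n] (mod int l ^ k)"
proof -
  have "real l powi (- int k) > 0" using prime_gt_0_nat[OF l] by simp
  then obtain N where "\<And>m n. m \<ge> N \<Longrightarrow> n \<ge> N \<Longrightarrow> place_abs (Finite l) (of_int (t m) - of_int (t n)) < real l powi (- int k)"
    using cauchy_seqsD[OF t] by metis
  then have "[t m = t n] (mod int l ^ k)" if "m \<ge> N" "n \<ge> N" for m n
    using place_abs_of_int_le_iff[OF l, of "t m - t n" k] that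
    by (simp add: cong_iff_dvd_diff less_imp_le)
  then show ?thesis by (rule that)
qed

lemma cauchy_seqs_of_intI:
  assumes l: "prime l" and t: "\<And>k. \<exists>N. \<forall>m\<ge>N. \<forall>n\<ge>N. [t m = t n] (mod int l ^ k)"
  shows "(\<lambda>n. of_int (t n)) \<in> cauchy_seqs (Finite l)"
  unfolding cauchy_seqs_def
proof (intro CollectI allI impI)
  fix e :: real assume "0 < e"
  then obtain k where k: "real l powi (- int k) < e"
    using order_tendstoD(2)[OF powi_minus_tendsto_0[OF l]] by (auto simp: eventually_sequentially)
  obtain N where N: "\<forall>m\<ge>N. \<forall>n\<ge>N. [t m = t n] (mod int l ^ k)" using t by blast
  have "place_abs (Finite l) (of_int (t m) - of_int (t n)) < e" if "m \<ge> N" "n \<ge> N" for m n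
  proof -
    have "int l ^ k dvd t m - t n" using N that by (simp add: cong_iff_dvd_diff)
    then have "place_abs (Finite l) (of_int (t m - t n)) \<le> real l powi (- int k)"
      using place_abs_of_int_le_iff[OF l] by blast
    then show ?thesis using k by simp
  qed
  then show "\<exists>N. \<forall>m\<ge>N. \<forall>n\<ge>N. place_abs (Finite l) (of_int (t m) - of_int (t n)) < e" by blast
qed

lemma not_null_seqs_of_int:
  assumes l: "prime l" and t: "\<forall>\<^sub>F n in sequentially. \<not> int l dvd t n"
  shows "(\<lambda>n. of_int (t n)) \<notin> null_seqs (Finite l)"
proof
  assume "(\<lambda>n. of_int (t n)) \<in> null_seqs (Finite l)"
  then have "\<forall>\<^sub>F n in sequentially. int l ^ 1 dvd t n" using null_seqs_of_int_iff[OF l] by blast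
  then have "\<forall>\<^sub>F n in sequentially. False" using t by eventually_elim simp
  then show False by simp
qed

text \<open>The roots are lifted term by term; uniqueness of the lift makes them Cauchy.\<close>

lemma cauchy_seqs_sqrt:
  assumes l: "prime l" and w: "(\<lambda>n. of_int (w n)) \<in> cauchy_seqs (Finite l)"
    and s: "\<not> int l dvd s" "\<forall>\<^sub>F n in sequentially. [s\<^sup>2 = w n] (mod hensel_modulus (int l))"
  obtains r where "(\<lambda>n. of_int (r n)) \<in> cauchy_seqs (Finite l)"
    "(\<lambda>n. of_int ((r n)\<^sup>2 - w n)) \<in> null_seqs (Finite l)"
proof -
  have l': "prime (int l)" using l by simp
  obtain N0 where N0: "\<And>n. n \<ge> N0 \<Longrightarrow> [s\<^sup>2 = w n] (mod hensel_modulus (int l))"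
    using s(2) by (auto simp: eventually_sequentially)
  have "\<exists>r. [r = s] (mod hensel_radius (int l)) \<and> [r\<^sup>2 = w n] (mod int l ^ n)" if "n \<ge> N0" for n
    using hensel_sqrt[OF l' s(1) N0[OF that]] .
  then obtain r where r: "\<And>n. n \<ge> N0 \<Longrightarrow> [r n = s] (mod hensel_radius (int l)) \<and> [(r n)\<^sup>2 = w n] (mod int l ^ n)"
    by metis
  show ?thesis
  proof (rule that[of r])
    show "(\<lambda>n. of_int (r n)) \<in> cauchy_seqs (Finite l)"
    proof (rule cauchy_seqs_of_intI[OF l])
      fix k
      obtain N where N: "\<And>m n. m \<ge> N \<Longrightarrow> n \<ge> N \<Longrightarrow> [w m = w n] (mod int l ^ Suc k)"
        using cauchy_seqs_of_intD[OF l w] by metis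
      have "[r m = r n] (mod int l ^ k)" if "m \<ge> max (max N N0) (Suc k)" "n \<ge> max (max N N0) (Suc k)" for m n
      proof (rule hensel_unique[OF l' s(1)])
        have sq: "[(r i)\<^sup>2 = w i] (mod int l ^ Suc k)" if "i \<ge> max (max N N0) (Suc k)" for i
          using r[of i] that by (intro cong_dvd_modulus[OF _ le_imp_power_dvd[of "Suc k" i]]) auto
        show "[(r m)\<^sup>2 = (r n)\<^sup>2] (mod int l ^ Suc k)"
          using cong_trans[OF cong_trans[OF sq[OF that(1)] N[of m n]] cong_sym[OF sq[OF that(2)]]] that by simp
      qed (use r that in auto)
      then show "\<exists>N. \<forall>m\<ge>N. \<forall>n\<ge>N. [r m = r n] (mod int l ^ k)" by blast
    qed
    have "\<forall>\<^sub>F n in sequentially. int l ^ k dvd (r n)\<^sup>2 - w n" for k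
      unfolding eventually_sequentially
    proof (intro exI allI impI)
      fix n assume n: "n \<ge> max N0 k"
      then have "[(r n)\<^sup>2 = w n] (mod int l ^ n)" using r by simp
      then have "int l ^ n dvd (r n)\<^sup>2 - w n" by (simp add: cong_iff_dvd_diff)
      then show "int l ^ k dvd (r n)\<^sup>2 - w n" using n by (intro dvd_trans[OF le_imp_power_dvd[of k n "int l"]]) auto
    qed
    then show "(\<lambda>n. of_int ((r n)\<^sup>2 - w n)) \<in> null_seqs (Finite l)"
      by (intro null_seqs_of_int_iff[OF l, THEN iffD2] allI)
  qed
qed

text \<open>A rational of absolute value at most 1 has a reduced denominator prime to l, which is
  invertible modulo \<open>l ^ n\<close>.\<close>

lemma padic_integer_approx:
  assumes l: "prime l" and x: "place_abs (Finite l) x \<le> 1"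
  obtains t :: int where "place_abs (Finite l) (x - of_int t) \<le> real l powi (- int n)"
proof -
  obtain m d where md: "d > 0" "coprime m d" "x = of_int m / of_int d" by (rule rat_as_quotient)
  have l1: "real l > 1" using prime_gt_1_nat[OF l] by simp
  have nd: "\<not> int l dvd d"
  proof
    assume ld: "int l dvd d"
    then have "\<not> int l dvd m" using coprime_common_divisor[OF md(2), of "int l"] prime_gt_1_nat[OF l] by auto
    then have "m \<noteq> 0" by auto
    have "multiplicity (int l) d > 0" using ld md(1) l by (subst prime_multiplicity_gt_zero_iff) auto
    moreover have "multiplicity (int l) m = 0" using \<open>\<not> int l dvd m\<close> by (rule not_dvd_imp_multiplicity_0)
    ultimately have "padic_val l x < 0" unfolding md(3) using padic_val_divide[OF l \<open>m \<noteq> 0\<close>, of d] md(1) by simp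
    then have "place_abs (Finite l) x > 1" using \<open>m \<noteq> 0\<close> md l1 by (auto simp: one_less_power_int place_abs.simps)
    then show False using x by simp
  qed
  then have "coprime d (int l ^ n)" using prime_imp_coprime[of "int l" d] l by (simp add: coprime_commute)
  then obtain e where e: "[d * e = 1] (mod int l ^ n)" using cong_solve_coprime_int by metis
  have "int l ^ n dvd m * (1 - d * e)" using e by (simp add: cong_iff_dvd_diff dvd_diff_commute)
  then have "place_abs (Finite l) (of_int (m * (1 - d * e))) \<le> real l powi (- int n)"
    using place_abs_of_int_le_iff[OF l] by blast
  moreover have "x - of_int (m * e) = of_int (m * (1 - d * e)) * inverse (of_int d)"
    using md by (simp add: field_simps)
  moreover have "place_abs (Finite l) (inverse (of_int d)) = 1"
  proof -
    have "place_abs (Finite l) (of_int d) = 1" using nd md(1) by (simp add: padic_val_of_int not_dvd_imp_multiplicity_0 place_abs.simps)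
    then show ?thesis using place_abs_inverse[of "Finite l" "of_int d"] l md(1) by simp
  qed
  ultimately have "place_abs (Finite l) (x - of_int (m * e)) \<le> real l powi (- int n)"
    using place_abs_mult[of "Finite l"] l by simp
  then show ?thesis by (rule that)
qed

text \<open>This plays the role of primitive coordinates over the l-adic integers: one rational
  factor scales the whole vector, and null sequences absorb the passage to integers. The index set
  is free because both points of the surface and zeros of a ternary form are scaled.\<close>

lemma primitive_integral_scaling:
  assumes l: "prime l" and J: "finite J" and s: "\<And>i. i \<in> J \<Longrightarrow> s i \<in> cauchy_seqs (Finite l)"
    and nn: "\<exists>i\<in>J. s i \<notin> null_seqs (Finite l)"
  obtains c :: rat and t :: "'i \<Rightarrow> nat \<Rightarrow> int" where "c \<noteq> 0"
    "\<And>i. i \<in> J \<Longrightarrow> (\<lambda>n. of_int (t i n)) \<in> cauchy_seqs (Finite l)"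
    "\<And>i. i \<in> J \<Longrightarrow> (\<lambda>n. c * s i n - of_int (t i n)) \<in> null_seqs (Finite l)"
    "\<forall>\<^sub>F n in sequentially. \<exists>i\<in>J. \<not> int l dvd t i n"
proof -
  let ?v = "Finite l"
  have v: "?v \<in> places" using l by simp
  have l1: "real l > 1" using prime_gt_1_nat[OF l] by simp
  obtain j where j: "j \<in> J" "s j \<notin> null_seqs ?v" using nn by blast
  obtain e N0 where e: "e > 0" "\<And>n. n \<ge> N0 \<Longrightarrow> place_abs ?v (s j n) \<ge> e"
    using cauchy_not_null_bounded_below[OF v s[OF j(1)] j(2)] by metis
  have "\<forall>i\<in>J. \<exists>N. \<forall>m\<ge>N. \<forall>n\<ge>N. place_abs ?v (s i m - s i n) < e"
    using s e(1) by (simp add: cauchy_seqs_def)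
  then obtain M where M: "\<And>i m n. i \<in> J \<Longrightarrow> m \<ge> M i \<Longrightarrow> n \<ge> M i \<Longrightarrow> place_abs ?v (s i m - s i n) < e" by metis
  \<comment> \<open>From N on no coordinate moves by as much as e, while some coordinate has size at
    least e; the largest one at N therefore keeps its size.\<close>
  define N where "N = max N0 (Max (M ` J))"
  have N: "N \<ge> N0" "\<And>i. i \<in> J \<Longrightarrow> N \<ge> M i" using J by (auto simp: N_def le_max_iff_disj)
  have "Max ((\<lambda>i. place_abs ?v (s i N)) ` J) \<in> (\<lambda>i. place_abs ?v (s i N)) ` J"
    using J j by (intro Max_in) auto
  then obtain k where k: "k \<in> J" and "place_abs ?v (s k N) = Max ((\<lambda>i. place_abs ?v (s i N)) ` J)" by auto
  then have kmax: "place_abs ?v (s i N) \<le> place_abs ?v (s k N)" if "i \<in> J" for i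
    using J that by simp
  have ke: "place_abs ?v (s k N) \<ge> e" using e(2)[OF N(1)] kmax[OF j(1)] by simp
  \<comment> \<open>Division by the largest coordinate at index N makes all entries integral and
    that one a unit.\<close>
  define c where "c = inverse (s k N)"
  have skN: "s k N \<noteq> 0" using ke e(1) by auto
  have c0: "c \<noteq> 0" using skN by (simp add: c_def)
  have ca: "place_abs ?v c = inverse (place_abs ?v (s k N))" unfolding c_def by (rule place_abs_inverse[OF v skN])
  have pos: "place_abs ?v (s k N) > 0" using ke e(1) by linarith
  have small: "place_abs ?v (c * s i n - c * s i N) < 1" if "i \<in> J" "n \<ge> N" for i n
  proof -
    have "place_abs ?v (s i n - s i N) < place_abs ?v (s k N)"
      using M[OF that(1), of n N] N(2)[OF that(1)] that(2) ke by linarith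
    moreover have "c * s i n - c * s i N = c * (s i n - s i N)" by (simp add: algebra_simps)
    ultimately show ?thesis using pos
      by (simp only: place_abs_mult[OF v] ca) (simp add: field_simps)
  qed
  have leN: "place_abs ?v (c * s i N) \<le> 1" if "i \<in> J" for i
    using kmax[OF that] pos by (simp only: place_abs_mult[OF v] ca) (simp add: field_simps)
  have le: "place_abs ?v (c * s i n) \<le> 1" if "i \<in> J" "n \<ge> N" for i n
    using place_abs_ultrametric[OF l, of "c * s i n - c * s i N" "c * s i N"] small[OF that] leN[OF that(1)]
    by simp
  have "\<exists>t::int. place_abs ?v (c * s i n - of_int t) \<le> real l powi (- int n)" if "i \<in> J" "n \<ge> N" for i n
    using padic_integer_approx[OF l le[OF that]] by metis
  then obtain t where t: "\<And>i n. i \<in> J \<Longrightarrow> n \<ge> N \<Longrightarrow> place_abs ?v (c * s i n - of_int (t i n)) \<le> real l powi (- int n)"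
    by metis
  have null: "(\<lambda>n. c * s i n - of_int (t i n)) \<in> null_seqs ?v" if i: "i \<in> J" for i
  proof (rule null_seqsI[OF v], rule tendsto_sandwich[OF _ _ tendsto_const powi_minus_tendsto_0[OF l]])
    show "\<forall>\<^sub>F n in sequentially. 0 \<le> place_abs ?v (c * s i n - of_int (t i n))" by (simp add: place_abs_nonneg)
    show "\<forall>\<^sub>F n in sequentially. place_abs ?v (c * s i n - of_int (t i n)) \<le> real l powi (- int n)"
      using eventually_ge_at_top[of N] by eventually_elim (rule t[OF i])
  qed
  show ?thesis
  proof (rule that[OF c0, of t])
    fix i assume i: "i \<in> J"
    show "(\<lambda>n. c * s i n - of_int (t i n)) \<in> null_seqs ?v" using null[OF i] .
    have "(\<lambda>n. c * s i n - (c * s i n - of_int (t i n))) \<in> cauchy_seqs ?v"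
      by (intro cauchy_seqs_diff[OF v] cauchy_seqs_mult[OF v] cauchy_seqs_const[OF v] s[OF i] null_seqs_cauchy[OF v null[OF i]])
    then show "(\<lambda>n. of_int (t i n)) \<in> cauchy_seqs ?v" by simp
  next
    \<comment> \<open>Index at least 1 makes the approximation error less than 1. Divisibility of
      the integer would then push the unit coordinate below absolute value 1.\<close>
    have "\<not> int l dvd t k n" if n: "n \<ge> max N 1" for n
    proof
      assume "int l dvd t k n"
      then have "place_abs ?v (of_int (t k n)) \<le> real l powi (- int 1)" using place_abs_of_int_le_iff[OF l, of "t k n" 1] by simp
      also have "\<dots> < 1" using l1 by (simp add: power_int_minus inverse_less_1_iff)
      finally have 1: "place_abs ?v (of_int (t k n)) < 1" .
      have "real l powi (- int n) < 1" using l1 n by (simp add: power_int_minus inverse_less_1_iff)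
      then have 2: "place_abs ?v (c * s k n - of_int (t k n)) < 1" using t[OF k, of n] n by simp
      have 3: "place_abs ?v (c * s k N - c * s k n) < 1"
        using small[OF k, of n] n place_abs_diff_commute[OF v] by simp
      have "place_abs ?v (c * s k n) < 1"
        using place_abs_ultrametric[OF l, of "c * s k n - of_int (t k n)" "of_int (t k n)"] 1 2 by simp
      then have "place_abs ?v (c * s k N) < 1"
        using place_abs_ultrametric[OF l, of "c * s k N - c * s k n" "c * s k n"] 3 by simp
      then show False using skN place_abs_one[OF v] by (simp add: c_def)
    qed
    then show "\<forall>\<^sub>F n in sequentially. \<exists>i\<in>J. \<not> int l dvd t i n" using k unfolding eventually_sequentially by blast
  qed
qed

section \<open>Local invariants\<close>

context
  fixes v assumes v: "v \<in> places"
begin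

lemma not_null_seqs_const: "q \<noteq> 0 \<Longrightarrow> (\<lambda>_. q) \<notin> null_seqs v"
  using place_abs_eq_0_iff[OF v] by (simp add: null_seqs_def LIMSEQ_const_iff)

lemma completion_two_nonzero: "\<one>\<^bsub>completion v\<^esub> \<oplus>\<^bsub>completion v\<^esub> \<one>\<^bsub>completion v\<^esub> \<noteq> \<zero>\<^bsub>completion v\<^esub>"
proof -
  have "(\<lambda>_. 1 + 1) \<notin> null_seqs v" by (rule not_null_seqs_const) simp
  then show ?thesis using cls_eq_zero_iff[OF v cauchy_seqs_const[OF v, of "1 + 1"]]
    by (simp add: cls_one[OF v] cls_add[OF v cauchy_seqs_const[OF v] cauchy_seqs_const[OF v]])
qed

lemma local_inv_norm:
  assumes c: "\<beta> \<in> cauchy_seqs v" "f \<in> cauchy_seqs v" "g \<in> cauchy_seqs v"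
    and nz: "\<beta> \<notin> null_seqs v" "k \<noteq> 0"
    and eq: "(\<lambda>n. \<beta> n - (f n * f n - k * (g n * g n))) \<in> null_seqs v"
  shows "local_inv v (quaternion_algebra (completion v) (cls v (\<lambda>_. k)) (cls v \<beta>)) = 0"
proof -
  interpret field "completion v" by (rule completion_field[OF v])
  have "algebra_isomorphic (completion v) (quaternion_algebra (completion v) (cls v (\<lambda>_. k)) (cls v \<beta>))
      (matrix_algebra2 (completion v))"
  proof (rule quaternion_algebra_norm_split)
    show "cls v \<beta> = cls v f \<otimes>\<^bsub>completion v\<^esub> cls v f \<ominus>\<^bsub>completion v\<^esub>
        cls v (\<lambda>_. k) \<otimes>\<^bsub>completion v\<^esub> (cls v g \<otimes>\<^bsub>completion v\<^esub> cls v g)"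
      using c eq by (simp add: cls_mult[OF v] cls_diff[OF v] cauchy_seqs_mult[OF v] cauchy_seqs_const[OF v]
          cls_eq_iff[OF v] cauchy_seqs_diff[OF v])
  qed (use c nz in \<open>simp_all add: cls_carrier[OF v] cauchy_seqs_const[OF v] cls_eq_zero_iff[OF v]
      not_null_seqs_const completion_two_nonzero\<close>)
  then show ?thesis by (simp add: local_inv_def)
qed

lemma local_inv_square:
  assumes c: "\<beta> \<in> cauchy_seqs v" "r \<in> cauchy_seqs v"
    and nz: "\<beta> \<notin> null_seqs v" "k \<noteq> 0" and r: "(\<lambda>n. r n * r n - k) \<in> null_seqs v"
  shows "local_inv v (quaternion_algebra (completion v) (cls v (\<lambda>_. k)) (cls v \<beta>)) = 0"
proof (rule local_inv_norm)
  \<comment> \<open>From \<beta> = ((\<beta> + 1)/2)^2 - ((\<beta> - 1)/2)^2; since k = r^2, the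
    factor k(r/k)^2 equals 1 and turns the second square into k times a square.\<close>
  let ?f = "\<lambda>n. inverse 2 * (\<beta> n + 1)" and ?g = "\<lambda>n. inverse 2 * inverse k * r n * (\<beta> n - 1)"
  show "?f \<in> cauchy_seqs v" "?g \<in> cauchy_seqs v"
    by (intro cauchy_seqs_mult[OF v] cauchy_seqs_add[OF v] cauchy_seqs_diff[OF v] cauchy_seqs_const[OF v] c)+
  have "(\<lambda>n. (inverse 4 * inverse k * (\<beta> n - 1) * (\<beta> n - 1)) * (r n * r n - k)) \<in> null_seqs v"
    by (intro null_seqs_mult[OF v r] cauchy_seqs_mult[OF v] cauchy_seqs_diff[OF v] cauchy_seqs_const[OF v] c)
  then show "(\<lambda>n. \<beta> n - (?f n * ?f n - k * (?g n * ?g n))) \<in> null_seqs v"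
    by (rule back_subst[of "\<lambda>s. s \<in> null_seqs v"]) (use nz(2) in \<open>auto simp: fun_eq_iff field_simps\<close>)
qed (use c nz in simp_all)

lemma quotient_not_null:
  assumes "t1 \<in> cauchy_seqs v" "t2 \<in> cauchy_seqs v" "t1 \<notin> null_seqs v" "t2 \<notin> null_seqs v"
  shows "(\<lambda>n. t1 n * inverse (t2 n)) \<notin> null_seqs v"
proof
  assume "(\<lambda>n. t1 n * inverse (t2 n)) \<in> null_seqs v"
  from null_seqs_mult[OF v this assms(2)] have "t1 \<in> null_seqs v"
    by (rule null_seqs_eventually_eq[OF v, rotated])
      (use cauchy_seqs_inverse(2)[OF v assms(2,4)] in \<open>eventually_elim, simp\<close>)
  then show False using assms(3) by simp
qed

text \<open>A quotient and the corresponding product differ by the square of t2, itself a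
  norm.\<close>

lemma local_inv_quotient_norm:
  assumes t: "t1 \<in> cauchy_seqs v" "t2 \<in> cauchy_seqs v" "t1 \<notin> null_seqs v" "t2 \<notin> null_seqs v"
    and fg: "f \<in> cauchy_seqs v" "g \<in> cauchy_seqs v" "k \<noteq> 0"
    and eq: "(\<lambda>n. t1 n * t2 n - (f n * f n - k * (g n * g n))) \<in> null_seqs v"
  shows "local_inv v (quaternion_algebra (completion v) (cls v (\<lambda>_. k)) (cls v (\<lambda>n. t1 n * inverse (t2 n)))) = 0"
proof (rule local_inv_norm)
  note i = cauchy_seqs_inverse[OF v t(2,4)]
  show "(\<lambda>n. f n * inverse (t2 n)) \<in> cauchy_seqs v" "(\<lambda>n. g n * inverse (t2 n)) \<in> cauchy_seqs v"
    "(\<lambda>n. t1 n * inverse (t2 n)) \<in> cauchy_seqs v"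
    by (intro cauchy_seqs_mult[OF v] fg t i)+
  have "(\<lambda>n. inverse (t2 n) * inverse (t2 n) * (t1 n * t2 n - (f n * f n - k * (g n * g n)))) \<in> null_seqs v"
    by (intro null_seqs_mult[OF v eq] cauchy_seqs_mult[OF v] i)
  then show "(\<lambda>n. t1 n * inverse (t2 n) - (f n * inverse (t2 n) * (f n * inverse (t2 n))
      - k * (g n * inverse (t2 n) * (g n * inverse (t2 n))))) \<in> null_seqs v"
    by (rule null_seqs_eventually_eq[OF v, rotated]) (use i(2) in \<open>eventually_elim, simp add: field_simps\<close>)
qed (use fg quotient_not_null[OF t] in simp_all)

text \<open>Vanishing at a point depends only on the classes of its coordinates, which permits the
  passage from rational to integer representatives.\<close>

lemma peval_null_seqs_cong:
  assumes "\<And>i. s i \<in> cauchy_seqs v" "\<And>i. t i \<in> cauchy_seqs v" "\<And>i. (\<lambda>n. s i n - t i n) \<in> null_seqs v"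
  shows "(\<lambda>n. peval F (\<lambda>i. s i n)) \<in> null_seqs v \<longleftrightarrow> (\<lambda>n. peval F (\<lambda>i. t i n)) \<in> null_seqs v"
proof -
  have "(\<lambda>i. cls v (s i)) = (\<lambda>i. cls v (t i))" by (intro ext cls_eq_iff[OF v, THEN iffD2] assms)
  then have "cls v (\<lambda>n. peval F (\<lambda>i. s i n)) = cls v (\<lambda>n. peval F (\<lambda>i. t i n))"
    using eval_rpoly_cls[OF v, of s F] eval_rpoly_cls[OF v, of t F] assms(1,2) by simp
  then show ?thesis using cls_eq_zero_iff[OF v cauchy_seqs_peval[OF v]] assms(1,2) by metis
qed

lemma local_pointE:
  assumes "P \<in> local_points v p a b"
  obtains s where "\<And>i. s i \<in> cauchy_seqs v" "P = proj_point (completion v) (\<lambda>i. cls v (s i))"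
    "\<exists>i. s i \<notin> null_seqs v"
    "(\<lambda>n. peval (quadric1 p) (\<lambda>i. s i n)) \<in> null_seqs v" "(\<lambda>n. peval (quadric2 p a b) (\<lambda>i. s i n)) \<in> null_seqs v"
proof -
  obtain c where c: "P = proj_point (completion v) c" "range c \<subseteq> carrier (completion v)" "c \<noteq> (\<lambda>_. \<zero>\<^bsub>completion v\<^esub>)"
    "eval_rpoly (completion v) (completion_of_rat v) (quadric1 p) c = \<zero>\<^bsub>completion v\<^esub>"
    "eval_rpoly (completion v) (completion_of_rat v) (quadric2 p a b) c = \<zero>\<^bsub>completion v\<^esub>"
    using assms by (auto simp: surface_points_def)
  have "\<forall>i. \<exists>s\<in>cauchy_seqs v. c i = cls v s" using c(2) completion_carrier[OF v] by blast
  then obtain s where s: "\<And>i. s i \<in> cauchy_seqs v" "\<And>i. c i = cls v (s i)" by metis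
  have cs: "c = (\<lambda>i. cls v (s i))" using s(2) by blast
  show ?thesis
  proof (rule that[of s])
    show "\<exists>i. s i \<notin> null_seqs v" using c(3) s cls_eq_zero_iff[OF v] by (auto simp: fun_eq_iff)
  qed (use c s(1) cs in \<open>simp_all add: eval_rpoly_cls[OF v] cls_eq_zero_iff[OF v] cauchy_seqs_peval[OF v]\<close>)
qed

lemma scaled_in_proj_point:
  assumes s: "\<And>i. s i \<in> cauchy_seqs v" and c: "c \<noteq> 0"
  shows "(\<lambda>i. cls v (\<lambda>n. c * s i n)) \<in> proj_point (completion v) (\<lambda>i. cls v (s i))"
  unfolding proj_point_def
proof (intro CollectI exI[of _ "cls v (\<lambda>_. c)"] conjI ext)
  show "cls v (\<lambda>_. c) \<in> carrier (completion v) - {\<zero>\<^bsub>completion v\<^esub>}"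
    using c by (simp add: cls_carrier[OF v] cauchy_seqs_const[OF v] cls_eq_zero_iff[OF v] not_null_seqs_const)
qed (simp add: s cls_mult[OF v] cauchy_seqs_const[OF v])

end

context surface_parameters
begin

text \<open>Any admissible pair of forms not vanishing at P computes the invariant:
  \<open>brauer_class_forms\<close> supplies the isomorphism over the function field, and evaluation
  at s supplies the fibre.\<close>

lemma has_invariant_at_forms:
  assumes v: "v \<in> places" and T: "T1 \<in> numerator_forms" "T2 \<in> denominator_forms"
    and s: "\<And>i. s i \<in> cauchy_seqs v" and P: "(\<lambda>i. cls v (s i)) \<in> P"
    and nn: "(\<lambda>n. peval T1 (\<lambda>i. s i n)) \<notin> null_seqs v" "(\<lambda>n. peval T2 (\<lambda>i. s i n)) \<notin> null_seqs v"
  shows "has_invariant_at p a b v P (local_inv v (quaternion_algebra (completion v) (cls v (\<lambda>_. of_int p))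
    (cls v (\<lambda>n. peval T1 (\<lambda>i. s i n) * inverse (peval T2 (\<lambda>i. s i n))))))"
proof -
  interpret field "completion v" by (rule completion_field[OF v])
  let ?t1 = "\<lambda>n. peval T1 (\<lambda>i. s i n)" and ?t2 = "\<lambda>n. peval T2 (\<lambda>i. s i n)"
  let ?b = "\<lambda>n. ?t1 n * inverse (?t2 n)"
  have t: "?t1 \<in> cauchy_seqs v" "?t2 \<in> cauchy_seqs v" using cauchy_seqs_peval[OF v s] by auto
  note i = cauchy_seqs_inverse[OF v t(2) nn(2)]
  have b: "?b \<in> cauchy_seqs v" by (intro cauchy_seqs_mult[OF v] t i)
  have bt: "(\<lambda>n. ?b n * ?t2 n - ?t1 n) \<in> null_seqs v"
    by (rule null_seqs_if_eventually_zero[OF v]) (use i(2) in \<open>eventually_elim, simp\<close>)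
  have bnn: "?b \<notin> null_seqs v" by (rule quotient_not_null[OF v t nn])
  have fp: "(of_int p, 1) \<in> FP" "(T1, T2) \<in> FP" by (rule fraction_pairs_const) (rule form_fraction[OF T])
  have vp: "has_value_at v P (rf (of_int p) 1) (cls v (\<lambda>_. of_int p))"
    unfolding has_value_at_def
  proof (intro conjI bexI[OF _ ratfun_self[OF fp(1)]] case_prodI bexI[OF _ P])
    show "eval_rpoly (completion v) (completion_of_rat v) 1 (\<lambda>i. cls v (s i)) \<noteq> \<zero>\<^bsub>completion v\<^esub>"
      by (simp add: eval_rpoly_cls[OF v s] cls_eq_zero_iff[OF v] cauchy_seqs_const[OF v] not_null_seqs_const[OF v])
  qed (simp_all add: eval_rpoly_cls[OF v s] cls_mult[OF v] cauchy_seqs_const[OF v] cls_carrier[OF v])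
  have vb: "has_value_at v P (rf T1 T2) (cls v ?b)"
    unfolding has_value_at_def
  proof (intro conjI bexI[OF _ ratfun_self[OF fp(2)]] case_prodI bexI[OF _ P])
    show "eval_rpoly (completion v) (completion_of_rat v) T2 (\<lambda>i. cls v (s i)) \<noteq> \<zero>\<^bsub>completion v\<^esub>"
      using nn(2) by (simp add: eval_rpoly_cls[OF v s] cls_eq_zero_iff[OF v] t)
    show "cls v ?b \<otimes>\<^bsub>completion v\<^esub> eval_rpoly (completion v) (completion_of_rat v) T2 (\<lambda>i. cls v (s i))
        = eval_rpoly (completion v) (completion_of_rat v) T1 (\<lambda>i. cls v (s i))"
      using bt by (simp add: eval_rpoly_cls[OF v s] cls_mult[OF v] cls_eq_iff[OF v] cauchy_seqs_mult[OF v] b t)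
  qed (rule cls_carrier[OF v b])
  have nz: "cls v (\<lambda>_. of_int p) \<noteq> \<zero>\<^bsub>completion v\<^esub>" "cls v ?b \<noteq> \<zero>\<^bsub>completion v\<^esub>"
    using p_pos bnn by (simp_all add: cls_eq_zero_iff[OF v] cauchy_seqs_const[OF v] not_null_seqs_const[OF v] b)
  show ?thesis
    unfolding has_invariant_at_def
    using ratfun_carrier[OF fp(1)] ratfun_carrier[OF fp(2)] brauer_class_forms[OF T] vp vb nz by blast
qed

end

section \<open>A ramified quaternion algebra\<close>

lemma null_seqs_of_intD:
  "prime l \<Longrightarrow> (\<lambda>n. of_int (t n)) \<in> null_seqs (Finite l) \<Longrightarrow> \<forall>\<^sub>F n in sequentially. int l ^ k dvd t n"
  using null_seqs_of_int_iff by blast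

lemma QuadRes_cong: "[m = n] (mod l) \<Longrightarrow> QuadRes l m \<longleftrightarrow> QuadRes l n"
  unfolding QuadRes_def using cong_trans cong_sym by blast

text \<open>Modulo l only the term with B survives, so l divides B. Its term is then divisible by
  l^2, and dividing the rest by l leaves A^2 - wC^2, which is anisotropic modulo l.\<close>

lemma ramified_form_anisotropic:
  fixes l w A B C :: int
  assumes l: "prime l" and w: "\<not> QuadRes l w" and dvd: "l ^ 2 dvd l * A\<^sup>2 + w * B\<^sup>2 - l * w * C\<^sup>2"
  shows "l dvd A \<and> l dvd B \<and> l dvd C"
proof -
  have "\<not> l dvd w"
  proof
    assume "l dvd w"
    then have "[0\<^sup>2 = w] (mod l)" by (simp add: cong_iff_dvd_diff)
    then show False using w unfolding QuadRes_def by blast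
  qed
  have "l dvd l * A\<^sup>2 + w * B\<^sup>2 - l * w * C\<^sup>2" using dvd by (rule dvd_trans[rotated]) (simp add: power2_eq_square)
  moreover have "w * B\<^sup>2 = l * A\<^sup>2 + w * B\<^sup>2 - l * w * C\<^sup>2 - l * (A\<^sup>2 - w * C\<^sup>2)" by (simp add: algebra_simps)
  ultimately have "l dvd w * B\<^sup>2" by (metis dvd_diff dvd_triv_left)
  then have B: "l dvd B" using l \<open>\<not> l dvd w\<close> by (metis prime_dvd_mult_iff prime_dvd_power)
  then have "l ^ 2 dvd w * B\<^sup>2" by (simp add: dvd_power_same)
  moreover have "l * (A\<^sup>2 - w * C\<^sup>2) = l * A\<^sup>2 + w * B\<^sup>2 - l * w * C\<^sup>2 - w * B\<^sup>2" by (simp add: algebra_simps)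
  ultimately have "l ^ 2 dvd l * (A\<^sup>2 - w * C\<^sup>2)" using dvd by (metis dvd_diff)
  then have "l dvd A\<^sup>2 - w * C\<^sup>2" using prime_gt_0_int[OF l] by (simp add: power2_eq_square)
  then show ?thesis using norm_anisotropic_mod[OF l w] B by blast
qed

text \<open>A splitting would give a nontrivial zero of the pure quaternion form, and primitive
  integer approximations to that zero contradict \<open>ramified_form_anisotropic\<close> modulo
  l^2.\<close>

lemma local_inv_nonresidue:
  assumes l: "prime l"
    and t: "(\<lambda>n. of_int (t1 n)) \<in> cauchy_seqs (Finite l)" "(\<lambda>n. of_int (t2 n)) \<in> cauchy_seqs (Finite l)"
    and u: "\<forall>\<^sub>F n in sequentially. \<not> int l dvd t2 n"
    and nr: "\<forall>\<^sub>F n in sequentially. \<not> QuadRes (int l) (t1 n * t2 n)"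
  shows "local_inv (Finite l) (quaternion_algebra (completion (Finite l)) (cls (Finite l) (\<lambda>_. of_int (int l)))
    (cls (Finite l) (\<lambda>n. of_int (t1 n) * inverse (of_int (t2 n))))) = 1 / 2"
proof -
  let ?v = "Finite l" and ?K = "completion (Finite l)"
  have v: "?v \<in> places" using l by simp
  interpret field ?K by (rule completion_field[OF v])
  let ?b = "\<lambda>n. of_int (t1 n) * inverse (of_int (t2 n)) :: rat"
  have t2nn: "(\<lambda>n. of_int (t2 n)) \<notin> null_seqs ?v" by (rule not_null_seqs_of_int[OF l u])
  note i = cauchy_seqs_inverse[OF v t(2) t2nn]
  have b: "?b \<in> cauchy_seqs ?v" by (intro cauchy_seqs_mult[OF v] t i)
  note cc = cauchy_seqs_mult[OF v] cauchy_seqs_add[OF v] cauchy_seqs_diff[OF v] cauchy_seqs_const[OF v] b t i(1)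
  have False if iso: "algebra_isomorphic ?K (quaternion_algebra ?K (cls ?v (\<lambda>_. of_int (int l))) (cls ?v ?b)) (matrix_algebra2 ?K)"
  proof -
    obtain X1 X2 X3 where X: "X1 \<in> carrier ?K" "X2 \<in> carrier ?K" "X3 \<in> carrier ?K"
      "(X1, X2, X3) \<noteq> (\<zero>\<^bsub>?K\<^esub>, \<zero>\<^bsub>?K\<^esub>, \<zero>\<^bsub>?K\<^esub>)"
      "cls ?v (\<lambda>_. of_int (int l)) \<otimes>\<^bsub>?K\<^esub> (X1 \<otimes>\<^bsub>?K\<^esub> X1) \<oplus>\<^bsub>?K\<^esub> cls ?v ?b \<otimes>\<^bsub>?K\<^esub> (X2 \<otimes>\<^bsub>?K\<^esub> X2)
        \<ominus>\<^bsub>?K\<^esub> (cls ?v (\<lambda>_. of_int (int l)) \<otimes>\<^bsub>?K\<^esub> cls ?v ?b) \<otimes>\<^bsub>?K\<^esub> (X3 \<otimes>\<^bsub>?K\<^esub> X3) = \<zero>\<^bsub>?K\<^esub>"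
      by (rule quaternion_algebra_split_isotropic[OF _ _ completion_two_nonzero[OF v] iso])
        (auto intro!: cls_carrier[OF v] cc)
    obtain x1 x2 x3 where x: "x1 \<in> cauchy_seqs ?v" "x2 \<in> cauchy_seqs ?v" "x3 \<in> cauchy_seqs ?v"
      and Xx: "X1 = cls ?v x1" "X2 = cls ?v x2" "X3 = cls ?v x3"
      using X(1-3) unfolding completion_carrier[OF v] by blast
    have form_null: "(\<lambda>n. of_int (int l) * (x1 n * x1 n) + ?b n * (x2 n * x2 n) - (of_int (int l) * ?b n) * (x3 n * x3 n)) \<in> null_seqs ?v"
      using X(5) unfolding Xx by (simp add: cls_mult[OF v] cls_add[OF v] cls_diff[OF v] cls_eq_zero_iff[OF v] x cc del: of_int_of_nat_eq)
    \<comment> \<open>Dividing x2 and x3 by t2 turns the coefficient t1/t2 into the integer t1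
      t2.\<close>
    define y where "y = (\<lambda>i n. case i of Cx \<Rightarrow> x1 n | Cy \<Rightarrow> inverse (of_int (t2 n)) * x2 n
      | Cz \<Rightarrow> inverse (of_int (t2 n)) * x3 n | _ \<Rightarrow> 0)"
    have ys: "y Cx = x1" "y Cy = (\<lambda>n. inverse (of_int (t2 n)) * x2 n)" "y Cz = (\<lambda>n. inverse (of_int (t2 n)) * x3 n)"
      by (simp_all add: y_def fun_eq_iff)
    have yc: "y i \<in> cauchy_seqs ?v" if "i \<in> {Cx, Cy, Cz}" for i using that by (auto simp: ys intro!: cc x)
    have scale_back: "x \<in> null_seqs ?v" if "(\<lambda>n. inverse (of_int (t2 n)) * x n) \<in> null_seqs ?v" for x
      using null_seqs_mult[OF v that t(2)]
      by (rule null_seqs_eventually_eq[OF v, rotated]) (use i(2) in \<open>eventually_elim, simp\<close>)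
    have ynn: "\<exists>i\<in>{Cx, Cy, Cz}. y i \<notin> null_seqs ?v"
      using X(4) scale_back by (auto simp: ys Xx cls_eq_zero_iff[OF v] x)
    obtain c r where c: "c \<noteq> 0" and r: "\<And>i. i \<in> {Cx, Cy, Cz} \<Longrightarrow> (\<lambda>n. of_int (r i n)) \<in> cauchy_seqs ?v"
      "\<And>i. i \<in> {Cx, Cy, Cz} \<Longrightarrow> (\<lambda>n. c * y i n - of_int (r i n)) \<in> null_seqs ?v"
      and prim: "\<forall>\<^sub>F n in sequentially. \<exists>i\<in>{Cx, Cy, Cz}. \<not> int l dvd r i n"
      by (rule primitive_integral_scaling[OF l _ yc ynn]) auto
    let ?w = "\<lambda>n. of_int (t1 n * t2 n) :: rat"
    \<comment> \<open>Cx, Cy and Cz serve as the three unknowns, and the coefficient t1 t2 occupies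
      the slot Cu; in this form \<open>peval_null_seqs_cong\<close> transfers the equation to
      integers.\<close>
    let ?F = "of_int (int l) * pvar Cx ^ 2 + pvar Cu * pvar Cy ^ 2 - of_int (int l) * pvar Cu * pvar Cz ^ 2"
    let ?s = "\<lambda>i. if i \<in> {Cx, Cy, Cz} then (\<lambda>n. c * y i n) else ?w"
    let ?t = "\<lambda>i. if i \<in> {Cx, Cy, Cz} then (\<lambda>n. of_int (r i n)) else ?w"
    have wc: "?w \<in> cauchy_seqs ?v" using cauchy_seqs_mult[OF v t] by simp
    have sc: "?s i \<in> cauchy_seqs ?v" for i using yc wc by (simp add: cc)
    have tc: "?t i \<in> cauchy_seqs ?v" for i using r(1) wc by simp
    have st: "(\<lambda>n. ?s i n - ?t i n) \<in> null_seqs ?v" for i using r(2) null_seqs_zero[OF v] by simp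
    have "(\<lambda>n. c * c * (of_int (int l) * (x1 n * x1 n) + ?b n * (x2 n * x2 n) - (of_int (int l) * ?b n) * (x3 n * x3 n))) \<in> null_seqs ?v"
      by (intro null_seqs_mult[OF v form_null] cc)
    then have "(\<lambda>n. peval ?F (\<lambda>i. ?s i n)) \<in> null_seqs ?v"
    proof (rule null_seqs_eventually_eq[OF v, rotated])
      show "\<forall>\<^sub>F n in sequentially. peval ?F (\<lambda>i. ?s i n) =
          c * c * (of_int (int l) * (x1 n * x1 n) + ?b n * (x2 n * x2 n) - (of_int (int l) * ?b n) * (x3 n * x3 n))"
        using i(2)
      proof eventually_elim
        case (elim n)
        define j :: rat where "j = inverse (of_int (t2 n))"
        have j: "of_int (t2 n) * j = 1" using elim by (simp add: j_def)
        have sq: "of_int (t1 n) * of_int (t2 n) * (c * (j * x))\<^sup>2 = c * c * (of_int (t1 n) * j * (x * x))" for x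
        proof -
          have "of_int (t1 n) * of_int (t2 n) * (c * (j * x))\<^sup>2 = (of_int (t2 n) * j) * (c * c * (of_int (t1 n) * j * (x * x)))"
            by (simp add: power2_eq_square)
          then show ?thesis by (simp only: j mult_1)
        qed
        have "peval ?F (\<lambda>i. ?s i n) = of_int (int l) * (c * x1 n)\<^sup>2 + of_int (t1 n) * of_int (t2 n) * (c * (j * x2 n))\<^sup>2
            - of_int (int l) * (of_int (t1 n) * of_int (t2 n) * (c * (j * x3 n))\<^sup>2)"
          by (simp add: ys j_def del: of_int_of_nat_eq)
        also have "\<dots> = c * c * (of_int (int l) * (x1 n * x1 n) + (of_int (t1 n) * j) * (x2 n * x2 n)
            - (of_int (int l) * (of_int (t1 n) * j)) * (x3 n * x3 n))"
          unfolding sq by (simp add: algebra_simps power2_eq_square)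
        finally show ?case by (simp only: j_def)
      qed
    qed
    then have "(\<lambda>n. peval ?F (\<lambda>i. ?t i n)) \<in> null_seqs ?v"
      using peval_null_seqs_cong[where s = ?s and t = ?t, OF v sc tc st] by blast
    then have "(\<lambda>n. of_int (int l * (r Cx n)\<^sup>2 + (t1 n * t2 n) * (r Cy n)\<^sup>2 - int l * (t1 n * t2 n) * (r Cz n)\<^sup>2)) \<in> null_seqs ?v"
      by (simp del: of_int_of_nat_eq)
    then have "\<forall>\<^sub>F n in sequentially. int l ^ 2 dvd int l * (r Cx n)\<^sup>2 + (t1 n * t2 n) * (r Cy n)\<^sup>2 - int l * (t1 n * t2 n) * (r Cz n)\<^sup>2"
      by (rule null_seqs_of_intD[OF l])
    then have "\<forall>\<^sub>F n in sequentially. False"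
      using prim nr
    proof eventually_elim
      case (elim n)
      then show ?case using ramified_form_anisotropic[of "int l" "t1 n * t2 n" "r Cx n" "r Cy n" "r Cz n"] l by auto
    qed
    then show False by simp
  qed
  then show ?thesis unfolding local_inv_def by auto
qed

section \<open>The invariant at p\<close>

context surface_parameters
begin

text \<open>From N on the coordinates are frozen modulo \<open>l ^ 3\<close>, so what the congruence
  lemmas say about the integers at index N persists for all later terms.\<close>

lemma primitive_local_point:
  assumes l: "prime l" and P: "P \<in> local_points (Finite l) p a b"
  obtains t :: "coord \<Rightarrow> nat \<Rightarrow> int" and N where
    "\<And>i. (\<lambda>n. of_int (t i n)) \<in> cauchy_seqs (Finite l)"
    "(\<lambda>i. cls (Finite l) (\<lambda>n. of_int (t i n))) \<in> P"
    "int l ^ 3 dvd (t Cy N)\<^sup>2 - p * (t Cx N)\<^sup>2 - t Cu N * t Cv N"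
    "int l ^ 3 dvd (t Cz N)\<^sup>2 - p * (t Cx N)\<^sup>2 - (t Cu N + t Cv N) * (a * t Cu N + b * t Cv N)"
    "\<not> (int l dvd t Cx N \<and> int l dvd t Cy N \<and> int l dvd t Cz N \<and> int l dvd t Cu N \<and> int l dvd t Cv N)"
    "\<And>i n. n \<ge> N \<Longrightarrow> [t i n = t i N] (mod int l ^ 3)"
proof -
  let ?v = "Finite l"
  have v: "?v \<in> places" using l by simp
  obtain s where s: "\<And>i. s i \<in> cauchy_seqs ?v" "P = proj_point (completion ?v) (\<lambda>i. cls ?v (s i))"
    "\<exists>i. s i \<notin> null_seqs ?v"
    "(\<lambda>n. peval (quadric1 p) (\<lambda>i. s i n)) \<in> null_seqs ?v" "(\<lambda>n. peval (quadric2 p a b) (\<lambda>i. s i n)) \<in> null_seqs ?v"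
    using local_pointE[OF v P] by metis
  obtain c t where c: "c \<noteq> 0" and t: "\<And>i. (\<lambda>n. of_int (t i n)) \<in> cauchy_seqs ?v"
    "\<And>i. (\<lambda>n. c * s i n - of_int (t i n)) \<in> null_seqs ?v"
    and prim: "\<forall>\<^sub>F n in sequentially. \<exists>i. \<not> int l dvd t i n"
    by (rule primitive_integral_scaling[OF l finite_UNIV_coord s(1)]) (use s(3) in auto)
  have sc: "(\<lambda>n. c * s i n) \<in> cauchy_seqs ?v" for i
    by (intro cauchy_seqs_mult[OF v] cauchy_seqs_const[OF v] s)
  have "(\<lambda>n. c * c * peval (quadric1 p) (\<lambda>i. s i n)) \<in> null_seqs ?v"
    by (intro null_seqs_mult[OF v s(4)] cauchy_seqs_const[OF v])
  then have "(\<lambda>n. peval (quadric1 p) (\<lambda>i. c * s i n)) \<in> null_seqs ?v"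
    by (simp add: quadric1_def algebra_simps power2_eq_square)
  then have "(\<lambda>n. peval (quadric1 p) (\<lambda>i. of_int (t i n))) \<in> null_seqs ?v"
    using peval_null_seqs_cong[where s = "\<lambda>i n. c * s i n" and t = "\<lambda>i n. of_int (t i n)", OF v sc t] by blast
  then have "(\<lambda>n. of_int ((t Cy n)\<^sup>2 - p * (t Cx n)\<^sup>2 - t Cu n * t Cv n)) \<in> null_seqs ?v"
    by (simp add: quadric1_def)
  then have q1: "\<forall>\<^sub>F n in sequentially. int l ^ 3 dvd (t Cy n)\<^sup>2 - p * (t Cx n)\<^sup>2 - t Cu n * t Cv n"
    by (rule null_seqs_of_intD[OF l])
  have "(\<lambda>n. c * c * peval (quadric2 p a b) (\<lambda>i. s i n)) \<in> null_seqs ?v"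
    by (intro null_seqs_mult[OF v s(5)] cauchy_seqs_const[OF v])
  then have "(\<lambda>n. peval (quadric2 p a b) (\<lambda>i. c * s i n)) \<in> null_seqs ?v"
    by (simp add: quadric2_def algebra_simps power2_eq_square)
  then have "(\<lambda>n. peval (quadric2 p a b) (\<lambda>i. of_int (t i n))) \<in> null_seqs ?v"
    using peval_null_seqs_cong[where s = "\<lambda>i n. c * s i n" and t = "\<lambda>i n. of_int (t i n)", OF v sc t] by blast
  then have "(\<lambda>n. of_int ((t Cz n)\<^sup>2 - p * (t Cx n)\<^sup>2 - (t Cu n + t Cv n) * (a * t Cu n + b * t Cv n))) \<in> null_seqs ?v"
    by (simp add: quadric2_def)
  then have q2: "\<forall>\<^sub>F n in sequentially. int l ^ 3 dvd (t Cz n)\<^sup>2 - p * (t Cx n)\<^sup>2 - (t Cu n + t Cv n) * (a * t Cu n + b * t Cv n)"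
    by (rule null_seqs_of_intD[OF l])
  obtain M where M: "\<And>n. n \<ge> M \<Longrightarrow> int l ^ 3 dvd (t Cy n)\<^sup>2 - p * (t Cx n)\<^sup>2 - t Cu n * t Cv n
      \<and> int l ^ 3 dvd (t Cz n)\<^sup>2 - p * (t Cx n)\<^sup>2 - (t Cu n + t Cv n) * (a * t Cu n + b * t Cv n) \<and> (\<exists>i. \<not> int l dvd t i n)"
    using eventually_conj[OF q1 eventually_conj[OF q2 prim]] by (auto simp: eventually_sequentially)
  have "\<forall>i. \<exists>N. \<forall>m\<ge>N. \<forall>n\<ge>N. [t i m = t i n] (mod int l ^ 3)"
    using cauchy_seqs_of_intD[OF l t(1)] by metis
  then obtain N' where N': "\<And>i m n. m \<ge> N' i \<Longrightarrow> n \<ge> N' i \<Longrightarrow> [t i m = t i n] (mod int l ^ 3)" by metis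
  define N where "N = max M (Max (range N'))"
  have N: "N \<ge> M" "\<And>i. N \<ge> N' i" by (auto simp: N_def le_max_iff_disj)
  show ?thesis
  proof (rule that[of t N])
    have "(\<lambda>i. cls ?v (\<lambda>n. of_int (t i n))) = (\<lambda>i. cls ?v (\<lambda>n. c * s i n))"
      by (intro ext cls_eq_iff[OF v, THEN iffD2, symmetric] sc t)
    then show "(\<lambda>i. cls ?v (\<lambda>n. of_int (t i n))) \<in> P"
      unfolding s(2) using scaled_in_proj_point[OF v s(1) c] by simp
    show "\<not> (int l dvd t Cx N \<and> int l dvd t Cy N \<and> int l dvd t Cz N \<and> int l dvd t Cu N \<and> int l dvd t Cv N)"
      using M[OF N(1)] by (metis coord.exhaust)
    show "[t i n = t i N] (mod int l ^ 3)" if "n \<ge> N" for i n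
      using N'[of i n N] N(2)[of i] that by simp
  qed (use M[OF N(1)] t(1) in auto)
qed

lemma invariant_at_p:
  assumes P: "P \<in> local_points (Finite (nat p)) p a b"
  shows "has_invariant_at p a b (Finite (nat p)) P (1 / 2)"
proof -
  let ?v = "Finite (nat p)"
  note l = nat_p(1)
  have v: "?v \<in> places" using l by simp
  obtain t N where t: "\<And>i. (\<lambda>n. of_int (t i n)) \<in> cauchy_seqs ?v" and tP: "(\<lambda>i. cls ?v (\<lambda>n. of_int (t i n))) \<in> P"
    and q: "p ^ 3 dvd (t Cy N)\<^sup>2 - p * (t Cx N)\<^sup>2 - t Cu N * t Cv N"
    "p ^ 3 dvd (t Cz N)\<^sup>2 - p * (t Cx N)\<^sup>2 - (t Cu N + t Cv N) * (a * t Cu N + b * t Cv N)"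
    "\<not> (p dvd t Cx N \<and> p dvd t Cy N \<and> p dvd t Cz N \<and> p dvd t Cu N \<and> p dvd t Cv N)"
    and N: "\<And>i n. n \<ge> N \<Longrightarrow> [t i n = t i N] (mod p ^ 3)"
    by (rule primitive_local_point[OF l P, unfolded nat_p(3)]) blast
  have Np: "[t i n = t i N] (mod p)" if "n \<ge> N" for i n
    using N[OF that] by (rule cong_dvd_modulus) simp
  have tc: "(\<lambda>n. of_int (4 * a * (t Cz n + t Cy n))) \<in> cauchy_seqs ?v" "(\<lambda>n. of_int (t Cz n - t Cy n)) \<in> cauchy_seqs ?v"
    using cauchy_seqs_mult[OF v cauchy_seqs_const[OF v, of "4 * of_int a"] cauchy_seqs_add[OF v t[of Cz] t[of Cy]]]
      cauchy_seqs_diff[OF v t[of Cz] t[of Cy]] by simp_all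
  obtain d e where de: "d = t Cu N \<or> d = t Cv N" "e = t Cz N - t Cy N \<or> e = t Cz N + t Cy N" "\<not> p dvd d"
    "\<not> QuadRes p (d * e)"
    using p_primitive[OF q] by metis
  obtain D where D: "pvar D \<in> denominator_forms" "d = t D N"
    using de(1) by (auto simp: denominator_forms_def)
  \<comment> \<open>Among the admissible numerators z + y appears only with the factor 4a; since 4a
    is 1 modulo p, the residue is the same.\<close>
  have "\<exists>T\<in>numerator_forms. \<exists>\<tau>. (\<lambda>n. of_int (\<tau> n)) \<in> cauchy_seqs ?v \<and>
     (\<forall>n. peval T (\<lambda>i. of_int (t i n)) = (of_int (\<tau> n) :: rat)) \<and> (\<forall>n\<ge>N. [\<tau> n = e] (mod p))"
    using de(2)
  proof
    assume e: "e = t Cz N - t Cy N"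
    show ?thesis
      using tc(2) Np by (intro bexI[of _ "pz - py"] exI[of _ "\<lambda>n. t Cz n - t Cy n"])
        (auto simp: numerator_forms_def e intro!: cong_diff)
  next
    assume e: "e = t Cz N + t Cy N"
    have "[4 * a * (t Cz n + t Cy n) = 1 * e] (mod p)" if "n \<ge> N" for n
      unfolding e using Np[OF that] by (intro cong_mult cong_add four_a)
    then show ?thesis
      using tc(1) by (intro bexI[of _ "of_int (4 * a) * (pz + py)"] exI[of _ "\<lambda>n. 4 * a * (t Cz n + t Cy n)"])
        (auto simp: numerator_forms_def)
  qed
  then obtain T \<tau> where T: "T \<in> numerator_forms" "(\<lambda>n. of_int (\<tau> n)) \<in> cauchy_seqs ?v"
    "\<And>n. peval T (\<lambda>i. of_int (t i n)) = (of_int (\<tau> n) :: rat)" "\<And>n. n \<ge> N \<Longrightarrow> [\<tau> n = e] (mod p)" by blast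
  have u2: "\<forall>\<^sub>F n in sequentially. \<not> p dvd t D n"
    using eventually_ge_at_top[of N] by eventually_elim (use Np de(3) D(2) cong_dvd_iff in blast)
  have nr: "\<forall>\<^sub>F n in sequentially. \<not> QuadRes p (\<tau> n * t D n)"
    using eventually_ge_at_top[of N]
  proof eventually_elim
    case (elim n)
    have "[\<tau> n * t D n = e * d] (mod p)" unfolding D(2) using elim T(4) Np by (intro cong_mult)
    then show ?case using QuadRes_cong de(4) by (metis mult.commute)
  qed
  \<comment> \<open>Zero is a square, so a product that is a non-residue has unit factors.\<close>
  have u1: "\<forall>\<^sub>F n in sequentially. \<not> p dvd \<tau> n"
    using nr
  proof eventually_elim
    case (elim n)
    have "[0\<^sup>2 = \<tau> n * t D n] (mod p)" if "p dvd \<tau> n" using that by (simp add: cong_iff_dvd_diff)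
    then show ?case using elim unfolding QuadRes_def by blast
  qed
  have nn: "(\<lambda>n. of_int (\<tau> n)) \<notin> null_seqs ?v" "(\<lambda>n. of_int (t D n)) \<notin> null_seqs ?v"
    using not_null_seqs_of_int[OF l] u1 u2 nat_p(3) by simp_all
  have "has_invariant_at p a b ?v P (local_inv ?v (quaternion_algebra (completion ?v) (cls ?v (\<lambda>_. of_int p))
    (cls ?v (\<lambda>n. peval T (\<lambda>i. of_int (t i n)) * inverse (peval (pvar D) (\<lambda>i. of_int (t i n)))))))"
    by (rule has_invariant_at_forms[OF v T(1) D(1) t tP]) (use nn T(3) in simp_all)
  moreover have "local_inv ?v (quaternion_algebra (completion ?v) (cls ?v (\<lambda>_. of_int p))
    (cls ?v (\<lambda>n. of_int (\<tau> n) * inverse (of_int (t D n))))) = 1 / 2"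
    using local_inv_nonresidue[OF l T(2) t] u2 nr unfolding nat_p(3) by blast
  ultimately show ?thesis using T(3) by simp
qed

end

section \<open>The invariants away from p\<close>

context surface_parameters
begin

text \<open>The product w of z - y with a unit denominator is a unit, hence a norm at the precision
  of \<open>hensel_modulus\<close>. One of the two squares in that representation is a unit up to
  the factor p; its root is lifted while the other entry stays fixed.\<close>

lemma invariant_at_inert:
  assumes inert: "inert (int l)" and P: "P \<in> local_points (Finite l) p a b"
  shows "has_invariant_at p a b (Finite l) P 0"
proof -
  let ?v = "Finite l"
  have l': "prime (int l)" and lp: "int l \<noteq> p" using inert by (auto simp: inert_def)
  then have l: "prime l" by simp
  have v: "?v \<in> places" using l by simp
  obtain t N where t: "\<And>i. (\<lambda>n. of_int (t i n)) \<in> cauchy_seqs ?v" and tP: "(\<lambda>i. cls ?v (\<lambda>n. of_int (t i n))) \<in> P"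
    and q: "int l ^ 3 dvd (t Cy N)\<^sup>2 - p * (t Cx N)\<^sup>2 - t Cu N * t Cv N"
    "int l ^ 3 dvd (t Cz N)\<^sup>2 - p * (t Cx N)\<^sup>2 - (t Cu N + t Cv N) * (a * t Cu N + b * t Cv N)"
    "\<not> (int l dvd t Cx N \<and> int l dvd t Cy N \<and> int l dvd t Cz N \<and> int l dvd t Cu N \<and> int l dvd t Cv N)"
    and N: "\<And>i n. n \<ge> N \<Longrightarrow> [t i n = t i N] (mod int l ^ 3)"
    by (rule primitive_local_point[OF l P]) blast
  have zy: "\<not> int l dvd t Cz N - t Cy N" and uv: "\<not> (int l dvd t Cu N \<and> int l dvd t Cv N)"
    using inert_primitive[OF inert q] by auto
  obtain D where D: "pvar D \<in> denominator_forms" "\<not> int l dvd t D N"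
    using uv by (auto simp: denominator_forms_def)
  define w where "w n = (t Cz n - t Cy n) * t D n" for n
  have wN: "[w n = w N] (mod int l ^ 3)" if "n \<ge> N" for n
    unfolding w_def using N[OF that] by (intro cong_mult cong_diff)
  \<comment> \<open>The modulus \<open>l ^ 3\<close> carries the precision that lifting requires, 8
    at l = 2 and l otherwise.\<close>
  have hm: "hensel_modulus (int l) dvd int l ^ 3" "int l dvd hensel_modulus (int l)"
    by (auto simp: hensel_modulus_def power3_eq_cube)
  have wu: "\<not> int l dvd w N" using zy D(2) prime_dvd_mult_iff[OF l'] by (simp add: w_def)
  note cc = cauchy_seqs_mult[OF v] cauchy_seqs_add[OF v] cauchy_seqs_diff[OF v] cauchy_seqs_const[OF v] t
  have wc: "(\<lambda>n. of_int (w n)) \<in> cauchy_seqs ?v" unfolding w_def of_int_mult of_int_diff by (intro cc)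
  have unit: "\<forall>\<^sub>F n in sequentially. \<not> int l dvd t Cz n - t Cy n" "\<forall>\<^sub>F n in sequentially. \<not> int l dvd t D n"
  proof -
    have "int l dvd int l ^ 3" by simp
    then have Nl: "[t i n = t i N] (mod int l)" if "n \<ge> N" for i n using N[OF that] cong_dvd_modulus by blast
    show "\<forall>\<^sub>F n in sequentially. \<not> int l dvd t D n"
      using eventually_ge_at_top[of N] by eventually_elim (use Nl D(2) cong_dvd_iff in blast)
    show "\<forall>\<^sub>F n in sequentially. \<not> int l dvd t Cz n - t Cy n"
      using eventually_ge_at_top[of N]
    proof eventually_elim
      case (elim n)
      then have "[t Cz n - t Cy n = t Cz N - t Cy N] (mod int l)" using Nl by (intro cong_diff)
      then show ?case using zy cong_dvd_iff by blast
    qed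
  qed
  have nn: "(\<lambda>n. of_int (t Cz n - t Cy n)) \<notin> null_seqs ?v" "(\<lambda>n. of_int (t D n)) \<notin> null_seqs ?v"
    by (rule not_null_seqs_of_int[OF l unit(1)], rule not_null_seqs_of_int[OF l unit(2)])
  have "\<exists>f g. f \<in> cauchy_seqs ?v \<and> g \<in> cauchy_seqs ?v \<and>
     (\<lambda>n. of_int (w n) - (f n * f n - of_int p * (g n * g n))) \<in> null_seqs ?v"
  proof -
    obtain f0 g0 where fg: "[f0\<^sup>2 - p * g0\<^sup>2 = w N] (mod hensel_modulus (int l))"
      using inert_unit_norm_mod[OF inert wu] by blast
    have fgn: "[f0\<^sup>2 - p * g0\<^sup>2 = w n] (mod hensel_modulus (int l))" if "n \<ge> N" for n
      by (rule cong_trans[OF fg cong_sym[OF cong_dvd_modulus[OF wN[OF that] hm(1)]]])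
    show ?thesis
    proof (cases "int l dvd f0")
      case False
      have w'c: "(\<lambda>n. of_int (w n + p * g0\<^sup>2)) \<in> cauchy_seqs ?v"
        using cauchy_seqs_add[OF v wc cauchy_seqs_const[OF v, of "of_int (p * g0\<^sup>2)"]] by simp
      have "\<forall>\<^sub>F n in sequentially. [f0\<^sup>2 = w n + p * g0\<^sup>2] (mod hensel_modulus (int l))"
        using eventually_ge_at_top[of N]
        by eventually_elim (use fgn in \<open>simp add: cong_iff_dvd_diff algebra_simps\<close>)
      from cauchy_seqs_sqrt[OF l w'c False this] obtain r where r: "(\<lambda>n. of_int (r n)) \<in> cauchy_seqs ?v"
        "(\<lambda>n. of_int ((r n)\<^sup>2 - (w n + p * g0\<^sup>2))) \<in> null_seqs ?v" .
      have "(\<lambda>n. of_int (w n) - (of_int (r n) * of_int (r n) - of_int p * (of_int g0 * of_int g0))) \<in> null_seqs ?v"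
        using null_seqs_uminus[OF v r(2)] by (simp add: power2_eq_square algebra_simps)
      then show ?thesis using r(1) cauchy_seqs_const[OF v] by blast
    next
      case True
      have pl: "\<not> int l dvd p" using primes_dvd_imp_eq[OF l' prime_p] lp by blast
      have "\<not> int l dvd g0"
      proof
        assume "int l dvd g0"
        then have "int l dvd f0\<^sup>2 - p * g0\<^sup>2" using True by (simp add: power2_eq_square)
        then have "int l dvd w N" using cong_dvd_iff[OF cong_dvd_modulus[OF fg hm(2)]] by blast
        then show False using wu by simp
      qed
      then have pg: "\<not> int l dvd p * g0" using pl prime_dvd_mult_iff[OF l'] by blast
      \<comment> \<open>With f0 divisible by l, the unit is p g0. Lifting the square root of p f0^2
        - pw and dividing it by p gives the second entry of the norm.\<close>
      have w'c: "(\<lambda>n. of_int (p * f0\<^sup>2 - p * w n)) \<in> cauchy_seqs ?v"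
        unfolding of_int_diff of_int_mult by (intro cc wc)
      have "\<forall>\<^sub>F n in sequentially. [(p * g0)\<^sup>2 = p * f0\<^sup>2 - p * w n] (mod hensel_modulus (int l))"
        using eventually_ge_at_top[of N]
      proof eventually_elim
        case (elim n)
        have "[p * f0\<^sup>2 - p * (f0\<^sup>2 - p * g0\<^sup>2) = p * f0\<^sup>2 - p * w n] (mod hensel_modulus (int l))"
          using fgn[OF elim] by (intro cong_diff cong_mult cong_refl)
        then show ?case by (simp add: power2_eq_square algebra_simps)
      qed
      from cauchy_seqs_sqrt[OF l w'c pg this] obtain r where r: "(\<lambda>n. of_int (r n)) \<in> cauchy_seqs ?v"
        "(\<lambda>n. of_int ((r n)\<^sup>2 - (p * f0\<^sup>2 - p * w n))) \<in> null_seqs ?v" .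
      have "(\<lambda>n. inverse (of_int p) * of_int ((r n)\<^sup>2 - (p * f0\<^sup>2 - p * w n))) \<in> null_seqs ?v"
        by (intro null_seqs_mult[OF v r(2)] cc)
      then have "(\<lambda>n. of_int (w n) - (of_int f0 * of_int f0
          - of_int p * ((inverse (of_int p) * of_int (r n)) * (inverse (of_int p) * of_int (r n))))) \<in> null_seqs ?v"
        by (rule back_subst[of "\<lambda>s. s \<in> null_seqs ?v"])
          (use p_pos in \<open>auto simp: fun_eq_iff field_simps power2_eq_square\<close>)
      then show ?thesis using cauchy_seqs_mult[OF v cauchy_seqs_const[OF v] r(1)] cauchy_seqs_const[OF v] by blast
    qed
  qed
  then obtain f g where fg: "f \<in> cauchy_seqs ?v" "g \<in> cauchy_seqs ?v"
     "(\<lambda>n. of_int (w n) - (f n * f n - of_int p * (g n * g n))) \<in> null_seqs ?v" by blast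
  have zyc: "(\<lambda>n. of_int (t Cz n - t Cy n)) \<in> cauchy_seqs ?v" unfolding of_int_diff by (intro cc)
  have "has_invariant_at p a b ?v P (local_inv ?v (quaternion_algebra (completion ?v) (cls ?v (\<lambda>_. of_int p))
    (cls ?v (\<lambda>n. peval (pz - py) (\<lambda>i. of_int (t i n)) * inverse (peval (pvar D) (\<lambda>i. of_int (t i n)))))))"
    by (rule has_invariant_at_forms[OF v _ D(1) t tP]) (use nn in \<open>simp_all add: numerator_forms_def\<close>)
  moreover have "local_inv ?v (quaternion_algebra (completion ?v) (cls ?v (\<lambda>_. of_int p))
    (cls ?v (\<lambda>n. of_int (t Cz n - t Cy n) * inverse (of_int (t D n))))) = 0"
    by (rule local_inv_quotient_norm[OF v zyc t nn fg(1,2)]) (use fg(3) p_pos in \<open>simp_all add: w_def\<close>)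
  ultimately show ?thesis by simp
qed

text \<open>If all denominators vanished, so would u, v and y, and the quadrics would kill x and z.
  If all numerators vanished, then z = y = 0 and L = 2au + (a + b - 1)v = 0. With q = z^2 - y^2 the
  identity L^2 - 4aq = pv^2 kills v, then L kills u and the first quadric kills x.\<close>

lemma nonvanishing_forms:
  assumes v: "v \<in> places" and s: "\<And>i. s i \<in> cauchy_seqs v" and nn: "\<exists>i. s i \<notin> null_seqs v"
    and q1: "(\<lambda>n. peval (quadric1 p) (\<lambda>i. s i n)) \<in> null_seqs v"
    and q2: "(\<lambda>n. peval (quadric2 p a b) (\<lambda>i. s i n)) \<in> null_seqs v"
  shows "\<exists>T\<in>denominator_forms. (\<lambda>n. peval T (\<lambda>i. s i n)) \<notin> null_seqs v" (is ?D)
    and "\<exists>T\<in>numerator_forms. (\<lambda>n. peval T (\<lambda>i. s i n)) \<notin> null_seqs v" (is ?N)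
proof -
  let ?null = "\<lambda>f. f \<in> null_seqs v"
  note cc = cauchy_seqs_mult[OF v] cauchy_seqs_add[OF v] cauchy_seqs_diff[OF v] cauchy_seqs_const[OF v] s
  have a0: "a \<noteq> 0" using odd_a by auto
  have q1': "?null (\<lambda>n. s Cy n * s Cy n - of_int p * (s Cx n * s Cx n) - s Cu n * s Cv n)"
    using q1 by (simp add: quadric1_def power2_eq_square)
  have q2': "?null (\<lambda>n. s Cz n * s Cz n - of_int p * (s Cx n * s Cx n) - (s Cu n + s Cv n) * (of_int a * s Cu n + of_int b * s Cv n))"
    using q2 by (simp add: quadric2_def power2_eq_square)
  have scaleD: "?null f" if "?null (\<lambda>n. c * f n)" "c \<noteq> 0" for c f
    using null_seqs_mult[OF v that(1) cauchy_seqs_const[OF v, of "inverse c"]] that(2) by (simp add: mult.assoc[symmetric])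
  have sqD: "?null f" if "?null (\<lambda>n. f n * f n)" "f \<in> cauchy_seqs v" for f
    using null_seqs_mult_cases[OF v that(2,2,1)] by blast
  have xD: "?null (s Cx)" if "?null (s Cy)" "?null (s Cu)"
  proof -
    have "?null (\<lambda>n. s Cy n * s Cy n - s Cv n * s Cu n)"
      by (intro null_seqs_diff[OF v] null_seqs_mult[OF v] that s)
    from null_seqs_diff[OF v this q1'] have "?null (\<lambda>n. of_int p * (s Cx n * s Cx n))" by (simp add: mult.commute)
    then show ?thesis using p_pos by - (rule sqD[OF scaleD[of "of_int p"] s], auto)
  qed
  have all: False if "?null (s Cx)" "?null (s Cy)" "?null (s Cz)" "?null (s Cu)" "?null (s Cv)"
    using nn that by (metis coord.exhaust)
  show ?D
  proof (rule ccontr)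
    assume "\<not> ?D"
    then have "?null (\<lambda>n. peval T (\<lambda>i. s i n))" if "T \<in> denominator_forms" for T using that by blast
    from this[of pu] this[of pv] this[of "pu + pv - 2 * py"]
    have u: "?null (s Cu)" and w: "?null (s Cv)" and y': "?null (\<lambda>n. s Cu n + s Cv n - 2 * s Cy n)"
      by (simp_all add: denominator_forms_def)
    have y: "?null (s Cy)"
      using null_seqs_diff[OF v null_seqs_add[OF v u w] y'] by - (rule scaleD[of 2], auto)
    note x = xD[OF y u]
    have "?null (\<lambda>n. of_int p * (s Cx n * s Cx n) + (s Cu n + s Cv n) * (of_int a * s Cu n + of_int b * s Cv n))"
      by (intro null_seqs_add[OF v] null_seqs_mult[OF v] cc x u w)
    from null_seqs_add[OF v q2' this]
    have z: "?null (s Cz)" by - (rule sqD[OF _ s], simp)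
    show False by (rule all[OF x y z u w])
  qed
  show ?N
  proof (rule ccontr)
    assume "\<not> ?N"
    then have *: "?null (\<lambda>n. peval T (\<lambda>i. s i n))" if "T \<in> numerator_forms" for T using that by blast
    let ?L = "\<lambda>n. of_int (2 * a) * s Cu n + of_int (a + b - 1) * s Cv n"
    let ?M = "\<lambda>n. of_int a * (s Cz n - s Cy n) + (s Cz n + s Cy n) - of_int (2 * a) * s Cu n - of_int (a + b - 1) * s Cv n"
    have zmy: "?null (\<lambda>n. s Cz n - s Cy n)" using *[of "pz - py"] by (simp add: numerator_forms_def)
    have "?null (\<lambda>n. of_int (4 * a) * (s Cz n + s Cy n))"
      using *[of "of_int (4 * a) * (pz + py)"] by (simp add: numerator_forms_def)
    then have zpy: "?null (\<lambda>n. s Cz n + s Cy n)" using a0 by - (rule scaleD[of "of_int (4 * a)"], auto)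
    have "?null (\<lambda>n. of_int (4 * a) * ?M n)"
      using *[of "of_int (4 * a) * (of_int a * (pz - py) + (pz + py) - of_int (2 * a) * pu - of_int (a + b - 1) * pv)"]
      by (simp add: numerator_forms_def)
    then have M: "?null ?M" using a0 by - (rule scaleD[of "of_int (4 * a)"], auto)
    have y: "?null (s Cy)" using null_seqs_diff[OF v zpy zmy] by - (rule scaleD[of 2], auto)
    have z: "?null (s Cz)" using null_seqs_add[OF v zmy y] by simp
    have L: "?null ?L"
      using null_seqs_diff[OF v null_seqs_add[OF v null_seqs_mult[OF v zmy cauchy_seqs_const[OF v, of "of_int a"]] zpy] M]
      by (simp add: algebra_simps)
    have Lc: "?L \<in> cauchy_seqs v" by (intro cc)
    \<comment> \<open>The terms in x, y and z cancel, which leaves the binary form au^2 + (a + b -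
      1)uv + bv^2.\<close>
    let ?q = "\<lambda>n. (s Cy n * s Cy n - of_int p * (s Cx n * s Cx n) - s Cu n * s Cv n)
        - (s Cz n * s Cz n - of_int p * (s Cx n * s Cx n) - (s Cu n + s Cv n) * (of_int a * s Cu n + of_int b * s Cv n))
        + (s Cz n + s Cy n) * (s Cz n - s Cy n)"
    have q: "?null ?q"
      by (rule null_seqs_add[OF v null_seqs_diff[OF v q1' q2'] null_seqs_mult[OF v zmy cauchy_seqs_add[OF v s s]]])
    have "?null (\<lambda>n. ?L n * ?L n - of_int (4 * a) * ?q n)"
      by (rule null_seqs_diff[OF v null_seqs_mult[OF v L Lc] null_seqs_mult[OF v q cauchy_seqs_const[OF v]]])
    moreover have "?L n * ?L n - of_int (4 * a) * ?q n = of_int p * (s Cv n * s Cv n)" for n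
      unfolding disc[symmetric] by (simp add: algebra_simps power2_eq_square)
    ultimately have "?null (\<lambda>n. of_int p * (s Cv n * s Cv n))" by simp
    then have w: "?null (s Cv)" using p_pos by - (rule sqD[OF scaleD[of "of_int p"] s], auto)
    have u: "?null (s Cu)"
      using null_seqs_diff[OF v L null_seqs_mult[OF v w cauchy_seqs_const[OF v, of "of_int (a + b - 1)"]]] a0
      by - (rule scaleD[of "of_int (2 * a)"], auto)
    show False by (rule all[OF xD[OF y u] y z u w])
  qed
qed

lemma invariant_at_square:
  assumes v: "v \<in> places" and P: "P \<in> local_points v p a b"
    and r: "r \<in> cauchy_seqs v" "(\<lambda>n. r n * r n - of_int p) \<in> null_seqs v"
  shows "has_invariant_at p a b v P 0"
proof -
  obtain s where s: "\<And>i. s i \<in> cauchy_seqs v" "P = proj_point (completion v) (\<lambda>i. cls v (s i))"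
    "\<exists>i. s i \<notin> null_seqs v"
    "(\<lambda>n. peval (quadric1 p) (\<lambda>i. s i n)) \<in> null_seqs v" "(\<lambda>n. peval (quadric2 p a b) (\<lambda>i. s i n)) \<in> null_seqs v"
    using local_pointE[OF v P] by metis
  obtain T1 T2 where T: "T1 \<in> numerator_forms" "T2 \<in> denominator_forms"
    and nn: "(\<lambda>n. peval T1 (\<lambda>i. s i n)) \<notin> null_seqs v" "(\<lambda>n. peval T2 (\<lambda>i. s i n)) \<notin> null_seqs v"
    using nonvanishing_forms[OF v s(1,3,4,5)] by blast
  have sP: "(\<lambda>i. cls v (s i)) \<in> P"
    unfolding s(2) using scaled_in_proj_point[OF v s(1), of 1] by simp
  have c: "(\<lambda>n. peval T (\<lambda>i. s i n)) \<in> cauchy_seqs v" for T by (rule cauchy_seqs_peval[OF v s(1)])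
  have "local_inv v (quaternion_algebra (completion v) (cls v (\<lambda>_. of_int p))
    (cls v (\<lambda>n. peval T1 (\<lambda>i. s i n) * inverse (peval T2 (\<lambda>i. s i n))))) = 0"
    using p_pos cauchy_seqs_mult[OF v c cauchy_seqs_inverse(1)[OF v c nn(2)]] quotient_not_null[OF v c c nn]
    by (intro local_inv_square[OF v _ r(1) _ _ r(2)]) auto
  then show ?thesis using has_invariant_at_forms[OF v T s(1) sP nn] by simp
qed

lemma real_sqrt_p:
  obtains r where "r \<in> cauchy_seqs Infinite" "(\<lambda>n. r n * r n - of_int p) \<in> null_seqs Infinite"
proof -
  have "\<exists>q::rat. \<bar>real_of_rat q - sqrt p\<bar> < inverse (Suc n)" for n
  proof -
    obtain x where "x \<in> \<rat>" "sqrt p - inverse (Suc n) < x" "x < sqrt p + inverse (Suc n)"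
      using Rats_dense_in_real[of "sqrt p - inverse (Suc n)" "sqrt p + inverse (Suc n)"] by auto
    moreover obtain q where "x = real_of_rat q" using \<open>x \<in> \<rat>\<close> by (rule Rats_cases)
    ultimately show ?thesis by (intro exI[of _ q]) (simp add: abs_less_iff)
  qed
  then obtain r :: "nat \<Rightarrow> rat" where r: "\<And>n. \<bar>real_of_rat (r n) - sqrt p\<bar> < inverse (Suc n)" by metis
  have lim: "(\<lambda>n. real_of_rat (r n)) \<longlonglongrightarrow> sqrt p"
    by (rule LIM_zero_cancel, rule tendsto_rabs_zero_cancel,
        rule tendsto_sandwich[OF _ _ tendsto_const LIMSEQ_inverse_real_of_nat])
      (use r in \<open>auto intro!: always_eventually less_imp_le\<close>)
  show ?thesis
  proof (rule that[of r])
    have "Cauchy (\<lambda>n. real_of_rat (r n))" using lim by (rule LIMSEQ_imp_Cauchy)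
    then show "r \<in> cauchy_seqs Infinite"
      by (auto simp: cauchy_seqs_def Cauchy_def dist_real_def place_abs.simps of_rat_diff)
    have "(\<lambda>n. real_of_rat (r n) * real_of_rat (r n) - p) \<longlonglongrightarrow> sqrt p * sqrt p - p" by (intro tendsto_intros lim)
    then have "(\<lambda>n. \<bar>real_of_rat (r n) * real_of_rat (r n) - p\<bar>) \<longlonglongrightarrow> 0"
      using p_pos by (intro tendsto_rabs_zero) simp
    then show "(\<lambda>n. r n * r n - of_int p) \<in> null_seqs Infinite"
      by (simp only: null_seqs_def mem_Collect_eq place_abs.simps of_rat_diff of_rat_mult of_rat_of_int_eq)
  qed
qed

lemma padic_sqrt_p:
  assumes l: "prime l" "int l \<noteq> p" "\<not> inert (int l)"
  obtains r where "r \<in> cauchy_seqs (Finite l)" "(\<lambda>n. r n * r n - of_int p) \<in> null_seqs (Finite l)"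
proof -
  have l': "prime (int l)" using l by simp
  have l2: "int l \<noteq> 2" and "QuadRes (int l) p" using l by (auto simp: inert_def)
  then obtain s where s: "[s\<^sup>2 = p] (mod int l)" by (auto simp: QuadRes_def)
  have "\<not> int l dvd p" using primes_dvd_imp_eq[OF l' prime_p] l(2) by blast
  then have "\<not> int l dvd s\<^sup>2" using cong_dvd_iff[OF s] by blast
  then have sl: "\<not> int l dvd s" by (metis dvd_power_same power2_eq_square dvd_mult2)
  have "\<forall>\<^sub>F n in sequentially. [s\<^sup>2 = p] (mod hensel_modulus (int l))" using s l2 by (simp add: hensel_modulus_def)
  moreover have "(\<lambda>_. of_int p) \<in> cauchy_seqs (Finite l)" using cauchy_seqs_const[of "Finite l"] l(1) by simp
  ultimately obtain r where r: "(\<lambda>n. of_int (r n)) \<in> cauchy_seqs (Finite l)"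
    "(\<lambda>n. of_int ((r n)\<^sup>2 - p)) \<in> null_seqs (Finite l)"
    using cauchy_seqs_sqrt[OF l(1) _ sl, of "\<lambda>_. p"] by blast
  then show ?thesis by (intro that[of "\<lambda>n. of_int (r n)"]) (simp_all add: power2_eq_square)
qed

theorem invariant_at_local_point:
  assumes v: "v \<in> places" and P: "P \<in> local_points v p a b"
  shows "has_invariant_at p a b v P (if v = Finite (nat p) then 1 / 2 else 0)"
proof (cases v)
  case Infinite
  obtain r where "r \<in> cauchy_seqs Infinite" "(\<lambda>n. r n * r n - of_int p) \<in> null_seqs Infinite" by (rule real_sqrt_p)
  then show ?thesis using invariant_at_square[OF v P] Infinite by simp
next
  case (Finite l)
  then have l: "prime l" using v by simp
  consider "l = nat p" | "l \<noteq> nat p" "inert (int l)" | "l \<noteq> nat p" "\<not> inert (int l)" by blast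
  then show ?thesis
  proof cases
    case 1
    then show ?thesis using invariant_at_p P Finite by simp
  next
    case 2
    then show ?thesis using invariant_at_inert P Finite by simp
  next
    case 3
    then have "int l \<noteq> p" by auto
    then obtain r where "r \<in> cauchy_seqs (Finite l)" "(\<lambda>n. r n * r n - of_int p) \<in> null_seqs (Finite l)"
      using padic_sqrt_p[OF l _ 3(2)] by metis
    then show ?thesis using invariant_at_square[OF v P] Finite 3(1) by simp
  qed
qed

lemma brauer_manin_set_empty: "brauer_manin_set p a b = {}"
proof -
  have False if P: "P \<in> brauer_manin_set p a b" for P
  proof -
    define \<iota> :: "place \<Rightarrow> rat" where "\<iota> v = (if v = Finite (nat p) then 1 / 2 else 0)" for v
    have "P v \<in> local_points v p a b" if "v \<in> places" for v
      using P that by (auto simp: brauer_manin_set_def adelic_points_def)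
    then have "\<forall>v\<in>places. has_invariant_at p a b v (P v) (\<iota> v)"
      unfolding \<iota>_def using invariant_at_local_point by blast
    then have "(\<Sum>v | v \<in> places \<and> \<iota> v \<noteq> 0. \<iota> v) \<in> \<int>" using P by (auto simp: brauer_manin_set_def)
    moreover have "{v. v \<in> places \<and> \<iota> v \<noteq> 0} = {Finite (nat p)}" using nat_p(1) by (auto simp: \<iota>_def)
    ultimately have "(1 / 2 :: rat) \<in> \<int>" by (simp only: sum.insert sum.empty finite.emptyI) (simp add: \<iota>_def)
    then obtain k :: int where "(1 / 2 :: rat) = of_int k" by (auto elim: Ints_cases)
    then have "of_int (2 * k) = (of_int 1 :: rat)" by (simp add: field_simps)
    then have "2 * k = 1" by (simp only: of_int_eq_iff)
    then show False by presburger
  qed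
  then show ?thesis by blast
qed

end

section \<open>Rational points\<close>

lemma rat_field_cring: "cring rat_field"
proof (rule cringI)
  show "abelian_group rat_field"
  proof (rule abelian_groupI)
    show "\<exists>y\<in>carrier rat_field. y \<oplus>\<^bsub>rat_field\<^esub> x = \<zero>\<^bsub>rat_field\<^esub>" for x
      by (intro bexI[of _ "- x"]) (auto simp: rat_field_def)
  qed (auto simp: rat_field_def)
  show "comm_monoid rat_field" by (rule comm_monoidI) (auto simp: rat_field_def)
qed (auto simp: rat_field_def algebra_simps)

lemma eval_rpoly_rat_field: "eval_rpoly rat_field (\<lambda>q. q) F c = peval F c"
proof -
  interpret cring rat_field by (rule rat_field_cring)
  have ops: "x \<otimes>\<^bsub>rat_field\<^esub> y = x * y" "x \<oplus>\<^bsub>rat_field\<^esub> y = x + y" "\<one>\<^bsub>rat_field\<^esub> = 1" "\<zero>\<^bsub>rat_field\<^esub> = 0" for x y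
    by (simp_all add: rat_field_def)
  have pow: "x [^]\<^bsub>rat_field\<^esub> (k::nat) = x ^ k" for x k
    by (induction k) (auto simp: rat_field_def nat_pow_def mult.commute)
  have prd: "(\<Otimes>\<^bsub>rat_field\<^esub>i\<in>S. f i) = (\<Prod>i\<in>S. f i)" if "finite S" for S and f :: "coord \<Rightarrow> rat"
    using that
  proof (induction S rule: finite_induct)
    case (insert x S)
    then have "(\<Otimes>\<^bsub>rat_field\<^esub>i\<in>insert x S. f i) = f x \<otimes>\<^bsub>rat_field\<^esub> (\<Otimes>\<^bsub>rat_field\<^esub>i\<in>S. f i)"
      by (intro finprod_insert) (auto simp: rat_field_def)
    then show ?case using insert by (simp add: ops)
  qed (simp add: ops)
  have sm: "(\<Oplus>\<^bsub>rat_field\<^esub>m\<in>S. f m) = (\<Sum>m\<in>S. f m)" if "finite S" for S and f :: "(coord \<Rightarrow>\<^sub>0 nat) \<Rightarrow> rat"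
    using that
  proof (induction S rule: finite_induct)
    case (insert x S)
    then have "(\<Oplus>\<^bsub>rat_field\<^esub>i\<in>insert x S. f i) = f x \<oplus>\<^bsub>rat_field\<^esub> (\<Oplus>\<^bsub>rat_field\<^esub>i\<in>S. f i)"
      by (intro finsum_insert) (auto simp: rat_field_def)
    then show ?case using insert by (simp add: ops)
  qed (simp add: ops)
  show ?thesis
    unfolding eval_rpoly_def pow prd[OF finite_UNIV_coord] sm[OF finite_keys]
    by (simp add: peval_def pmonom_def ops)
qed

text \<open>Clearing denominators and dividing by the greatest common divisor gives the primitive
  integers that \<open>no_integral_points\<close> expects.\<close>

lemma rational_vector_primitive:
  fixes c :: "coord \<Rightarrow> rat"
  assumes "c \<noteq> (\<lambda>_. 0)"
  obtains k :: rat and t :: "coord \<Rightarrow> int" where "k \<noteq> 0" "\<And>i. c i = k * of_int (t i)" "Gcd (range t) = 1"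
proof -
  define D where "D = (\<Prod>i\<in>UNIV. snd (quotient_of (c i)))"
  have D: "D \<noteq> 0" using quotient_of_denom_pos'[of "c _"] by (auto simp: D_def less_le)
  have "\<exists>m::int. of_int D * c i = of_int m" for i
  proof -
    have "snd (quotient_of (c i)) dvd D" unfolding D_def by (rule dvd_prodI) auto
    then obtain e where e: "D = snd (quotient_of (c i)) * e" by blast
    have "c i = of_int (fst (quotient_of (c i))) / of_int (snd (quotient_of (c i)))"
      by (rule quotient_of_div) simp
    then have "of_int D * c i = of_int (fst (quotient_of (c i)) * e)"
      using quotient_of_denom_pos'[of "c i"] by (simp add: e field_simps)
    then show ?thesis by blast
  qed
  then obtain m where m: "\<And>i. of_int D * c i = of_int (m i)" by metis
  define g where "g = Gcd (range m)"
  obtain j where j: "c j \<noteq> 0" using assms by auto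
  have "m j \<noteq> 0" using m[of j] D j by (metis mult_eq_0_iff of_int_0 of_int_eq_0_iff)
  then have g: "g \<noteq> 0" by (auto simp: g_def Gcd_0_iff)
  define t where "t i = m i div g" for i
  have t: "m i = g * t i" for i by (simp add: t_def g_def)
  show ?thesis
  proof (rule that[of "of_int g / of_int D" t])
    show "of_int g / of_int D \<noteq> (0::rat)" using g D by simp
    show "c i = of_int g / of_int D * of_int (t i)" for i using m[of i] t[of i] D by (simp add: field_simps)
    have "range m = (*) g ` range t" using t by auto
    then have "Gcd (range m) = normalize (g * Gcd (range t))" by (simp only: Gcd_mult)
    then have "\<bar>g\<bar> = \<bar>g * Gcd (range t)\<bar>" unfolding g_def[symmetric] by simp
    then have "\<bar>g\<bar> * 1 = \<bar>g\<bar> * Gcd (range t)" by (simp add: abs_mult)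
    then show "Gcd (range t) = 1" using g by simp
  qed
qed

context surface_parameters
begin

lemma rational_points_empty: "rational_points p a b = {}"
proof -
  have False if P: "P \<in> rational_points p a b" for P
  proof -
    have zero: "\<zero>\<^bsub>rat_field\<^esub> = 0" by (simp add: rat_field_def)
    obtain c :: "coord \<Rightarrow> rat" where c: "c \<noteq> (\<lambda>_. 0)" and q: "peval (quadric1 p) c = 0" "peval (quadric2 p a b) c = 0"
      using P by (auto simp: surface_points_def eval_rpoly_rat_field zero)
    obtain k t where k: "k \<noteq> 0" and ct: "\<And>i. c i = k * of_int (t i)" and gcd: "Gcd (range t) = 1"
      by (rule rational_vector_primitive[OF c]) blast
    have "k * k * of_int ((t Cy)\<^sup>2 - p * (t Cx)\<^sup>2 - t Cu * t Cv) = 0"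
      using q(1) by (simp add: quadric1_def ct power2_eq_square algebra_simps)
    then have e1: "(t Cy)\<^sup>2 - p * (t Cx)\<^sup>2 = t Cu * t Cv"
      using k by (simp only: mult_eq_0_iff of_int_eq_0_iff) simp
    have "k * k * of_int ((t Cz)\<^sup>2 - p * (t Cx)\<^sup>2 - (t Cu + t Cv) * (a * t Cu + b * t Cv)) = 0"
      using q(2) by (simp add: quadric2_def ct power2_eq_square algebra_simps)
    then have e2: "(t Cz)\<^sup>2 - p * (t Cx)\<^sup>2 = (t Cu + t Cv) * (a * t Cu + b * t Cv)"
      using k by (simp only: mult_eq_0_iff of_int_eq_0_iff) simp
    have "range t = {t Cx, t Cy, t Cz, t Cu, t Cv}" by (simp add: UNIV_coord)
    then show False using no_integral_points[OF e1 e2] gcd by simp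
  qed
  then show ?thesis by blast
qed

end

theorem theorem6p11:
  fixes p a b :: int
  assumes "prime p" and "odd p"
    and "(a + b - 1)\<^sup>2 - 4 * a * b = p"
    and "[4 * a = 1] (mod p)" and "[4 * b = 1] (mod p)"
    and "[a = 1] (mod 2)" and "[b = 1] (mod 2)"
    and "[a = 1] (mod 8)"
  shows "brauer_manin_set p a b = {} \<and> rational_points p a b = {}"
proof -
  have "odd a" "odd b" using assms(6,7) by (auto simp: cong_def)
  then interpret surface_parameters p a b using assms by unfold_locales
  show ?thesis using brauer_manin_set_empty rational_points_empty by simp
qed

end
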